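(* Every split graph that has no induced subgraph isomorphic to $H$ and is clique-Sperner has clique-width at most $5$. Moreover, given such a graph $G$, one can compute in time $\mathcal{O}(|V(G)|^4)$ a $5$-expression $\tau$ of $G$ with $|\tau|=\mathcal{O}(|V(G)|)$.
   Context: A split partition of $G$ is a partition $(K,I)$ of $V(G)$ into a clique $K$ and an independent set $I$; $G$ is split if it has one. A split graph $G$ is clique-Sperner if it has a split partition $(K,I)$ such that for all $u,v\in K$, $N(u)\cap I\subseteq N(v)\cap I$ implies $u=v$. $H$ is the graph on vertices $c_1,c_2,x_1,y_1,x_2,y_2$ with edges $c_1c_2,c_1x_1,c_1y_1,c_2x_2,c_2y_2$. A $k$-graph is a graph with vertex labels from $\{1,\dots,k\}$. A $k$-expression is an expression built from: $i(v)$ (create vertex $v$ with label $i$), $G_1\oplus G_2$ (disjoint union), $\rho_{i\to j}$ (relabel every vertex with label $i$ to label $j$), and $\eta_{i,j}$ for $i\ne j$ (add all edges between vertices labeled $i$ and vertices labeled $j$). The clique-width of $G$ is the least $k$ such that some $k$-expression produces a $k$-graph isomorphic to $G$. $|\tau|$ is the number of symbols of the expression $\tau$. *)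

theory Defs
  imports "Graph_Theory.Graph_Theory" "HOL-Library.Extended_Nat"
begin

section \<open>Graphs\<close>

text \<open>A finite simple graph is a \<^locale>\<open>pair_graph\<close>: an edge $uv$ is represented by the two
  arcs \<open>(u, v)\<close> and \<open>(v, u)\<close>.\<close>

definition nbhd :: "'a pair_pre_digraph \<Rightarrow> 'a \<Rightarrow> 'a set" where
  "nbhd G u = {v. (u, v) \<in> parcs G}"

definition clique :: "'a pair_pre_digraph \<Rightarrow> 'a set \<Rightarrow> bool" where
  "clique G K \<longleftrightarrow> K \<subseteq> pverts G \<and> (\<forall>u\<in>K. \<forall>v\<in>K. u \<noteq> v \<longrightarrow> (u, v) \<in> parcs G)"

definition independent :: "'a pair_pre_digraph \<Rightarrow> 'a set \<Rightarrow> bool" where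
  "independent G I \<longleftrightarrow> I \<subseteq> pverts G \<and> (\<forall>u\<in>I. \<forall>v\<in>I. (u, v) \<notin> parcs G)"

definition split_partition :: "'a pair_pre_digraph \<Rightarrow> 'a set \<Rightarrow> 'a set \<Rightarrow> bool" where
  "split_partition G K I \<longleftrightarrow>
     K \<union> I = pverts G \<and> K \<inter> I = {} \<and> clique G K \<and> independent G I"

definition split_graph :: "'a pair_pre_digraph \<Rightarrow> bool" where
  "split_graph G \<longleftrightarrow> (\<exists>K I. split_partition G K I)"

definition clique_Sperner :: "'a pair_pre_digraph \<Rightarrow> bool" where
  "clique_Sperner G \<longleftrightarrow>
     (\<exists>K I. split_partition G K I \<and>
       (\<forall>u\<in>K. \<forall>v\<in>K. nbhd G u \<inter> I \<subseteq> nbhd G v \<inter> I \<longrightarrow> u = v))"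

definition pair_iso :: "'a pair_pre_digraph \<Rightarrow> 'b pair_pre_digraph \<Rightarrow> bool" where
  "pair_iso G G' \<longleftrightarrow> digraph_iso (with_proj G) (with_proj G')"

definition has_induced :: "'a pair_pre_digraph \<Rightarrow> 'b pair_pre_digraph \<Rightarrow> bool" where
  "has_induced G F \<longleftrightarrow>
     (\<exists>S. induced_subgraph (with_proj S) (with_proj G) \<and> pair_iso S F)"

definition sym_closure :: "('a \<times> 'a) set \<Rightarrow> ('a \<times> 'a) set" where
  "sym_closure r = r \<union> r\<inverse>"

datatype H_vertex = C1 | C2 | X1 | Y1 | X2 | Y2

definition H_graph :: "H_vertex pair_pre_digraph" where
  "H_graph = \<lparr> pverts = UNIV,
     parcs = sym_closure {(C1, C2), (C1, X1), (C1, Y1), (C2, X2), (C2, Y2)} \<rparr>"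

lemma pair_graph_H_graph: "pair_graph H_graph"
proof -
  have "(UNIV :: H_vertex set) \<subseteq> set [C1, C2, X1, Y1, X2, Y2]"
  proof
    fix v :: H_vertex
    show "v \<in> set [C1, C2, X1, Y1, X2, Y2]" by (cases v) simp_all
  qed
  then have "finite (UNIV :: H_vertex set)"
    by (rule finite_subset) simp
  then show ?thesis
    by unfold_locales (auto simp: H_graph_def sym_closure_def symmetric_def sym_def)
qed


section \<open>Clique-width\<close>

datatype 'a cw_expr =
    Create nat 'a
  | DUnion "'a cw_expr" "'a cw_expr"
  | Relabel nat nat "'a cw_expr"
  | Join nat nat "'a cw_expr"

text \<open>A labelled graph is a graph together with a labelling function, whose values outside
  the vertex set are irrelevant.\<close>

type_synonym 'a lgraph = "'a pair_pre_digraph \<times> ('a \<Rightarrow> nat)"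

fun lg_union :: "'a lgraph \<Rightarrow> 'a lgraph \<Rightarrow> 'a lgraph" where
  "lg_union (G1, l1) (G2, l2) =
     (\<lparr> pverts = pverts G1 \<union> pverts G2, parcs = parcs G1 \<union> parcs G2 \<rparr>,
      \<lambda>v. if v \<in> pverts G1 then l1 v else l2 v)"

fun lg_relabel :: "nat \<Rightarrow> nat \<Rightarrow> 'a lgraph \<Rightarrow> 'a lgraph" where
  "lg_relabel i j (G, l) = (G, \<lambda>v. if l v = i then j else l v)"

fun lg_join :: "nat \<Rightarrow> nat \<Rightarrow> 'a lgraph \<Rightarrow> 'a lgraph" where
  "lg_join i j (G, l) =
     (\<lparr> pverts = pverts G,
        parcs = parcs G \<union> sym_closure {(u, v). u \<in> pverts G \<and> v \<in> pverts G \<and> l u = i \<and> l v = j} \<rparr>,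
      l)"

primrec lg_of :: "'a cw_expr \<Rightarrow> 'a lgraph" where
  "lg_of (Create i v) = (\<lparr> pverts = {v}, parcs = {} \<rparr>, \<lambda>_. i)"
| "lg_of (DUnion e f) = lg_union (lg_of e) (lg_of f)"
| "lg_of (Relabel i j e) = lg_relabel i j (lg_of e)"
| "lg_of (Join i j e) = lg_join i j (lg_of e)"

abbreviation graph_of :: "'a cw_expr \<Rightarrow> 'a pair_pre_digraph" where
  "graph_of e \<equiv> fst (lg_of e)"

text \<open>The operands of a disjoint union must be vertex-disjoint; hence every vertex is created
  at most once.\<close>

primrec k_expression :: "nat \<Rightarrow> 'a cw_expr \<Rightarrow> bool" where
  "k_expression k (Create i v) \<longleftrightarrow> i \<in> {1..k}"
| "k_expression k (DUnion e f) \<longleftrightarrow>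
     k_expression k e \<and> k_expression k f \<and> pverts (graph_of e) \<inter> pverts (graph_of f) = {}"
| "k_expression k (Relabel i j e) \<longleftrightarrow> i \<in> {1..k} \<and> j \<in> {1..k} \<and> k_expression k e"
| "k_expression k (Join i j e) \<longleftrightarrow> i \<in> {1..k} \<and> j \<in> {1..k} \<and> i \<noteq> j \<and> k_expression k e"

text \<open>The value is \<open>\<infinity>\<close> if no expression exists, which for finite graphs happens only for the
  graph without vertices. Letting the created vertices range over the vertex type of \<open>G\<close> loses
  nothing, since that type contains the vertices of \<open>G\<close> itself.\<close>

definition clique_width :: "'a pair_pre_digraph \<Rightarrow> enat" where
  "clique_width G =
     Inf {enat k | k. \<exists>e :: 'a cw_expr. k_expression k e \<and> pair_iso (graph_of e) G}"

text \<open>Expressions as words in prefix notation, without brackets: the operation, each of its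
  labels and the name of a created vertex count as one symbol each.\<close>

primrec expr_size :: "'a cw_expr \<Rightarrow> nat" where
  "expr_size (Create i v) = 3"
| "expr_size (DUnion e f) = 1 + expr_size e + expr_size f"
| "expr_size (Relabel i j e) = 3 + expr_size e"
| "expr_size (Join i j e) = 3 + expr_size e"

primrec code :: "nat cw_expr \<Rightarrow> nat list" where
  "code (Create i v) = [0, i, v]"
| "code (DUnion e f) = 1 # code e @ code f"
| "code (Relabel i j e) = 2 # i # j # code e"
| "code (Join i j e) = 3 # i # j # code e"

lemma length_code: "length (code e) = expr_size e"
  by (induction e) auto


section \<open>A word random access machine\<close>

text \<open>Structured programs over finitely many variables and finitely many arrays of natural
  numbers. Every arithmetic operation, comparison, memory access and branch costs one time unit.
  To keep unit costs realistic, all values and addresses that occur must be smaller than a bound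
  \<open>W\<close>, that is, they must fit into a machine word; an execution exceeding the bound is stuck
  and has no result.\<close>

datatype aexp =
    Const nat
  | Var nat
  | Arr nat aexp
  | Add aexp aexp
  | Sub aexp aexp
  | Mul aexp aexp

datatype bexp =
    Less aexp aexp
  | Eq aexp aexp
  | Not bexp
  | And bexp bexp

datatype com =
    Skip
  | Assign nat aexp
  | Store nat aexp aexp
  | Seq com com
  | Cond bexp com com
  | While bexp com

record state =
  vars :: "nat \<Rightarrow> nat"
  arrs :: "nat \<Rightarrow> nat \<Rightarrow> nat"

primrec aval :: "aexp \<Rightarrow> state \<Rightarrow> nat" where
  "aval (Const c) s = c"
| "aval (Var x) s = vars s x"
| "aval (Arr a e) s = arrs s a (aval e s)"
| "aval (Add e f) s = aval e s + aval f s"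
| "aval (Sub e f) s = aval e s - aval f s"
| "aval (Mul e f) s = aval e s * aval f s"

primrec bval :: "bexp \<Rightarrow> state \<Rightarrow> bool" where
  "bval (Less e f) s \<longleftrightarrow> aval e s < aval f s"
| "bval (Eq e f) s \<longleftrightarrow> aval e s = aval f s"
| "bval (Not b) s \<longleftrightarrow> \<not> bval b s"
| "bval (And b c) s \<longleftrightarrow> bval b s \<and> bval c s"

primrec afits :: "nat \<Rightarrow> aexp \<Rightarrow> state \<Rightarrow> bool" where
  "afits W (Const c) s \<longleftrightarrow> c < W"
| "afits W (Var x) s \<longleftrightarrow> vars s x < W"
| "afits W (Arr a e) s \<longleftrightarrow> afits W e s \<and> arrs s a (aval e s) < W"
| "afits W (Add e f) s \<longleftrightarrow> afits W e s \<and> afits W f s \<and> aval e s + aval f s < W"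
| "afits W (Sub e f) s \<longleftrightarrow> afits W e s \<and> afits W f s"
| "afits W (Mul e f) s \<longleftrightarrow> afits W e s \<and> afits W f s \<and> aval e s * aval f s < W"

primrec bfits :: "nat \<Rightarrow> bexp \<Rightarrow> state \<Rightarrow> bool" where
  "bfits W (Less e f) s \<longleftrightarrow> afits W e s \<and> afits W f s"
| "bfits W (Eq e f) s \<longleftrightarrow> afits W e s \<and> afits W f s"
| "bfits W (Not b) s \<longleftrightarrow> bfits W b s"
| "bfits W (And b c) s \<longleftrightarrow> bfits W b s \<and> bfits W c s"

primrec acost :: "aexp \<Rightarrow> nat" where
  "acost (Const c) = 1"
| "acost (Var x) = 1"
| "acost (Arr a e) = 1 + acost e"
| "acost (Add e f) = 1 + acost e + acost f"
| "acost (Sub e f) = 1 + acost e + acost f"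
| "acost (Mul e f) = 1 + acost e + acost f"

primrec bcost :: "bexp \<Rightarrow> nat" where
  "bcost (Less e f) = 1 + acost e + acost f"
| "bcost (Eq e f) = 1 + acost e + acost f"
| "bcost (Not b) = 1 + bcost b"
| "bcost (And b c) = 1 + bcost b + bcost c"

text \<open>\<open>exec W c s t s'\<close>: with word bound \<open>W\<close>, program \<open>c\<close> started in state \<open>s\<close> halts after
  \<open>t\<close> time units in state \<open>s'\<close>.\<close>

inductive exec :: "nat \<Rightarrow> com \<Rightarrow> state \<Rightarrow> nat \<Rightarrow> state \<Rightarrow> bool" for W where
  Skip: "exec W Skip s 1 s"
| Assign: "afits W e s \<Longrightarrow>
    exec W (Assign x e) s (1 + acost e) (s\<lparr>vars := (vars s)(x := aval e s)\<rparr>)"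
| Store: "afits W i s \<Longrightarrow> afits W e s \<Longrightarrow>
    exec W (Store a i e) s (1 + acost i + acost e)
      (s\<lparr>arrs := (arrs s)(a := (arrs s a)(aval i s := aval e s))\<rparr>)"
| Seq: "exec W c s t s' \<Longrightarrow> exec W d s' t' s'' \<Longrightarrow> exec W (Seq c d) s (t + t') s''"
| CondTrue: "bfits W b s \<Longrightarrow> bval b s \<Longrightarrow> exec W c s t s' \<Longrightarrow>
    exec W (Cond b c d) s (1 + bcost b + t) s'"
| CondFalse: "bfits W b s \<Longrightarrow> \<not> bval b s \<Longrightarrow> exec W d s t s' \<Longrightarrow>
    exec W (Cond b c d) s (1 + bcost b + t) s'"
| WhileFalse: "bfits W b s \<Longrightarrow> \<not> bval b s \<Longrightarrow> exec W (While b c) s (1 + bcost b) s"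
| WhileTrue: "bfits W b s \<Longrightarrow> bval b s \<Longrightarrow> exec W c s t s' \<Longrightarrow> exec W (While b c) s' t' s'' \<Longrightarrow>
    exec W (While b c) s (1 + bcost b + t + t') s''"

lemma exec_deterministic:
  "exec W c s t s' \<Longrightarrow> exec W c s u s'' \<Longrightarrow> u = t \<and> s'' = s'"
proof (induction arbitrary: u s'' rule: exec.induct)
  case (Seq c s t s' d t' s1)
  from Seq.prems obtain t2 s2 t3
    where "exec W c s t2 s2" "exec W d s2 t3 s''" "u = t2 + t3"
    by cases
  with Seq.IH show ?case by metis
next
  case (WhileTrue b s c t s' t' s1)
  from WhileTrue.prems WhileTrue.hyps obtain t2 s2 t3
    where "exec W c s t2 s2" "exec W (While b c) s2 t3 s''" "u = 1 + bcost b + t2 + t3"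
    by cases simp_all
  with WhileTrue.IH show ?case by metis
next
  case (CondTrue b s c t s' d)
  from CondTrue.prems CondTrue.hyps obtain t2
    where "exec W c s t2 s''" "u = 1 + bcost b + t2"
    by cases simp_all
  with CondTrue.IH show ?case by metis
next
  case (CondFalse b s d t s' c)
  from CondFalse.prems CondFalse.hyps obtain t2
    where "exec W d s t2 s''" "u = 1 + bcost b + t2"
    by cases simp_all
  with CondFalse.IH show ?case by metis
next
  case (WhileFalse b s c)
  from WhileFalse.prems WhileFalse.hyps show ?case by cases simp_all
next
  case (Skip s)
  then show ?case by cases simp_all
next
  case (Assign e s x)
  from Assign.prems show ?case by cases simp_all
next
  case (Store i s e a)
  from Store.prems show ?case by cases simp_all
qed

text \<open>A graph on the vertices \<open>0, \<dots>, n - 1\<close> is given by \<open>n\<close> in variable 0 and its adjacency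
  matrix, row by row, in array 0; all other memory is zero. A word is returned in array 1,
  its length in variable 1.\<close>

definition input_state :: "nat \<Rightarrow> nat pair_pre_digraph \<Rightarrow> state" where
  "input_state n G =
     \<lparr> vars = (\<lambda>_. 0)(0 := n),
       arrs = (\<lambda>_ _. 0)(0 := \<lambda>i. if i < n * n \<and> (i div n, i mod n) \<in> parcs G then 1 else 0) \<rparr>"

definition outputs :: "state \<Rightarrow> nat list \<Rightarrow> bool" where
  "outputs s xs \<longleftrightarrow> vars s 1 = length xs \<and> (\<forall>i < length xs. arrs s 1 i = xs ! i)"

end

theory Submission
  imports Defs
begin

text \<open>For distinct clique vertices \<open>u\<close>, \<open>v\<close> the private neighbourhoods \<open>N\<^sub>I(u) - N\<^sub>I(v)\<close> and
  \<open>N\<^sub>I(v) - N\<^sub>I(u)\<close> are nonempty by the Sperner condition, and one of them is a singleton since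
  there is no induced \<open>H\<close>. If \<open>u\<close> has the least and \<open>w\<close> the largest degree in the clique, then
  the private neighbour \<open>z\<close> of \<open>u\<close> with respect to \<open>w\<close> splits the rest of the graph into a lower
  part, the clique vertices adjacent to \<open>z\<close> and their other neighbours, and an upper part: every
  upper clique vertex is complete to the lower part, and there are no other edges between lower and
  upper part. Hence expressions of the two parts with two labels each, together with a fifth label
  for \<open>z\<close>, combine to an expression of the graph. Both parts inherit the hypotheses and the order
  by degree. The algorithm recurses with an explicit stack of pending upper parts and emits the
  expression in prefix order, taking quadratic time for each vertex \<open>z\<close>.\<close>

section \<open>Decomposition of clique-Sperner split graphs\<close>

text \<open>The parts inherit the hypotheses because the clique vertices of a part agree on every
  independent vertex outside it (\<open>module\<close>), so private neighbours of two of them stay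
  inside the part. Hence the degrees of \<open>G\<close>, computed once, order the clique within
  every part, and nothing has to be restated for induced subgraphs.

  The obstacle for the algorithm is that the expression is unknown while its code is being written.
  In prefix order the operations above an operand precede it, so they can be written first; only the
  second operand of a union has to wait, which is why upper parts are stacked and the lower part is
  treated at once. Correctness is therefore a statement about continuations: whatever expressions
  the pending parts receive, the word written so far, followed by their codes, encodes an expression
  of \<open>G\<close>. Linear size holds because each round retires a vertex and writes at most 30
  symbols. Preprocessing and main loop both take cubic time, within the required fourth
  power.\<close>

definition priv :: "'a pair_pre_digraph \<Rightarrow> 'a set \<Rightarrow> 'a \<Rightarrow> 'a \<Rightarrow> 'a set" where
  "priv G I u v = nbhd G u \<inter> I - nbhd G v"

section \<open>Isomorphisms and induced copies of \<open>H\<close>\<close>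

lemma pair_iso_refl:
  assumes "pair_wf_digraph G"
  shows "pair_iso G G"
proof -
  interpret pair_wf_digraph G by fact
  let ?f = "\<lparr>iso_verts = id, iso_arcs = id, iso_head = snd, iso_tail = fst\<rparr>"
  have "digraph_isomorphism ?f"
    unfolding digraph_isomorphism_def using wf_digraph_axioms by simp
  moreover have "with_proj G = app_iso ?f (with_proj G)"
    by (simp add: app_iso_def with_proj_def)
  ultimately show ?thesis unfolding pair_iso_def digraph_iso_def by blast
qed

lemma pair_isoI:
  assumes "pair_wf_digraph G" "inj_on f (pverts G)" "f ` pverts G = pverts H"
    "map_prod f f ` parcs G = parcs H"
  shows "pair_iso G H"
proof -
  interpret pair_wf_digraph G by fact
  let ?f = "\<lparr>iso_verts = f, iso_arcs = map_prod f f, iso_head = snd, iso_tail = fst\<rparr>"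
  have "inj_on (map_prod f f) (parcs G)"
    using map_prod_inj_on[OF assms(2) assms(2)]
    by (rule inj_on_subset) (use in_arcsD1 in_arcsD2 in \<open>simp add: subrelI\<close>)
  then have "digraph_isomorphism ?f"
    unfolding digraph_isomorphism_def using wf_digraph_axioms assms(2) by simp
  moreover have "with_proj H = app_iso ?f (with_proj G)"
    using assms(3,4) by (simp add: app_iso_def with_proj_def)
  ultimately show ?thesis unfolding pair_iso_def digraph_iso_def by blast
qed

lemma has_inducedI:
  assumes G: "pair_wf_digraph G" and H: "pair_wf_digraph H"
    and f: "inj_on f (pverts H)" "f ` pverts H \<subseteq> pverts G"
    and arcs: "\<And>p q. p \<in> pverts H \<Longrightarrow> q \<in> pverts H \<Longrightarrow> (f p, f q) \<in> parcs G \<longleftrightarrow> (p, q) \<in> parcs H"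
  shows "has_induced G H"
proof -
  let ?V = "f ` pverts H"
  define S where "S = \<lparr>pverts = ?V, parcs = parcs G \<inter> ?V \<times> ?V\<rparr>"
  have wfS: "pair_wf_digraph S" by unfold_locales (auto simp: S_def)
  have "subgraph (with_proj S) (with_proj G)"
    unfolding subgraph_def using f(2) G wfS
    by (simp add: S_def compatible_def wf_digraph_wp_iff)
  then have "induced_subgraph (with_proj S) (with_proj G)"
    unfolding induced_subgraph_def by (auto simp: S_def)
  moreover have "pair_iso S H"
  proof (rule pair_isoI[OF wfS])
    \<comment> \<open>\<open>pair_iso S H\<close> asks for a map out of the subgraph, so the
      embedding \<open>f\<close> is inverted.\<close>
    let ?g = "the_inv_into (pverts H) f"
    have g: "?g (f p) = p" if "p \<in> pverts H" for p using the_inv_into_f_f[OF f(1) that] .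
    show "inj_on ?g (pverts S)" unfolding S_def using inj_on_the_inv_into[OF f(1)] by simp
    show "?g ` pverts S = pverts H" using g by (force simp: S_def)
    show "map_prod ?g ?g ` parcs S = parcs H"
    proof (intro set_eqI iffI)
      fix e assume "e \<in> map_prod ?g ?g ` parcs S"
      then obtain p q where "p \<in> pverts H" "q \<in> pverts H" "(f p, f q) \<in> parcs G" "e = (?g (f p), ?g (f q))"
        by (auto simp: S_def)
      then show "e \<in> parcs H" using arcs g by simp
    next
      fix e assume e: "e \<in> parcs H"
      obtain p q where pq: "e = (p, q)" by fastforce
      with e H have "p \<in> pverts H" "q \<in> pverts H"
        using pair_wf_digraph.in_arcsD1 pair_wf_digraph.in_arcsD2 by metis+
      then have "(f p, f q) \<in> parcs S" "e = map_prod ?g ?g (f p, f q)"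
        using e pq arcs g by (auto simp: S_def)
      then show "e \<in> map_prod ?g ?g ` parcs S" by (rule rev_image_eqI)
    qed
  qed
  ultimately show ?thesis unfolding has_induced_def by blast
qed

text \<open>The clique edge \<open>uv\<close> becomes the central edge and the private neighbours
  become the leaves: a private neighbour misses the other centre by definition, and the leaves lie
  in the independent set.\<close>

lemma has_induced_H_graph:
  assumes G: "pair_graph G" and sp: "split_partition G K I" and uv: "u \<in> K" "v \<in> K" "u \<noteq> v"
    and x: "x1 \<in> priv G I u v" "y1 \<in> priv G I u v" "x1 \<noteq> y1"
      "x2 \<in> priv G I v u" "y2 \<in> priv G I v u" "x2 \<noteq> y2"
  shows "has_induced G H_graph"
proof -
  interpret pair_graph G by fact
  have sym: "(b, a) \<in> parcs G" if "(a, b) \<in> parcs G" for a b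
    using arcs_symmetric that .
  have noloop: "(a, a) \<notin> parcs G" for a using pair_no_loops[of "(a, a)"] by auto
  have ind: "(a, b) \<notin> parcs G" if "a \<in> I" "b \<in> I" for a b
    using sp that unfolding split_partition_def independent_def by blast
  have inI: "x1 \<in> I" "y1 \<in> I" "x2 \<in> I" "y2 \<in> I" using x unfolding priv_def by auto
  have e: "(u, v) \<in> parcs G" "(u, x1) \<in> parcs G" "(u, y1) \<in> parcs G" "(v, x2) \<in> parcs G" "(v, y2) \<in> parcs G"
    using x sp uv unfolding priv_def nbhd_def split_partition_def clique_def by blast+
  have n: "(v, x1) \<notin> parcs G" "(v, y1) \<notin> parcs G" "(u, x2) \<notin> parcs G" "(u, y2) \<notin> parcs G"
    using x unfolding priv_def nbhd_def by blast+
  note e' = e[THEN sym]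
  have n': "(x1, v) \<notin> parcs G" "(y1, v) \<notin> parcs G" "(x2, u) \<notin> parcs G" "(y2, u) \<notin> parcs G"
    using n sym by blast+
  have "u \<noteq> a" "v \<noteq> a" if "a \<in> I" for a using that uv sp unfolding split_partition_def by auto
  note ne = this[OF inI(1)] this[OF inI(2)] this[OF inI(3)] this[OF inI(4)]
  have ne2: "x1 \<noteq> x2" "x1 \<noteq> y2" "y1 \<noteq> x2" "y1 \<noteq> y2" using e n by metis+
  note neq = ne ne[symmetric] ne2 ne2[symmetric] uv(3) uv(3)[symmetric] x(3,6) x(3,6)[symmetric]
  note nI = ind[OF inI(1)] ind[OF inI(2)] ind[OF inI(3)] ind[OF inI(4)]
  let ?f = "case_H_vertex u v x1 y1 x2 y2"
  show ?thesis
  proof (rule has_inducedI)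
    show "pair_wf_digraph G" by (rule pair_wf_digraph_axioms)
    show "pair_wf_digraph H_graph"
      using pair_graph_H_graph unfolding pair_graph_def pair_digraph_def pair_fin_digraph_def by blast
    have "?f p = ?f q \<longrightarrow> p = q" for p q by (cases p; cases q) (simp_all add: neq)
    then show "inj_on ?f (pverts H_graph)" by (auto intro: inj_onI)
    have "?f p \<in> pverts G" for p
      using uv inI sp unfolding split_partition_def by (cases p) auto
    then show "?f ` pverts H_graph \<subseteq> pverts G" by auto
    show "(?f p, ?f q) \<in> parcs G \<longleftrightarrow> (p, q) \<in> parcs H_graph" for p q
      by (cases p; cases q) (simp_all add: H_graph_def sym_closure_def e e' n n' noloop nI inI)
  qed
qed

text \<open>In hypergraph terms the sets \<open>nbhd G u \<inter> I\<close>, for \<open>u\<close> in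
  \<open>K\<close>, are the hyperedges of a 1-Sperner hypergraph on \<open>I\<close>. The minimum is
  at least 1 by the Sperner condition and at most 1 by the exclusion of \<open>H\<close>; both
  hypotheses enter the decomposition only in this form.\<close>

locale one_Sperner_split =
  fixes G :: "'a pair_pre_digraph" and K I :: "'a set"
  assumes pair_graph_G: "pair_graph G"
    and part: "split_partition G K I"
    and one_Sperner: "u \<in> K \<Longrightarrow> v \<in> K \<Longrightarrow> u \<noteq> v \<Longrightarrow>
      min (card (priv G I u v)) (card (priv G I v u)) = 1"

lemma one_Sperner_splitI:
  assumes G: "pair_graph G" and sp: "split_partition G K I" and H: "\<not> has_induced G H_graph"
    and Sp: "\<And>u v. u \<in> K \<Longrightarrow> v \<in> K \<Longrightarrow> nbhd G u \<inter> I \<subseteq> nbhd G v \<inter> I \<Longrightarrow> u = v"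
  shows "one_Sperner_split G K I"
proof (rule one_Sperner_split.intro)
  show "pair_graph G" "split_partition G K I" by fact+
  interpret pair_graph G by fact
  have fin: "finite (priv G I a b)" for a b
  proof (rule finite_subset)
    show "priv G I a b \<subseteq> pverts G" using sp unfolding priv_def split_partition_def by auto
  qed (rule pair_finite_verts)
  fix u v assume uv: "u \<in> K" "v \<in> K" "u \<noteq> v"
  have ge: "card (priv G I a b) \<ge> 1" if "a \<in> K" "b \<in> K" "a \<noteq> b" for a b
  proof -
    have "priv G I a b \<noteq> {}" using Sp[of a b] that unfolding priv_def by blast
    then show ?thesis using fin by (simp add: Suc_le_eq card_gt_0_iff)
  qed
  have two: "\<exists>x y. x \<in> priv G I a b \<and> y \<in> priv G I a b \<and> x \<noteq> y" if "card (priv G I a b) \<ge> 2" for a b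
  proof (rule ccontr)
    assume "\<not> ?thesis"
    then have "card (priv G I a b) \<le> Suc 0" using card_le_Suc0_iff_eq[OF fin] by blast
    then show False using that by simp
  qed
  show "min (card (priv G I u v)) (card (priv G I v u)) = 1"
  proof (rule ccontr)
    assume "min (card (priv G I u v)) (card (priv G I v u)) \<noteq> 1"
    with ge[of u v] ge[of v u] uv have "card (priv G I u v) \<ge> 2" "card (priv G I v u) \<ge> 2"
      by auto
    with two[of u v] two[of v u] has_induced_H_graph[OF G sp uv] H show False by blast
  qed
qed

section \<open>Degrees, private neighbourhoods and separating vertices\<close>

context one_Sperner_split
begin

sublocale pair_graph G by (fact pair_graph_G)

abbreviation adj :: "'a \<Rightarrow> 'a \<Rightarrow> bool" where "adj u v \<equiv> (u, v) \<in> parcs G"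

definition deg :: "'a \<Rightarrow> nat" where "deg u = card (nbhd G u)"

lemma adj_sym: "adj u v \<longleftrightarrow> adj v u"
  using arcs_symmetric by blast

lemma adj_irrefl: "\<not> adj u u"
  using pair_no_loops by fastforce

lemma adj_K: "u \<in> K \<Longrightarrow> v \<in> K \<Longrightarrow> adj u v \<longleftrightarrow> u \<noteq> v"
  using part adj_irrefl unfolding split_partition_def clique_def by auto

lemma adj_I: "u \<in> I \<Longrightarrow> v \<in> I \<Longrightarrow> \<not> adj u v"
  using part unfolding split_partition_def independent_def by blast

lemma K_Un_I: "K \<union> I = pverts G" and K_Int_I: "K \<inter> I = {}"
  using part unfolding split_partition_def by auto

lemma finite_K: "finite K" and finite_I: "finite I"
  using K_Un_I pair_finite_verts by (metis finite_Un)+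

lemma mem_priv: "x \<in> priv G I u v \<longleftrightarrow> x \<in> I \<and> adj u x \<and> \<not> adj v x"
  unfolding priv_def nbhd_def by auto

text \<open>All clique vertices have equally many neighbours in \<open>K\<close>, so comparing their
  degrees in \<open>G\<close> compares their neighbourhoods in \<open>I\<close>.\<close>

lemma deg_K: assumes "u \<in> K" shows "deg u = card K - 1 + card (nbhd G u \<inter> I)"
proof -
  have "nbhd G u = (K - {u}) \<union> (nbhd G u \<inter> I)"
    using assms adj_K K_Un_I K_Int_I in_arcsD2 unfolding nbhd_def by blast
  moreover have "card ((K - {u}) \<union> (nbhd G u \<inter> I)) = card (K - {u}) + card (nbhd G u \<inter> I)"
    using finite_K finite_I K_Int_I by (intro card_Un_disjoint) auto
  ultimately show ?thesis using assms unfolding deg_def by simp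
qed

lemma priv_singleton:
  assumes "u \<in> K" "v \<in> K" "u \<noteq> v" "deg u \<le> deg v"
  shows "\<exists>x. priv G I u v = {x}"
proof -
  let ?U = "nbhd G u \<inter> I" and ?V = "nbhd G v \<inter> I"
  have "card ?U \<le> card ?V" using assms deg_K by simp
  moreover have "priv G I u v = ?U - ?V" "priv G I v u = ?V - ?U" unfolding priv_def by auto
  moreover have fin: "finite ?U" "finite ?V" using finite_I by auto
  \<comment> \<open>Both sides count \<open>?U \<union> ?V\<close>, so the smaller neighbourhood has
    the smaller difference.\<close>
  moreover have "card ?U + card (?V - ?U) = card ?V + card (?U - ?V)"
    using card_Un_disjoint[of ?U "?V - ?U"] card_Un_disjoint[of ?V "?U - ?V"] fin
    by (simp add: Un_commute)
  ultimately have "card (priv G I u v) \<le> card (priv G I v u)" by simp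
  then have "card (priv G I u v) = 1" using one_Sperner[OF assms(1-3)] by simp
  then show ?thesis by (simp add: card_1_singleton_iff)
qed

text \<open>The vertex \<open>z\<close> that the smallest neighbourhood has in excess of the largest one separates
  the clique vertices: each \<open>e\<close> adjacent to \<open>z\<close> has, apart from \<open>z\<close>, only neighbours of
  each \<open>f\<close> not adjacent to \<open>z\<close>.\<close>

lemma extremal_separates:
  assumes T: "T \<subseteq> K" and u: "u \<in> T" "\<And>e. e \<in> T \<Longrightarrow> deg u \<le> deg e"
    and w: "w \<in> T" "\<And>e. e \<in> T \<Longrightarrow> deg e \<le> deg w"
    and z: "z \<in> I" "adj u z" "\<not> adj w z"
    and ef: "e \<in> T" "f \<in> T" "adj e z" "\<not> adj f z" and x: "x \<in> I" "x \<noteq> z" "adj e x"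
  shows "adj f x"
proof (rule ccontr)
  assume nx: "\<not> adj f x"
  note sing = priv_singleton
  have Kin: "a \<in> T \<Longrightarrow> a \<in> K" for a using T by blast
  obtain q where q: "priv G I e w = {q}" using sing[of e w] w ef z Kin by metis
  have "q = z" using q mem_priv[of z e w] z ef by auto
  with q have ew: "priv G I e w = {z}" by simp
  have xw: "adj w x" using ew mem_priv[of x e w] x by auto
  have fw: "f \<noteq> w" using xw nx by auto
  obtain y where y: "priv G I f w = {y}" using sing[of f w] w ef fw Kin by metis
  have "e \<noteq> f" using ef by auto
  \<comment> \<open>Otherwise \<open>e\<close> would have a single private neighbour against
    \<open>f\<close>, but \<open>x\<close> and \<open>z\<close> are two.\<close>
  have "\<not> deg e \<le> deg f"
  proof
    assume "deg e \<le> deg f"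
    then obtain p where "priv G I e f = {p}" using sing[of e f] ef \<open>e \<noteq> f\<close> Kin by metis
    moreover have "x \<in> priv G I e f" "z \<in> priv G I e f" using mem_priv x nx z ef by auto
    ultimately show False using \<open>x \<noteq> z\<close> by auto
  qed
  then have dfe: "deg f \<le> deg e" "u \<noteq> e" using u ef by auto
  \<comment> \<open>The only private neighbour \<open>y'\<close> of \<open>f\<close> against
    \<open>e\<close> will turn out to be both \<open>r\<close>, which is adjacent to
    \<open>w\<close>, and \<open>y\<close>, which is not.\<close>
  obtain y' where y': "priv G I f e = {y'}" using sing[of f e] ef \<open>e \<noteq> f\<close> dfe Kin by metis
  have "u \<noteq> f" using z ef by auto
  obtain p where p: "priv G I u f = {p}" using sing[of u f] u ef \<open>u \<noteq> f\<close> Kin by metis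
  have "p = z" using p mem_priv[of z u f] z ef by auto
  obtain r where r: "priv G I u e = {r}" using sing[of u e] u ef dfe Kin by metis
  then have r1: "r \<in> I" "adj u r" "\<not> adj e r" using mem_priv[of r u e] by auto
  have "r \<noteq> z" using r1 ef by auto
  have "u \<noteq> w" using z by auto
  obtain s where s: "priv G I u w = {s}" using sing[of u w] u w \<open>u \<noteq> w\<close> Kin by metis
  have "s = z" using s mem_priv[of z u w] z by auto
  have rf: "adj f r" using p mem_priv[of r u f] r1 \<open>p = z\<close> \<open>r \<noteq> z\<close> by auto
  have rw: "adj w r" using s mem_priv[of r u w] r1 \<open>s = z\<close> \<open>r \<noteq> z\<close> by auto
  have "r = y'" using y' mem_priv[of r f e] rf r1 by auto
  have "y \<in> I" "adj f y" "\<not> adj w y" using y mem_priv[of y f w] by auto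
  moreover have "y \<noteq> z" using calculation ef by auto
  ultimately have "\<not> adj e y" using ew mem_priv[of y e w] by auto
  then have "y = y'" using y' mem_priv[of y f e] \<open>adj f y\<close> \<open>y \<in> I\<close> by auto
  then show False using \<open>r = y'\<close> rw \<open>\<not> adj w y\<close> by simp
qed

text \<open>Weaker than a module in the usual sense: only clique vertices of \<open>S\<close> have
  to agree, and only on independent vertices outside \<open>S\<close>. This is just what confines
  their private neighbours to \<open>S\<close>.\<close>

definition module :: "'a set \<Rightarrow> bool" where
  "module S \<longleftrightarrow> S \<subseteq> pverts G \<and>
     (\<forall>u \<in> K \<inter> S. \<forall>v \<in> K \<inter> S. \<forall>x \<in> I - S. adj u x \<longleftrightarrow> adj v x)"

text \<open>An independent vertex goes to the lower part only if it has a neighbour in the lower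
  clique; isolated vertices stay in the upper part. This makes edges between lower clique vertices
  and upper independent vertices impossible.\<close>

definition lower :: "'a set \<Rightarrow> 'a \<Rightarrow> 'a set" where
  "lower S z = {x \<in> S. \<exists>u \<in> K \<inter> S. adj u z \<and> (x = u \<or> x \<in> I - {z} \<and> adj u x)}"

text \<open>If \<open>S\<close> has at most one clique vertex, every independent vertex of
  \<open>S\<close> separates it, so the recursion descends to single vertices without a further
  case.\<close>

definition separates :: "'a set \<Rightarrow> 'a \<Rightarrow> bool" where
  "separates S z \<longleftrightarrow> z \<in> I \<inter> S \<and>
     (\<forall>e \<in> K \<inter> S. \<forall>f \<in> K \<inter> S. \<forall>x \<in> I \<inter> S. adj e z \<and> \<not> adj f z \<and> x \<noteq> z \<and> adj e x \<longrightarrow> adj f x)"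

lemma separates_mem:
  assumes "separates S z" shows "z \<in> I" "z \<in> S" "z \<notin> K"
  using assms K_Int_I unfolding separates_def by blast+

abbreviation upper :: "'a set \<Rightarrow> 'a \<Rightarrow> 'a set" where "upper S z \<equiv> S - {z} - lower S z"

lemma module_pverts: "module (pverts G)"
  using K_Un_I unfolding module_def by blast

lemma lower_subset: "z \<in> I \<Longrightarrow> lower S z \<subseteq> S - {z}"
  using K_Int_I unfolding lower_def by auto

text \<open>An independent neighbour of a lower clique vertex is in the lower part, equal to
  \<open>z\<close>, or outside \<open>S\<close>. All lower clique vertices see \<open>z\<close>, and
  outside \<open>S\<close> they agree because \<open>S\<close> is a module.\<close>

lemma module_lower:
  assumes "module S" "separates S z" shows "module (lower S z)"
proof -
  have lz: "adj u z" if "u \<in> K" "u \<in> lower S z" for u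
    using that K_Int_I unfolding lower_def by auto
  have "adj v x"
    if u: "u \<in> K" "u \<in> lower S z" and v: "v \<in> K" "v \<in> lower S z"
      and x: "x \<in> I" "x \<notin> lower S z" "adj u x" for u v x
  proof (cases "x \<in> S")
    case True
    then have "x = z" using u x lz[of u] unfolding lower_def by blast
    then show ?thesis using lz v by blast
  next
    case False
    have "u \<in> S" "v \<in> S" using u v unfolding lower_def by auto
    then show ?thesis using assms(1) u v x False unfolding module_def by blast
  qed
  moreover have "lower S z \<subseteq> pverts G" using assms(1) unfolding module_def lower_def by blast
  ultimately show ?thesis unfolding module_def by blast
qed

text \<open>An independent vertex outside the upper part is outside \<open>S\<close>, equal to
  \<open>z\<close>, or in the lower part. Upper clique vertices agree on the first kind, all miss
  \<open>z\<close>, and see everything of the third kind; these are the facts 1, 2 and 3.\<close>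

lemma module_upper:
  assumes "module S" "separates S z" shows "module (upper S z)"
proof -
  have 1: "adj u x \<longleftrightarrow> adj v x" if "u \<in> K" "u \<in> S" "v \<in> K" "v \<in> S" "x \<in> I" "x \<notin> S" for u v x
    using assms(1) that unfolding module_def by blast
  have 2: "\<not> adj u z" if "u \<in> K" "u \<in> upper S z" for u
    using that unfolding lower_def by auto
  have 3: "adj u x" if "u \<in> K" "u \<in> upper S z" "x \<in> I" "x \<in> lower S z" for u x
  proof -
    have "x \<notin> K" using that(3) K_Int_I by blast
    with that(4) obtain e where e: "e \<in> K \<inter> S" "adj e z" "x \<in> S" "x \<noteq> z" "adj e x"
      unfolding lower_def by auto
    have "u \<in> K \<inter> S" using that(1,2) by blast
    then show ?thesis using assms(2) that(3) 2[OF that(1,2)] e unfolding separates_def by blast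
  qed
  have "adj u x \<longleftrightarrow> adj v x"
    if "u \<in> K" "u \<in> upper S z" "v \<in> K" "v \<in> upper S z" "x \<in> I" "x \<notin> upper S z" for u v x
    using 1[of u v x] 2[of u] 2[of v] 3[of u x] 3[of v x] that by blast
  moreover have "upper S z \<subseteq> pverts G" using assms(1) unfolding module_def by blast
  ultimately show ?thesis unfolding module_def by blast
qed

text \<open>The hypotheses are shaped after what the search loops establish: \<open>u\<close> and
  \<open>w\<close> may be dummies if \<open>S\<close> has no clique vertex, and \<open>z\<close> is
  an arbitrary independent vertex unless some vertex of \<open>S\<close> is private to
  \<open>u\<close> against \<open>w\<close>. For distinct extremes such a vertex exists, and it lies
  in \<open>S\<close> because \<open>S\<close> is a module.\<close>

lemma separatesI:
  assumes S: "module S" and z: "z \<in> I \<inter> S"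
    and uw: "\<And>e. e \<in> K \<inter> S \<Longrightarrow> u \<in> K \<inter> S \<and> w \<in> K \<inter> S \<and> deg u \<le> deg e \<and> deg e \<le> deg w"
    and single: "u = w \<Longrightarrow> K \<inter> S \<subseteq> {u}"
    and pref: "(\<exists>x \<in> I \<inter> S. adj u x \<and> \<not> adj w x) \<Longrightarrow> adj u z \<and> \<not> adj w z"
  shows "separates S z"
proof (cases "u = w \<or> K \<inter> S = {}")
  case True
  then have "\<exists>u. K \<inter> S \<subseteq> {u}" using single by blast
  then show ?thesis using z unfolding separates_def by blast
next
  case False
  have umin: "deg u \<le> deg e" and wmax: "deg e \<le> deg w" if "e \<in> K \<inter> S" for e
    using uw[OF that] by simp_all
  from False obtain a where "a \<in> K \<inter> S" by blast
  from uw[OF this] have uwK: "u \<in> K \<inter> S" "w \<in> K \<inter> S" "deg u \<le> deg w" by simp_all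
  then obtain x where x: "priv G I u w = {x}" using priv_singleton[of u w] False by auto
  then have "x \<in> priv G I u w" by simp
  then have x: "x \<in> I" "adj u x" "\<not> adj w x" unfolding mem_priv by simp_all
  have "x \<in> S"
  proof (rule ccontr)
    assume "x \<notin> S"
    then have "adj u x \<longleftrightarrow> adj w x" using S uwK x(1) unfolding module_def by blast
    then show False using x by simp
  qed
  then have uz: "adj u z" "\<not> adj w z" using pref x by blast+
  have "adj f y" if "e \<in> K \<inter> S" "f \<in> K \<inter> S" "y \<in> I \<inter> S" "adj e z \<and> \<not> adj f z \<and> y \<noteq> z \<and> adj e y" for e f y
    using extremal_separates[OF _ uwK(1) umin uwK(2) wmax _ uz, of e f y] z that by simp
  then show ?thesis using z unfolding separates_def by blast
qed

text \<open>Two clique vertices of a module without independent vertices would agree on all of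
  \<open>I\<close>, leaving no private neighbour.\<close>

lemma singleton_or_I_nonempty:
  assumes S: "module S" "S \<noteq> {}" and I: "I \<inter> S = {}"
  shows "\<exists>u \<in> K. S = {u}"
proof -
  obtain u where u: "u \<in> S" "u \<in> K" using S I K_Un_I unfolding module_def by blast
  moreover have "v = u" if "v \<in> S" for v
  proof (rule ccontr)
    assume "v \<noteq> u"
    have v: "v \<in> K" using that S I K_Un_I unfolding module_def by blast
    have "x \<notin> priv G I u v" for x
      using S(1) I u v that unfolding mem_priv module_def by blast
    then have "priv G I u v = {}" by blast
    moreover have "min (card (priv G I u v)) (card (priv G I v u)) = 1"
      using one_Sperner u v \<open>v \<noteq> u\<close> by blast
    ultimately show False by simp
  qed
  ultimately show ?thesis by blast
qed

lemma ex_separates: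
  assumes S: "module S" and I: "I \<inter> S \<noteq> {}"
  shows "\<exists>z. separates S z"
proof (cases "\<exists>u. K \<inter> S \<subseteq> {u}")
  case True
  then show ?thesis using I unfolding separates_def by blast
next
  case False
  then have ne: "K \<inter> S \<noteq> {}" and fin: "finite (K \<inter> S)" using finite_K by auto
  define u where "u = arg_min_on deg (K \<inter> S)"
  have u: "u \<in> K \<inter> S" "\<And>e. e \<in> K \<inter> S \<Longrightarrow> deg u \<le> deg e"
    unfolding u_def using arg_min_if_finite(1)[OF fin ne] arg_min_least[OF fin ne] by blast+
  \<comment> \<open>The maximum is taken without \<open>u\<close>, so that \<open>w\<close> differs
    from \<open>u\<close> even if all degrees are equal.\<close>
  have ne': "K \<inter> S - {u} \<noteq> {}" using False by blast
  have "Max (deg ` (K \<inter> S - {u})) \<in> deg ` (K \<inter> S - {u})" using fin ne' by (intro Max_in) auto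
  then obtain w where w: "deg w = Max (deg ` (K \<inter> S - {u}))" "w \<in> K \<inter> S - {u}"
    by (elim imageE) simp
  have wmax: "deg e \<le> deg w" if "e \<in> K \<inter> S - {u}" for e
    unfolding w(1) by (rule Max_ge) (use fin that in auto)
  have "u \<in> K" "w \<in> K" "u \<noteq> w" "deg u \<le> deg w" using u w(2) by auto
  from priv_singleton[OF this] obtain x where x: "priv G I u w = {x}" by blast
  then have "x \<in> priv G I u w" by simp
  then have x: "x \<in> I" "adj u x" "\<not> adj w x" unfolding mem_priv by simp_all
  then have "x \<in> S" using S u w unfolding module_def by blast
  have "deg e \<le> deg w" if "e \<in> K \<inter> S" for e
    using wmax[of e] w(2) u(2)[of w] that by (cases "e = u") auto
  then have "separates S x" using separatesI[of S x u w] S x \<open>x \<in> S\<close> u w(2) by blast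
  then show ?thesis ..
qed

definition realizes :: "'a set \<Rightarrow> 'a cw_expr \<Rightarrow> bool" where
  "realizes S e \<longleftrightarrow> k_expression 5 e \<and>
     graph_of e = \<lparr>pverts = S, parcs = parcs G \<inter> S \<times> S\<rparr> \<and>
     (\<forall>v \<in> S. snd (lg_of e) v = (if v \<in> K then 1 else 2))"

end

text \<open>Labels 1 and 2 are reserved for clique and independent vertices of finished parts; the part
  above \<open>z\<close> is moved to labels 3 and 4, so that it can be joined to the part below \<open>z\<close>.\<close>

definition attach :: "'a \<Rightarrow> 'a cw_expr \<Rightarrow> 'a cw_expr" where
  "attach z e = Relabel 5 2 (Relabel 4 2 (Relabel 3 1 (Join 1 5 (DUnion (Create 5 z) e))))"

definition shift :: "'a cw_expr \<Rightarrow> 'a cw_expr" where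
  "shift e = Relabel 1 3 (Relabel 2 4 e)"

text \<open>After \<open>shift\<close>, label 3 holds the upper clique. Joining it to both 1 and 2
  makes it complete to the lower part, while label 4, the upper independent vertices, is joined to
  nothing.\<close>

definition glue :: "'a cw_expr \<Rightarrow> 'a cw_expr \<Rightarrow> 'a cw_expr" where
  "glue e f = Join 1 3 (Join 2 3 (DUnion e (shift f)))"

section \<open>Adjacency between the parts around a separating vertex\<close>

context one_Sperner_split
begin

lemma realizes_Create:
  assumes "v \<in> pverts G"
  shows "realizes {v} (Create (if v \<in> K then 1 else 2) v)"
  using assms adj_irrefl unfolding realizes_def by auto

lemma realizesE:
  assumes "realizes S e"
  obtains l where "k_expression 5 e" "lg_of e = (\<lparr>pverts = S, parcs = parcs G \<inter> S \<times> S\<rparr>, l)"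
    "\<And>v. v \<in> S \<Longrightarrow> l v = (if v \<in> K then 1 else 2)"
  using assms unfolding realizes_def by (cases "lg_of e") auto

text \<open>Labels can produce these edges because only the type of the upper vertex matters. An
  upper clique vertex is complete to the lower part by separation; an upper independent vertex
  adjacent to a lower clique vertex would itself have been put into the lower part.\<close>

lemma upper_lower_adj:
  assumes S: "S \<subseteq> pverts G" and z: "separates S z" and a: "a \<in> lower S z" and b: "b \<in> upper S z"
  shows "adj a b \<longleftrightarrow> b \<in> K"
proof (cases "b \<in> K")
  case True
  then have nbz: "\<not> adj b z" and "b \<in> S" using b unfolding lower_def by auto
  from a obtain e where e: "e \<in> K \<inter> S" "adj e z" "a = e \<or> a \<in> I - {z} \<and> adj e a" "a \<in> S"
    unfolding lower_def by blast
  show ?thesis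
  proof (cases "a = e")
    case True
    then show ?thesis using e b \<open>b \<in> K\<close> adj_K[of a b] a by blast
  next
    case False
    then have "adj b a" using e nbz z True \<open>b \<in> S\<close> unfolding separates_def by blast
    then show ?thesis using adj_sym True by blast
  qed
next
  case False
  then have "b \<in> I" using b S K_Un_I by blast
  have "\<not> adj a b"
  proof
    assume ab: "adj a b"
    then have "a \<in> K" using \<open>b \<in> I\<close> adj_I a S K_Un_I unfolding lower_def by blast
    then have "adj a z" "a \<in> S" using a K_Int_I unfolding lower_def by auto
    then show False using ab b \<open>a \<in> K\<close> \<open>b \<in> I\<close> unfolding lower_def by blast
  qed
  then show ?thesis using False by blast
qed

lemma adj_separating:
  assumes S: "S \<subseteq> pverts G" and z: "separates S z" and a: "a \<in> S"
  shows "adj a z \<longleftrightarrow> a \<in> lower S z \<and> a \<in> K"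
  using assms K_Un_I K_Int_I adj_I unfolding separates_def lower_def by blast

lemma parcs_decompose:
  assumes S: "S \<subseteq> pverts G" and z: "separates S z"
  shows "parcs G \<inter> lower S z \<times> lower S z \<union> parcs G \<inter> upper S z \<times> upper S z
      \<union> sym_closure (lower S z \<times> (upper S z \<inter> K)) \<union> sym_closure ((lower S z \<inter> K) \<times> {z}) = parcs G \<inter> S \<times> S"
    (is "?l = ?r")
proof (rule set_eqI)
  fix p :: "'a \<times> 'a"
  obtain a b where p: "p = (a, b)" by fastforce
  note zS = separates_mem[OF z] lower_subset[OF separates_mem(1)[OF z], of S]
  have lu: "adj x y \<longleftrightarrow> y \<in> K" "adj y x \<longleftrightarrow> y \<in> K" if "x \<in> lower S z" "y \<in> upper S z" for x y
    using upper_lower_adj[OF S z that] adj_sym[of x y] by simp_all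
  have sz: "adj x z \<longleftrightarrow> x \<in> lower S z \<and> x \<in> K" "adj z x \<longleftrightarrow> x \<in> lower S z \<and> x \<in> K" if "x \<in> S" for x
    using adj_separating[OF S z that] adj_sym[of x z] by simp_all
  have mem: "p \<in> ?l \<longleftrightarrow> adj a b \<and> (a \<in> lower S z \<and> b \<in> lower S z \<or> a \<in> upper S z \<and> b \<in> upper S z)
      \<or> a \<in> lower S z \<and> b \<in> upper S z \<and> b \<in> K \<or> b \<in> lower S z \<and> a \<in> upper S z \<and> a \<in> K
      \<or> a \<in> lower S z \<and> a \<in> K \<and> b = z \<or> b \<in> lower S z \<and> b \<in> K \<and> a = z"
    unfolding p sym_closure_def Un_iff Int_iff mem_Sigma_iff converse_iff singleton_iff by argo
  have r: "p \<in> ?r \<longleftrightarrow> adj a b \<and> a \<in> S \<and> b \<in> S" unfolding p by auto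
  \<comment> \<open>With the facts instantiated at \<open>a\<close> and \<open>b\<close>, the
    equality of the two arc sets becomes purely propositional.\<close>
  have h: "x = z \<longrightarrow> x \<notin> lower S z \<and> x \<in> S" "x \<in> lower S z \<longrightarrow> x \<in> S"
    "x \<in> upper S z \<longleftrightarrow> x \<in> S \<and> x \<noteq> z \<and> x \<notin> lower S z" for x using zS by blast+
  have 1: "a \<in> lower S z \<and> b \<in> upper S z \<longrightarrow> (adj a b \<longleftrightarrow> b \<in> K)"
    "b \<in> lower S z \<and> a \<in> upper S z \<longrightarrow> (adj a b \<longleftrightarrow> a \<in> K)" using lu by simp_all
  have 2: "b = z \<and> a \<in> S \<longrightarrow> (adj a b \<longleftrightarrow> a \<in> lower S z \<and> a \<in> K)"
    "a = z \<and> b \<in> S \<longrightarrow> (adj a b \<longleftrightarrow> b \<in> lower S z \<and> b \<in> K)" using sz by simp_all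
  show "p \<in> ?l \<longleftrightarrow> p \<in> ?r"
    unfolding mem r using h[of a] h[of b] 1 2 by argo
qed

end

section \<open>Labelled graphs produced by the combining operations\<close>

lemma lg_join_labels:
  assumes "{v \<in> V. l v = i} = A" "{v \<in> V. l v = j} = B"
  shows "lg_join i j (\<lparr>pverts = V, parcs = E\<rparr>, l) = (\<lparr>pverts = V, parcs = E \<union> sym_closure (A \<times> B)\<rparr>, l)"
proof -
  have "{(u, v). u \<in> V \<and> v \<in> V \<and> l u = i \<and> l v = j} = A \<times> B" unfolding assms[symmetric] by auto
  then show ?thesis by simp
qed

lemma lg_of_shift:
  assumes "lg_of f = (\<lparr>pverts = U, parcs = F\<rparr>, m)" "\<And>v. v \<in> U \<Longrightarrow> m v = (if v \<in> K then 1 else 2)"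
  shows "\<exists>m'. lg_of (shift f) = (\<lparr>pverts = U, parcs = F\<rparr>, m') \<and>
    (\<forall>v \<in> U. m' v = (if v \<in> K then 3 else 4))"
  using assms unfolding shift_def by simp

lemma lg_of_glue:
  assumes e: "lg_of e = (\<lparr>pverts = L, parcs = E\<rparr>, l)" "\<And>v. v \<in> L \<Longrightarrow> l v = (if v \<in> K then 1 else 2)"
    and f: "lg_of f = (\<lparr>pverts = U, parcs = F\<rparr>, m)" "\<And>v. v \<in> U \<Longrightarrow> m v = (if v \<in> K then 1 else 2)"
    and disj: "L \<inter> U = {}"
  shows "\<exists>l'. lg_of (glue e f) =
      (\<lparr>pverts = L \<union> U, parcs = E \<union> F \<union> sym_closure (L \<times> (U \<inter> K))\<rparr>, l') \<and>
      (\<forall>v \<in> L. l' v = (if v \<in> K then 1 else 2)) \<and> (\<forall>v \<in> U. l' v = (if v \<in> K then 3 else 4))"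
proof -
  obtain m' where m: "lg_of (shift f) = (\<lparr>pverts = U, parcs = F\<rparr>, m')"
    "\<And>v. v \<in> U \<Longrightarrow> m' v = (if v \<in> K then 3 else 4)"
    using lg_of_shift[OF f] by blast
  define l' where "l' = (\<lambda>v. if v \<in> L then l v else m' v)"
  have L: "l' v = (if v \<in> K then 1 else 2)" if "v \<in> L" for v using e(2) that by (simp add: l'_def)
  have U: "l' v = (if v \<in> K then 3 else 4)" if "v \<in> U" for v using m(2) disj that by (auto simp: l'_def)
  have "lg_of (DUnion e (shift f)) = (\<lparr>pverts = L \<union> U, parcs = E \<union> F\<rparr>, l')"
    using e(1) m(1) by (simp add: l'_def)
  moreover have "{v \<in> L \<union> U. l' v = 1} = L \<inter> K" "{v \<in> L \<union> U. l' v = 2} = L - K"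
    "{v \<in> L \<union> U. l' v = 3} = U \<inter> K"
    using L U by (auto split: if_splits)
  ultimately have "lg_of (glue e f) = (\<lparr>pverts = L \<union> U,
      parcs = E \<union> F \<union> sym_closure ((L - K) \<times> (U \<inter> K)) \<union> sym_closure ((L \<inter> K) \<times> (U \<inter> K))\<rparr>, l')"
    unfolding glue_def by (simp only: lg_of.simps lg_join_labels)
  moreover have "E \<union> F \<union> sym_closure ((L - K) \<times> (U \<inter> K)) \<union> sym_closure ((L \<inter> K) \<times> (U \<inter> K))
      = E \<union> F \<union> sym_closure (L \<times> (U \<inter> K))"
    unfolding sym_closure_def by blast
  ultimately show ?thesis using L U by simp
qed

text \<open>Either of \<open>L\<close> and \<open>U\<close> may be empty, so that one lemma serves
  all three combinations: a glued pair, a lower part alone, and a shifted upper part alone.\<close>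

lemma lg_of_attach:
  assumes e: "lg_of e = (\<lparr>pverts = L \<union> U, parcs = E\<rparr>, l)"
    "\<And>v. v \<in> L \<Longrightarrow> l v = (if v \<in> K then 1 else 2)" "\<And>v. v \<in> U \<Longrightarrow> l v = (if v \<in> K then 3 else 4)"
    and z: "z \<notin> L" "z \<notin> U" "z \<notin> K"
  shows "\<exists>l'. lg_of (attach z e) =
      (\<lparr>pverts = insert z (L \<union> U), parcs = E \<union> sym_closure ((L \<inter> K) \<times> {z})\<rparr>, l') \<and>
      (\<forall>v \<in> insert z (L \<union> U). l' v = (if v \<in> K then 1 else 2))"
proof -
  define l' where "l' = (\<lambda>v. if v \<in> {z} then 5 else l v)"
  have z5: "l' z = 5" by (simp add: l'_def)
  have L: "l' v = (if v \<in> K then 1 else 2)" if "v \<in> L" for v using e(2)[OF that] z that by (auto simp: l'_def)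
  have U: "l' v = (if v \<in> K then 3 else 4)" if "v \<in> U" for v using e(3)[OF that] z that by (auto simp: l'_def)
  have "lg_of (DUnion (Create 5 z) e) = (\<lparr>pverts = insert z (L \<union> U), parcs = E\<rparr>, l')"
    using e(1) by (simp add: l'_def)
  moreover have "{v \<in> insert z (L \<union> U). l' v = 1} = L \<inter> K"
    using L U z5 by (auto split: if_splits)
  moreover have "{v \<in> insert z (L \<union> U). l' v = 5} = {z}"
    using L U z5 by (auto split: if_splits)
  ultimately have 1: "lg_of (Join 1 5 (DUnion (Create 5 z) e)) =
      (\<lparr>pverts = insert z (L \<union> U), parcs = E \<union> sym_closure ((L \<inter> K) \<times> {z})\<rparr>, l')"
    by (simp only: lg_of.simps lg_join_labels)
  define l'' where "l'' = (\<lambda>v. if l' v = 5 \<or> l' v = 4 then 2 else if l' v = 3 then 1 else l' v)"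
  have "lg_of (attach z e) = (\<lparr>pverts = insert z (L \<union> U), parcs = E \<union> sym_closure ((L \<inter> K) \<times> {z})\<rparr>, l'')"
    unfolding attach_def lg_of.simps(3) 1 lg_relabel.simps by (auto simp: l''_def)
  moreover have "\<forall>v \<in> insert z (L \<union> U). l'' v = (if v \<in> K then 1 else 2)"
    using L U z5 z by (auto simp: l''_def split: if_splits)
  ultimately show ?thesis by blast
qed

section \<open>Expressions of modules\<close>

context one_Sperner_split
begin

lemma realizes_attach_glue:
  assumes S: "S \<subseteq> pverts G" and z: "separates S z"
    and e: "realizes (lower S z) e" and f: "realizes (upper S z) f"
  shows "realizes S (attach z (glue e f))"
proof -
  let ?L = "lower S z" and ?U = "upper S z"
  from e obtain l where e: "k_expression 5 e" "lg_of e = (\<lparr>pverts = ?L, parcs = parcs G \<inter> ?L \<times> ?L\<rparr>, l)"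
    "\<And>v. v \<in> ?L \<Longrightarrow> l v = (if v \<in> K then 1 else 2)" using realizesE by metis
  from f obtain m where f: "k_expression 5 f" "lg_of f = (\<lparr>pverts = ?U, parcs = parcs G \<inter> ?U \<times> ?U\<rparr>, m)"
    "\<And>v. v \<in> ?U \<Longrightarrow> m v = (if v \<in> K then 1 else 2)" using realizesE by metis
  note zS = separates_mem[OF z] lower_subset[OF separates_mem(1)[OF z], of S]
  have disj: "?L \<inter> ?U = {}" by blast
  obtain l1 where g: "lg_of (glue e f) = (\<lparr>pverts = ?L \<union> ?U,
      parcs = parcs G \<inter> ?L \<times> ?L \<union> parcs G \<inter> ?U \<times> ?U \<union> sym_closure (?L \<times> (?U \<inter> K))\<rparr>, l1)"
    "\<And>v. v \<in> ?L \<Longrightarrow> l1 v = (if v \<in> K then 1 else 2)" "\<And>v. v \<in> ?U \<Longrightarrow> l1 v = (if v \<in> K then 3 else 4)"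
    using lg_of_glue[OF e(2,3) f(2,3) disj] by blast
  have z': "z \<notin> ?L" "z \<notin> ?U" "z \<notin> K" using zS by auto
  obtain l2 where h: "lg_of (attach z (glue e f)) = (\<lparr>pverts = insert z (?L \<union> ?U),
      parcs = parcs G \<inter> ?L \<times> ?L \<union> parcs G \<inter> ?U \<times> ?U \<union> sym_closure (?L \<times> (?U \<inter> K))
        \<union> sym_closure ((?L \<inter> K) \<times> {z})\<rparr>, l2)"
    "\<And>v. v \<in> insert z (?L \<union> ?U) \<Longrightarrow> l2 v = (if v \<in> K then 1 else 2)"
    using lg_of_attach[OF g z'] by blast
  have V: "insert z (?L \<union> ?U) = S" using zS by blast
  have "k_expression 5 (attach z (glue e f))"
    using e f g z' disj unfolding attach_def glue_def shift_def by simp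
  then show ?thesis
    unfolding realizes_def h(1) using h(2) parcs_decompose[OF S z] unfolding V by simp
qed

text \<open>No expression produces the empty graph, so an empty part cannot be an operand of
  \<open>glue\<close> and needs a lemma of its own.\<close>

lemma realizes_attach:
  assumes S: "S \<subseteq> pverts G" and z: "separates S z" and U: "upper S z = {}"
    and e: "realizes (lower S z) e"
  shows "realizes S (attach z e)"
proof -
  let ?L = "lower S z"
  from e obtain l where e: "k_expression 5 e" "lg_of e = (\<lparr>pverts = ?L \<union> {}, parcs = parcs G \<inter> ?L \<times> ?L\<rparr>, l)"
    "\<And>v. v \<in> ?L \<Longrightarrow> l v = (if v \<in> K then 1 else 2)"
    "\<And>v. v \<in> {} \<Longrightarrow> l v = (if v \<in> K then 3 else 4)" using realizesE by (metis empty_iff sup_bot_right)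
  note zS = separates_mem[OF z] lower_subset[OF separates_mem(1)[OF z], of S]
  have z': "z \<notin> ?L" "z \<notin> {}" "z \<notin> K" using zS by auto
  obtain l2 where h: "lg_of (attach z e) = (\<lparr>pverts = insert z (?L \<union> {}),
      parcs = parcs G \<inter> ?L \<times> ?L \<union> sym_closure ((?L \<inter> K) \<times> {z})\<rparr>, l2)"
    "\<And>v. v \<in> insert z (?L \<union> {}) \<Longrightarrow> l2 v = (if v \<in> K then 1 else 2)"
    using lg_of_attach[OF e(2-4) z'] by blast
  have V: "insert z (?L \<union> {}) = S" using zS U by blast
  have "k_expression 5 (attach z e)" using e z' unfolding attach_def by simp
  moreover have "sym_closure (?L \<times> ({} \<inter> K)) = {}" unfolding sym_closure_def by simp
  ultimately show ?thesis
    unfolding realizes_def h(1) using h(2) parcs_decompose[OF S z] unfolding V U by simp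
qed

text \<open>The shift is essential although nothing lies below: \<open>z\<close> has no neighbour in
  the upper part, and without the shift \<open>Join 1 5\<close> would connect it to the upper
  clique.\<close>

lemma realizes_attach_shift:
  assumes S: "S \<subseteq> pverts G" and z: "separates S z" and L: "lower S z = {}"
    and f: "realizes (upper S z) f"
  shows "realizes S (attach z (shift f))"
proof -
  let ?U = "upper S z"
  from f obtain m where f: "k_expression 5 f" "lg_of f = (\<lparr>pverts = ?U, parcs = parcs G \<inter> ?U \<times> ?U\<rparr>, m)"
    "\<And>v. v \<in> ?U \<Longrightarrow> m v = (if v \<in> K then 1 else 2)" using realizesE by metis
  obtain l1 where g: "lg_of (shift f) = (\<lparr>pverts = {} \<union> ?U, parcs = parcs G \<inter> ?U \<times> ?U\<rparr>, l1)"
    "\<And>v. v \<in> {} \<Longrightarrow> l1 v = (if v \<in> K then 1 else 2)" "\<And>v. v \<in> ?U \<Longrightarrow> l1 v = (if v \<in> K then 3 else 4)"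
    using lg_of_shift[OF f(2,3)] by auto
  have z': "z \<notin> {}" "z \<notin> ?U" "z \<notin> K" using separates_mem[OF z] by auto
  obtain l2 where h: "lg_of (attach z (shift f)) = (\<lparr>pverts = insert z ({} \<union> ?U),
      parcs = parcs G \<inter> ?U \<times> ?U \<union> sym_closure (({} \<inter> K) \<times> {z})\<rparr>, l2)"
    "\<And>v. v \<in> insert z ({} \<union> ?U) \<Longrightarrow> l2 v = (if v \<in> K then 1 else 2)"
    using lg_of_attach[OF g z'] by blast
  have V: "insert z ({} \<union> ?U) = S" using separates_mem[OF z] L by blast
  have "k_expression 5 (attach z (shift f))" using f g z' unfolding attach_def shift_def by simp
  moreover have "sym_closure ({} \<times> (?U \<inter> K)) = {}" "sym_closure (({} \<inter> K) \<times> {z}) = {}"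
    unfolding sym_closure_def by simp_all
  ultimately show ?thesis
    unfolding realizes_def h(1) using h(2) parcs_decompose[OF S z] unfolding V L by (simp add: insert_absorb separates_mem(2)[OF z])
qed

text \<open>This recursion yields the clique-width bound over an arbitrary vertex type; the program
  on natural numbers follows the same case distinction through its loop invariant.\<close>

lemma ex_realizes:
  assumes "module S" "S \<noteq> {}"
  shows "\<exists>e. realizes S e"
proof -
  have "finite S" using assms(1) pair_finite_verts finite_subset unfolding module_def by blast
  then show ?thesis using assms
  proof (induction S rule: finite_psubset_induct)
    case (psubset S)
    then have S: "S \<subseteq> pverts G" unfolding module_def by blast
    show ?case
    proof (cases "I \<inter> S = {}")
      case True
      then obtain u where "S = {u}" using singleton_or_I_nonempty psubset.prems by blast
      then show ?thesis using realizes_Create S by blast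
    next
      case False
      then obtain z where z: "separates S z" using ex_separates psubset.prems by blast
      note zS = separates_mem[OF z] lower_subset[OF separates_mem(1)[OF z], of S]
      have L: "\<exists>e. realizes (lower S z) e" if "lower S z \<noteq> {}"
        using psubset.IH[of "lower S z"] module_lower[OF psubset.prems(1) z] zS that by blast
      have U: "\<exists>e. realizes (upper S z) e" if "upper S z \<noteq> {}"
        using psubset.IH[of "upper S z"] module_upper[OF psubset.prems(1) z] zS that by blast
      consider "lower S z = {}" "upper S z = {}" | "lower S z \<noteq> {}" "upper S z = {}"
        | "lower S z = {}" "upper S z \<noteq> {}" | "lower S z \<noteq> {}" "upper S z \<noteq> {}" by blast
      then show ?thesis
      proof cases
        case 1
        then have "S = {z}" using zS by blast
        then show ?thesis using realizes_Create S by blast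
      next
        case 2
        then show ?thesis using L realizes_attach[OF S z] by blast
      next
        case 3
        then show ?thesis using U realizes_attach_shift[OF S z] by blast
      next
        case 4
        then show ?thesis using L U realizes_attach_glue[OF S z] by blast
      qed
    qed
  qed
qed

lemma clique_width_le_5:
  assumes "pverts G \<noteq> {}"
  shows "clique_width G \<le> 5"
proof -
  obtain e where e: "realizes (pverts G) e" using ex_realizes[OF module_pverts assms] by blast
  have "parcs G \<inter> pverts G \<times> pverts G = parcs G" using in_arcsD1 in_arcsD2 by auto
  then have "k_expression 5 e" "graph_of e = G" using e unfolding realizes_def by simp_all
  then have "k_expression 5 e \<and> pair_iso (graph_of e) G" using pair_iso_refl[OF pair_wf_digraph_axioms] by simp
  then have "enat 5 \<in> {enat k | k. \<exists>e :: 'a cw_expr. k_expression k e \<and> pair_iso (graph_of e) G}" by blast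
  then have "clique_width G \<le> enat 5" unfolding clique_width_def by (rule Inf_lower)
  then show ?thesis by (simp add: numeral_eq_enat)
qed

end

section \<open>Recognition of the clique\<close>

text \<open>The core consists of the non-simplicial vertices; the second disjunct matters only for a
  graph with a single edge, one of whose ends has to be put into the clique.\<close>

definition hub :: "'a::linorder pair_pre_digraph \<Rightarrow> 'a \<Rightarrow> 'a \<Rightarrow> 'a \<Rightarrow> bool" where
  "hub G v x y \<longleftrightarrow> (v, x) \<in> parcs G \<and>
     ((v, y) \<in> parcs G \<and> (x, y) \<notin> parcs G \<and> x \<noteq> y \<or> v < x \<and> card (nbhd G x) = 1)"

definition core :: "'a::linorder pair_pre_digraph \<Rightarrow> 'a set" where
  "core G = {v \<in> pverts G. \<exists>x \<in> pverts G. \<exists>y \<in> pverts G. hub G v x y}"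

text \<open>The partition is not part of the input, so the program needs a clique that it can
  recognize locally. If \<open>K\<close> has two vertices, a private neighbour makes each of them
  non-simplicial, whereas the neighbours of an independent vertex lie in \<open>K\<close> and are
  pairwise adjacent. The centre of a star with two leaves is recognized as well. In the remaining
  cases the core has at most one vertex, which makes the Sperner condition trivial.\<close>

lemma split_partition_core:
  fixes G :: "'a::linorder pair_pre_digraph"
  assumes G: "pair_graph G" and sp: "split_partition G K I"
    and Sp: "\<And>u v. u \<in> K \<Longrightarrow> v \<in> K \<Longrightarrow> nbhd G u \<inter> I \<subseteq> nbhd G v \<inter> I \<Longrightarrow> u = v"
  shows "\<exists>I'. split_partition G (core G) I' \<and>
    (\<forall>u \<in> core G. \<forall>v \<in> core G. nbhd G u \<inter> I' \<subseteq> nbhd G v \<inter> I' \<longrightarrow> u = v)"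
proof -
  interpret pair_graph G by fact
  have sym: "(b, a) \<in> parcs G" if "(a, b) \<in> parcs G" for a b
    using arcs_symmetric that .
  have irr: "(a, a) \<notin> parcs G" for a using pair_no_loops[of "(a, a)"] by auto
  have V: "K \<union> I = pverts G" "K \<inter> I = {}"
    and KK: "\<And>a b. a \<in> K \<Longrightarrow> b \<in> K \<Longrightarrow> a \<noteq> b \<Longrightarrow> (a, b) \<in> parcs G"
    and II: "\<And>a b. a \<in> I \<Longrightarrow> b \<in> I \<Longrightarrow> (a, b) \<notin> parcs G"
    using sp unfolding split_partition_def clique_def independent_def by blast+
  have nI: "b \<in> K" if "(a, b) \<in> parcs G" "a \<in> I" for a b
    using that II[of a b] in_arcsD2[of a b] V by blast
  have one: "nbhd G x = {v}" if "card (nbhd G x) = 1" "(x, v) \<in> parcs G" for x v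
    using that card_1_singletonE[of "nbhd G x"] unfolding nbhd_def by (metis (mono_tags) mem_Collect_eq singletonD)
  have K_core: "v \<in> core G" if "v \<in> K" "w \<in> K" "w \<noteq> v" for v w
  proof -
    have "\<not> nbhd G v \<inter> I \<subseteq> nbhd G w \<inter> I" using Sp[of v w] that by blast
    then obtain x where x: "x \<in> I" "(v, x) \<in> parcs G" "(w, x) \<notin> parcs G" unfolding nbhd_def by blast
    moreover have "(v, w) \<in> parcs G" "w \<noteq> x" using KK that x V by auto
    ultimately have "hub G v w x" unfolding hub_def by blast
    then show ?thesis unfolding core_def using V that x by blast
  qed
  show ?thesis
  proof (cases "core G = K")
    case True
    then show ?thesis using sp Sp by (intro exI[of _ I]) simp
  next
    case False
    text \<open>Then the graph has at most one edge: otherwise \<open>K\<close> is exactly the set of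
      non-simplicial vertices.\<close>
    have small: "\<exists>u. core G \<subseteq> {u} \<and> (\<forall>a b. (a, b) \<in> parcs G \<longrightarrow> a \<in> core G \<or> b \<in> core G)"
    proof (cases "core G \<subseteq> K")
      case True
      then obtain v where v: "v \<in> K" "v \<notin> core G" using False by blast
      have Kv: "K = {v}" using K_core[of v] v by blast
      then have "core G = {}" using True v(2) by blast
      have nv: "(v, x) \<notin> parcs G" for x
      proof
        assume vx: "(v, x) \<in> parcs G"
        have xI: "x \<in> I" using vx irr[of v] in_arcsD2[OF vx] V(1) Kv by (cases "x = v") auto
        have "(x, y) \<in> parcs G \<longleftrightarrow> y = v" for y using nI[of x y] xI Kv sym[OF vx] by auto
        then have "card (nbhd G x) = 1" unfolding nbhd_def by simp
        moreover have "x \<noteq> v" using vx irr by blast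
        moreover have "card (nbhd G v) = 1" if "x < v"
        proof -
          have "y = x" if vy: "(v, y) \<in> parcs G" for y
          proof (rule ccontr)
            assume "y \<noteq> x"
            moreover have "(x, y) \<notin> parcs G" using II[OF xI, of y] vy irr[of v] in_arcsD2[OF vy] V(1) Kv by (cases "y = v") auto
            ultimately have "hub G v x y" using vx vy unfolding hub_def by blast
            then show False using v(2) in_arcsD1[OF vx] in_arcsD2[OF vx] in_arcsD2[OF vy]
              unfolding core_def by blast
          qed
          then have "nbhd G v = {x}" using vx unfolding nbhd_def by blast
          then show ?thesis by simp
        qed
        \<comment> \<open>The second disjunct of \<open>hub\<close> does not mention its last
          argument; the order of the vertices decides which end of the edge enters the core.\<close>
        ultimately have "hub G v x x \<or> hub G x v v"
          using vx sym[OF vx] unfolding hub_def by (metis neqE)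
        then have "v \<in> core G \<or> x \<in> core G" unfolding core_def
          using in_arcsD1[OF vx] in_arcsD2[OF vx] by blast
        then show False using v \<open>core G = {}\<close> by blast
      qed
      have "a \<in> K \<or> b \<in> K" if "(a, b) \<in> parcs G" for a b
        using nI[OF that] in_arcsD1[OF that] V by blast
      then have "(a, b) \<notin> parcs G" for a b using Kv nv sym by blast
      then show ?thesis using \<open>core G = {}\<close> by blast
    next
      case False
      then obtain v x y where v: "v \<in> I" "hub G v x y" "v \<notin> K" using V unfolding core_def by blast
      have vx: "(v, x) \<in> parcs G" using v unfolding hub_def by blast
      have "x \<in> K" using nI vx v by blast
      \<comment> \<open>The neighbours of \<open>v\<close> lie in the clique \<open>K\<close>, so
        \<open>v\<close> cannot be a hub by the first disjunct.\<close>
      have "v < x \<and> card (nbhd G x) = 1"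
      proof (rule ccontr)
        assume "\<not> ?thesis"
        then have "(v, y) \<in> parcs G" "(x, y) \<notin> parcs G" "x \<noteq> y" using v unfolding hub_def by blast+
        then show False using nI[of v y] v KK[of x y] \<open>x \<in> K\<close> by blast
      qed
      then have nx: "nbhd G x = {v}" and "v < x" using one[of x v] sym[OF vx] by blast+
      have xw: "(x, w) \<in> parcs G \<longleftrightarrow> w = v" for w using nx unfolding nbhd_def by auto
      have "w = x" if "w \<in> K" for w using KK[OF \<open>x \<in> K\<close> that] v(3) that unfolding xw by blast
      then have Kx: "K = {x}" using \<open>x \<in> K\<close> by blast
      have arcs: "(a, b) \<in> parcs G \<longleftrightarrow> (a, b) = (v, x) \<or> (a, b) = (x, v)" for a b
      proof
        assume ab: "(a, b) \<in> parcs G"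
        have "a = x \<or> b = x" using nI[OF ab] Kx in_arcsD1[OF ab] V by blast
        then show "(a, b) = (v, x) \<or> (a, b) = (x, v)"
          using ab sym[OF ab] xw by blast
      qed (use vx sym[OF vx] in blast)
      have "x \<notin> core G"
      proof
        assume "x \<in> core G"
        then obtain p q where "hub G x p q" unfolding core_def by blast
        then show False using \<open>v < x\<close> unfolding hub_def arcs by auto
      qed
      moreover have "a = v \<or> a = x" if a: "a \<in> core G" for a
      proof -
        from a obtain p q where "hub G a p q" unfolding core_def by blast
        then show ?thesis unfolding hub_def arcs by blast
      qed
      ultimately have "core G \<subseteq> {v}" by blast
      moreover have "v \<in> core G"
      proof -
        from False obtain c where "c \<in> core G" by blast
        then show ?thesis using \<open>core G \<subseteq> {v}\<close> by blast
      qed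
      moreover have "a \<in> core G \<or> b \<in> core G" if "(a, b) \<in> parcs G" for a b
        using that \<open>v \<in> core G\<close> unfolding arcs by auto
      ultimately show ?thesis by (intro exI[of _ v]) simp
    qed
    then obtain u where u: "core G \<subseteq> {u}" "\<And>a b. (a, b) \<in> parcs G \<Longrightarrow> a \<in> core G \<or> b \<in> core G" by blast
    \<comment> \<open>The core has at most one vertex, hence is a clique, and it meets every edge,
      hence its complement is independent.\<close>
    have "split_partition G (core G) (pverts G - core G)"
      unfolding split_partition_def clique_def independent_def
    proof (intro conjI ballI impI)
      show "(a, b) \<notin> parcs G" if "a \<in> pverts G - core G" "b \<in> pverts G - core G" for a b
        using u(2)[of a b] that by blast
      show "(a, b) \<in> parcs G" if "a \<in> core G" "b \<in> core G" "a \<noteq> b" for a b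
        using u(1) that by blast
    qed (auto simp: core_def)
    then show ?thesis using u(1) by blast
  qed
qed

section \<open>Executions of programs\<close>

text \<open>Exact times depend on the branches taken; upper bounds depend on the program text and
  compose.\<close>

definition run :: "nat \<Rightarrow> nat \<Rightarrow> com \<Rightarrow> state \<Rightarrow> state \<Rightarrow> bool" where
  "run W T c s s' \<longleftrightarrow> (\<exists>t \<le> T. exec W c s t s')"

lemma run_mono: "run W T c s s' \<Longrightarrow> T \<le> T' \<Longrightarrow> run W T' c s s'"
  unfolding run_def by (meson le_trans)

lemma run_Seq: "run W T c s s1 \<Longrightarrow> run W T' d s1 s2 \<Longrightarrow> run W (T + T') (Seq c d) s s2"
  unfolding run_def by (meson add_mono exec.Seq)

lemma run_Cond:
  assumes "bfits W b s" "bval b s \<Longrightarrow> run W T c s s'" "\<not> bval b s \<Longrightarrow> run W T d s s'"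
  shows "run W (1 + bcost b + T) (Cond b c d) s s'"
proof (cases "bval b s")
  case True
  then obtain t where "t \<le> T" "exec W c s t s'" using assms(2) unfolding run_def by blast
  then show ?thesis unfolding run_def
    using CondTrue[OF assms(1) True, of c t s' d] by (intro exI[of _ "1 + bcost b + t"]) simp
next
  case False
  then obtain t where "t \<le> T" "exec W d s t s'" using assms(3) unfolding run_def by blast
  then show ?thesis unfolding run_def
    using CondFalse[OF assms(1) False, of d t s' c] by (intro exI[of _ "1 + bcost b + t"]) simp
qed

lemma run_Cond_True:
  "run W T c s s' \<Longrightarrow> bfits W b s \<Longrightarrow> bval b s \<Longrightarrow> run W (1 + bcost b + T) (Cond b c d) s s'"
  by (rule run_Cond) simp_all

lemma run_Cond_False:
  "run W T d s s' \<Longrightarrow> bfits W b s \<Longrightarrow> \<not> bval b s \<Longrightarrow> run W (1 + bcost b + T) (Cond b c d) s s'"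
  by (rule run_Cond) simp_all

text \<open>The measure \<open>m\<close> bounds the number of rounds; the leading
  \<open>1 + bcost b\<close> pays for the final, failing test.\<close>

lemma run_While:
  assumes fits: "\<And>s. P s \<Longrightarrow> bfits W b s"
    and step: "\<And>s. P s \<Longrightarrow> bval b s \<Longrightarrow> \<exists>s'. run W T c s s' \<and> P s' \<and> m s' < (m s :: nat)"
    and "P s"
  shows "\<exists>s'. run W (1 + bcost b + m s * (1 + bcost b + T)) (While b c) s s' \<and> P s' \<and> \<not> bval b s'"
  using \<open>P s\<close>
proof (induction "m s" arbitrary: s rule: less_induct)
  case less
  show ?case
  proof (cases "bval b s")
    case False
    then have "run W (1 + bcost b) (While b c) s s"
      using WhileFalse[OF fits[OF less.prems]] unfolding run_def by blast
    then show ?thesis using less.prems False run_mono by (meson le_add1)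
  next
    case True
    then obtain s1 where s1: "run W T c s s1" "P s1" "m s1 < m s" using step less.prems by blast
    then obtain s2 where s2: "run W (1 + bcost b + m s1 * (1 + bcost b + T)) (While b c) s1 s2"
      "P s2" "\<not> bval b s2" using less.hyps by blast
    from s1(1) s2(1) obtain t t' where t: "t \<le> T" "exec W c s t s1"
      "t' \<le> 1 + bcost b + m s1 * (1 + bcost b + T)" "exec W (While b c) s1 t' s2"
      unfolding run_def by blast
    have "exec W (While b c) s (1 + bcost b + t + t') s2"
      using WhileTrue[OF fits[OF less.prems] True t(2,4)] .
    moreover have "1 + bcost b + t + t' \<le> 1 + bcost b + Suc (m s1) * (1 + bcost b + T)"
      using t by simp
    moreover have "Suc (m s1) * (1 + bcost b + T) \<le> m s * (1 + bcost b + T)"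
      using s1(3) by (intro mult_right_mono) auto
    ultimately have "run W (1 + bcost b + m s * (1 + bcost b + T)) (While b c) s s2"
      unfolding run_def by (meson add_left_mono le_trans)
    then show ?thesis using s2 by blast
  qed
qed

section \<open>Memory left unchanged by a program\<close>

primrec writes_var :: "com \<Rightarrow> nat \<Rightarrow> bool" where
  "writes_var Skip x \<longleftrightarrow> False"
| "writes_var (Assign y e) x \<longleftrightarrow> x = y"
| "writes_var (Store a i e) x \<longleftrightarrow> False"
| "writes_var (Seq c d) x \<longleftrightarrow> writes_var c x \<or> writes_var d x"
| "writes_var (Cond b c d) x \<longleftrightarrow> writes_var c x \<or> writes_var d x"
| "writes_var (While b c) x \<longleftrightarrow> writes_var c x"

primrec writes_arr :: "com \<Rightarrow> nat \<Rightarrow> bool" where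
  "writes_arr Skip x \<longleftrightarrow> False"
| "writes_arr (Assign y e) x \<longleftrightarrow> False"
| "writes_arr (Store a i e) x \<longleftrightarrow> x = a"
| "writes_arr (Seq c d) x \<longleftrightarrow> writes_arr c x \<or> writes_arr d x"
| "writes_arr (Cond b c d) x \<longleftrightarrow> writes_arr c x \<or> writes_arr d x"
| "writes_arr (While b c) x \<longleftrightarrow> writes_arr c x"

text \<open>With this syntactic overapproximation of the memory written, loop invariants need to
  mention only what the loop body changes.\<close>

definition frame :: "com \<Rightarrow> state \<Rightarrow> state \<Rightarrow> bool" where
  "frame c s s' \<longleftrightarrow> (\<forall>x. \<not> writes_var c x \<longrightarrow> vars s' x = vars s x) \<and>
     (\<forall>a. \<not> writes_arr c a \<longrightarrow> arrs s' a = arrs s a)"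

lemma frame_vars: "frame c s s' \<Longrightarrow> \<not> writes_var c x \<Longrightarrow> vars s' x = vars s x"
  and frame_arrs: "frame c s s' \<Longrightarrow> \<not> writes_arr c a \<Longrightarrow> arrs s' a = arrs s a"
  unfolding frame_def by auto

lemma exec_frame: "exec W c s t s' \<Longrightarrow> frame c s s'"
  by (induction rule: exec.induct) (auto simp: frame_def)

lemma run_frame: "run W T c s s' \<Longrightarrow> frame c s s'"
  unfolding run_def using exec_frame by blast

section \<open>Symbolic execution of loop-free programs\<close>

primrec loop_free :: "com \<Rightarrow> bool" where
  "loop_free Skip \<longleftrightarrow> True"
| "loop_free (Assign y e) \<longleftrightarrow> True"
| "loop_free (Store a i e) \<longleftrightarrow> True"
| "loop_free (Seq c d) \<longleftrightarrow> loop_free c \<and> loop_free d"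
| "loop_free (Cond b c d) \<longleftrightarrow> loop_free c \<and> loop_free d"
| "loop_free (While b c) \<longleftrightarrow> False"

text \<open>Without loops, execution is a function that the simplifier can evaluate. The values of
  \<open>result\<close> and \<open>cost\<close> at \<open>While\<close> are dummies, excluded by
  \<open>loop_free\<close>.\<close>

primrec result :: "com \<Rightarrow> state \<Rightarrow> state" where
  "result Skip s = s"
| "result (Assign x e) s = s\<lparr>vars := (vars s)(x := aval e s)\<rparr>"
| "result (Store a i e) s = s\<lparr>arrs := (arrs s)(a := (arrs s a)(aval i s := aval e s))\<rparr>"
| "result (Seq c d) s = result d (result c s)"
| "result (Cond b c d) s = (if bval b s then result c s else result d s)"
| "result (While b c) s = s"

primrec fits :: "nat \<Rightarrow> com \<Rightarrow> state \<Rightarrow> bool" where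
  "fits W Skip s \<longleftrightarrow> True"
| "fits W (Assign x e) s \<longleftrightarrow> afits W e s"
| "fits W (Store a i e) s \<longleftrightarrow> afits W i s \<and> afits W e s"
| "fits W (Seq c d) s \<longleftrightarrow> fits W c s \<and> fits W d (result c s)"
| "fits W (Cond b c d) s \<longleftrightarrow> bfits W b s \<and> (if bval b s then fits W c s else fits W d s)"
| "fits W (While b c) s \<longleftrightarrow> False"

primrec cost :: "com \<Rightarrow> nat" where
  "cost Skip = 1"
| "cost (Assign x e) = 1 + acost e"
| "cost (Store a i e) = 1 + acost i + acost e"
| "cost (Seq c d) = cost c + cost d"
| "cost (Cond b c d) = 1 + bcost b + max (cost c) (cost d)"
| "cost (While b c) = 0"

lemma run_loop_free: "loop_free c \<Longrightarrow> fits W c s \<Longrightarrow> run W (cost c) c s (result c s)"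
proof (induction c arbitrary: s)
  case (Seq c d)
  then have "run W (cost c) c s (result c s)" "run W (cost d) d (result c s) (result d (result c s))"
    by simp_all
  then show ?case unfolding cost.simps result.simps by (rule run_Seq)
next
  case (Cond b c d)
  have "run W (1 + bcost b + max (cost c) (cost d)) (Cond b c d) s (result (Cond b c d) s)"
  proof (rule run_Cond)
    assume b: "bval b s"
    then have "run W (cost c) c s (result c s)" using Cond by simp
    then show "run W (max (cost c) (cost d)) c s (result (Cond b c d) s)"
      using run_mono[OF _ max.cobounded1] b by simp
  next
    assume b: "\<not> bval b s"
    then have "run W (cost d) d s (result d s)" using Cond by simp
    then show "run W (max (cost c) (cost d)) d s (result (Cond b c d) s)"
      using run_mono[OF _ max.cobounded2] b by simp
  qed (use Cond in simp)
  then show ?case by simp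
next
  case (Assign x e)
  then show ?case using exec.Assign[of W e s x] unfolding run_def by auto
next
  case (Store a i e)
  then show ?case using exec.Store[of W i s e a] unfolding run_def by (intro exI[of _ "1 + acost i + acost e"]) simp
next
  case Skip
  then show ?case using exec.Skip[of W s] unfolding run_def by auto
qed simp

lemma run_loop_freeI:
  "fits W c s \<Longrightarrow> loop_free c \<Longrightarrow> cost c \<le> T \<Longrightarrow> run W T c s (result c s)"
  using run_loop_free run_mono by blast

definition For :: "nat \<Rightarrow> com \<Rightarrow> com" where
  "For x c = Seq (Assign x (Const 0))
     (While (Less (Var x) (Var 0)) (Seq c (Assign x (Add (Var x) (Const 1)))))"

lemma writes_For [simp]:
  "writes_var (For x c) y \<longleftrightarrow> y = x \<or> writes_var c y"
  "writes_arr (For x c) a \<longleftrightarrow> writes_arr c a"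
  by (auto simp: For_def)

text \<open>Initialization costs 2, every test 4 and every increment 4, whence
  \<open>6 + n * (T + 8)\<close>. The frame relative to the starting state \<open>s\<close> gives
  the loop body access to everything the loop leaves alone.\<close>

lemma run_For:
  assumes n: "vars s 0 = n" "n < W" "1 < W" and x: "x \<noteq> 0" "\<not> writes_var c x" "\<not> writes_var c 0"
    and init: "P 0 (s\<lparr>vars := (vars s)(x := 0)\<rparr>)"
    and step: "\<And>i s1. i < n \<Longrightarrow> P i s1 \<Longrightarrow> vars s1 x = i \<Longrightarrow> vars s1 0 = n \<Longrightarrow> frame (For x c) s s1 \<Longrightarrow>
      \<exists>s2. run W T c s1 s2 \<and> P (Suc i) (s2\<lparr>vars := (vars s2)(x := Suc i)\<rparr>)"
  shows "\<exists>s'. run W (6 + n * (T + 8)) (For x c) s s' \<and> P n s' \<and> frame (For x c) s s'"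
proof -
  let ?b = "Less (Var x) (Var 0)" and ?c = "Seq c (Assign x (Add (Var x) (Const 1)))"
  let ?s = "s\<lparr>vars := (vars s)(x := 0)\<rparr>"
  define Q where "Q s1 \<longleftrightarrow> vars s1 x \<le> n \<and> vars s1 0 = n \<and> P (vars s1 x) s1 \<and> frame (For x c) s s1" for s1
  have "\<exists>s'. run W (1 + bcost ?b + (n - vars ?s x) * (1 + bcost ?b + (T + 4))) (While ?b ?c) ?s s' \<and> Q s' \<and> \<not> bval ?b s'"
  proof (rule run_While)
    show "Q ?s" using init n x by (simp add: Q_def frame_def)
  next
    fix s1 assume "Q s1" then show "bfits W ?b s1" using n by (simp add: Q_def)
  next
    fix s1 assume Q: "Q s1" and "bval ?b s1"
    then have lt: "vars s1 x < n" by (simp add: Q_def)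
    then obtain s2 where s2: "run W T c s1 s2" "P (Suc (vars s1 x)) (s2\<lparr>vars := (vars s2)(x := Suc (vars s1 x))\<rparr>)"
      using step[OF lt] Q unfolding Q_def by blast
    have fr: "frame c s1 s2" using run_frame[OF s2(1)] .
    have eq: "vars s2 x = vars s1 x" "vars s2 0 = n" using frame_vars[OF fr] x Q by (simp_all add: Q_def)
    let ?s2 = "s2\<lparr>vars := (vars s2)(x := Suc (vars s1 x))\<rparr>"
    have "run W 4 (Assign x (Add (Var x) (Const 1))) s2 ?s2"
      using run_loop_free[of "Assign x (Add (Var x) (Const 1))" W s2] eq lt n
      by (simp add: eval_nat_numeral)
    with s2(1) have "run W (T + 4) ?c s1 ?s2" by (rule run_Seq)
    moreover have "Q ?s2"
      using s2(2) eq lt x Q fr by (auto simp: Q_def frame_def)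
    moreover have "n - vars ?s2 x < n - vars s1 x" using lt by simp
    ultimately show "\<exists>s'. run W (T + 4) ?c s1 s' \<and> Q s' \<and> n - vars s' x < n - vars s1 x" by blast
  qed
  then obtain s' where s': "run W (4 + n * (T + 8)) (While ?b ?c) ?s s'" "Q s'" "\<not> bval ?b s'"
    by (auto simp: eval_nat_numeral)
  have "run W 2 (Assign x (Const 0)) s ?s"
    using run_loop_free[of "Assign x (Const 0)" W s] n by (simp add: eval_nat_numeral)
  from run_Seq[OF this s'(1)] have "run W (6 + n * (T + 8)) (For x c) s s'"
    unfolding For_def by simp
  moreover have "vars s' x = n" using s' by (simp add: Q_def)
  ultimately show ?thesis using s'(2) unfolding Q_def by auto
qed

definition emit :: "aexp \<Rightarrow> com" where
  "emit e = Seq (Store 1 (Var 1) e) (Assign 1 (Add (Var 1) (Const 1)))"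

primrec emits :: "aexp list \<Rightarrow> com" where
  "emits [] = Skip"
| "emits (e # es) = Seq (emit e) (emits es)"

lemma writes_emit [simp]:
  "writes_var (emit e) x \<longleftrightarrow> x = 1" "writes_arr (emit e) x \<longleftrightarrow> x = 1"
  by (simp_all add: emit_def)

lemma writes_emits [simp]:
  "writes_var (emits es) x \<longleftrightarrow> x = 1 \<and> es \<noteq> []" "writes_arr (emits es) x \<longleftrightarrow> x = 1 \<and> es \<noteq> []"
  by (induction es) auto

text \<open>Variable 1 is the write position and moves during emission; other variables and
  constants keep their values, so a whole list may be evaluated in the starting state.\<close>

definition atom :: "nat \<Rightarrow> aexp \<Rightarrow> state \<Rightarrow> bool" where
  "atom W e s \<longleftrightarrow> (\<exists>c < W. e = Const c) \<or> (\<exists>x. x \<noteq> 1 \<and> e = Var x \<and> vars s x < W)"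

text \<open>Each symbol costs 3 for the store and 4 for moving the write position; the closing
  \<open>Skip\<close> costs 1.\<close>

lemma run_emits:
  assumes "outputs s xs" "length xs + length es < W" "1 < W" "\<And>e. e \<in> set es \<Longrightarrow> atom W e s"
  shows "\<exists>s'. run W (1 + 7 * length es) (emits es) s s' \<and> outputs s' (xs @ map (\<lambda>e. aval e s) es)"
  using assms
proof (induction es arbitrary: s xs)
  case Nil
  have "run W 1 Skip s s" using run_loop_free[of Skip W s] by simp
  then show ?case using Nil by auto
next
  case (Cons e es)
  have e: "afits W e s" "acost e = 1" using Cons.prems(4)[of e] by (auto simp: atom_def)
  have ptr: "vars s 1 = length xs" using Cons.prems(1) by (simp add: outputs_def)
  let ?s = "result (emit e) s"
  have s1: "?s = s\<lparr>vars := (vars s)(1 := Suc (length xs)), arrs := (arrs s)(1 := (arrs s 1)(length xs := aval e s))\<rparr>"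
    using ptr by (simp add: emit_def)
  have "fits W (emit e) s" using Cons.prems e ptr by (simp add: emit_def)
  then have 1: "run W 7 (emit e) s ?s"
    using run_loop_free[of "emit e" W s] e by (simp add: emit_def eval_nat_numeral)
  have "outputs ?s (xs @ [aval e s])"
    using Cons.prems(1) unfolding s1 outputs_def by (auto simp: nth_append)
  moreover have "atom W f ?s" if "f \<in> set es" for f
    using Cons.prems(4)[of f] that unfolding s1 atom_def by auto
  ultimately obtain s2 where s2: "run W (1 + 7 * length es) (emits es) ?s s2"
    "outputs s2 ((xs @ [aval e s]) @ map (\<lambda>e. aval e ?s) es)"
    using Cons.IH[of ?s "xs @ [aval e s]"] Cons.prems by auto
  have "aval f ?s = aval f s" if "f \<in> set es" for f
    using Cons.prems(4)[of f] that unfolding s1 atom_def by auto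
  then have "map (\<lambda>e. aval e ?s) es = map (\<lambda>e. aval e s) es" by simp
  with s2(2) have "outputs s2 (xs @ map (\<lambda>e. aval e s) (e # es))" by simp
  moreover have "run W (1 + 7 * length (e # es)) (emits (e # es)) s s2"
    using run_Seq[OF 1 s2(1)] by (simp add: add.commute)
  ultimately show ?case by blast
qed

section \<open>Preprocessing\<close>

text \<open>Use of the memory: the loops run over variables 2, 3, 4; variable 5 is the height \<open>L\<close> of the
  stack of pending subproblems, 6 and 7 are the clique vertices of least and largest degree in the
  current subproblem, 8 is the separating vertex \<open>z\<close>, and 9 and 10 tell whether the parts below and
  above \<open>z\<close> are nonempty. Arrays 2, 3 and 5 hold degrees, membership in the clique and the part
  below \<open>z\<close>; array 4 holds the stack level of each vertex, 0 for those already emitted. In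
  variables 6, 7 and 8 the value \<open>n\<close> means that there is no such vertex.\<close>

abbreviation (input) Or where "Or b c \<equiv> Not (And (Not b) (Not c))"

definition entry :: "aexp \<Rightarrow> aexp \<Rightarrow> aexp" where
  "entry e f = Arr 0 (Add (Mul e (Var 0)) f)"

definition deg_prog :: com where
  "deg_prog = For 2 (For 3 (Store 2 (Var 2) (Add (Arr 2 (Var 2)) (entry (Var 2) (Var 3)))))"

definition hub_test :: bexp where
  "hub_test = And (Eq (entry (Var 2) (Var 3)) (Const 1))
     (Or (And (Eq (entry (Var 2) (Var 4)) (Const 1))
           (And (Eq (entry (Var 3) (Var 4)) (Const 0)) (Not (Eq (Var 3) (Var 4)))))
         (And (Less (Var 2) (Var 3)) (Eq (Arr 2 (Var 3)) (Const 1))))"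

definition core_prog :: com where
  "core_prog = For 2 (For 3 (For 4 (Cond hub_test (Store 3 (Var 2) (Const 1)) Skip)))"

definition init_prog :: com where
  "init_prog = Seq (For 2 (Store 4 (Var 2) (Const 1))) (Assign 5 (Const 1))"

text \<open>The quadratic term of the word bound accommodates matrix addresses; together with the
  linear term it also covers row \<open>n\<close>, which is read for the dummy vertex. The linear
  term alone suffices for vertices, levels and output positions, as at most 30 symbols are written
  per vertex.\<close>

locale input_graph = pair_graph G for G :: "nat pair_pre_digraph" +
  fixes n W :: nat
  assumes verts: "pverts G = {0..<n}" and n_pos: "1 \<le> n" and W: "n * n + 40 * n + 100 < W"
begin

definition matrix :: "nat \<Rightarrow> nat" where
  "matrix i = (if i < n * n \<and> (i div n, i mod n) \<in> parcs G then 1 else 0)"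

text \<open>There is no bound on \<open>u\<close>: for the dummy vertex \<open>n\<close> the address lies behind the matrix, where
  the array is zero.\<close>

lemma matrix_entry: "v < n \<Longrightarrow> matrix (u * n + v) = (if (u, v) \<in> parcs G then 1 else 0)"
proof -
  assume v: "v < n"
  show ?thesis
  proof (cases "u < n")
    case True
    have "u * n + v < Suc u * n" using v by simp
    also have "\<dots> \<le> n * n" using True by (intro mult_le_mono1) simp
    finally show ?thesis using v by (simp add: matrix_def)
  next
    case False
    then have "n * n \<le> u * n" by (intro mult_le_mono1) simp
    then have "\<not> u * n + v < n * n" by linarith
    then have "matrix (u * n + v) = 0" by (simp only: matrix_def simp_thms if_False)
    moreover have "(u, v) \<notin> parcs G" using in_arcsD1[of u v] verts False by auto
    ultimately show ?thesis by simp
  qed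
qed

lemma matrix_le_1: "matrix i \<le> 1"
  by (simp add: matrix_def)

lemma matrix_W: "matrix i < W"
  using matrix_le_1[of i] W by simp

lemma bound_W: "a \<le> 40 * n + 100 \<Longrightarrow> a < W"
  using W by simp

lemma index_W: "u \<le> n \<Longrightarrow> v \<le> n \<Longrightarrow> u * n + v < W" "u \<le> n \<Longrightarrow> u * n < W"
proof -
  assume "u \<le> n"
  then have "u * n \<le> n * n" by (rule mult_le_mono1)
  then show "u * n < W" using W by linarith
  assume "v \<le> n"
  then show "u * n + v < W" using W \<open>u * n \<le> n * n\<close> by linarith
qed

lemmas word_simps = matrix_entry matrix_W bound_W index_W

definition degrees :: "nat \<Rightarrow> nat" where
  "degrees v = (if v < n then card (nbhd G v) else 0)"

lemma card_nbhd: "card (nbhd G v) \<le> n"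
proof -
  have "nbhd G v \<subseteq> {0..<n}" using in_arcsD2 verts unfolding nbhd_def by blast
  then show ?thesis using card_mono[of "{0..<n}"] by simp
qed

lemma degrees_W: "degrees v < W" "card (nbhd G v) < W"
  using card_nbhd[of v] W unfolding degrees_def by auto

lemma run_deg_prog:
  assumes "vars s 0 = n" "arrs s 0 = matrix" "arrs s 2 = (\<lambda>_. 0)"
  shows "\<exists>s'. run W (50 * (n + 1) * (n + 1)) deg_prog s s' \<and> arrs s' 2 = degrees"
proof -
  \<comment> \<open>Array 2 when the rows before \<open>i\<close> are summed and row
    \<open>i\<close> is summed up to column \<open>j\<close>. A finished row,
    \<open>?row i n\<close>, is the same function as \<open>?row (Suc i) 0\<close>, which connects
    the two loops.\<close>
  let ?row = "\<lambda>i j v. if v < i then card (nbhd G v) else if v = i then card (nbhd G i \<inter> {..<j}) else 0"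
  let ?step = "Store 2 (Var 2) (Add (Arr 2 (Var 2)) (entry (Var 2) (Var 3)))"
  have full: "nbhd G i \<inter> {..<n} = nbhd G i" for i
    using in_arcsD2 verts unfolding nbhd_def by auto
  have inner: "\<exists>s2. run W (6 + n * (20 + 8)) (For 3 ?step) s1 s2 \<and> arrs s2 2 = ?row (Suc i) 0"
    if i: "i < n" and s1: "arrs s1 2 = ?row i 0" "vars s1 2 = i" "vars s1 0 = n" "arrs s1 0 = matrix" for i s1
  proof -
    have "\<exists>s2. run W (6 + n * (20 + 8)) (For 3 ?step) s1 s2 \<and> arrs s2 2 = ?row i n \<and> frame (For 3 ?step) s1 s2"
    proof (rule run_For[where P="\<lambda>j s. arrs s 2 = ?row i j"])
      fix j s2
      assume j: "j < n" and s2: "arrs s2 2 = ?row i j" "vars s2 3 = j" "vars s2 0 = n"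
        and fr: "frame (For 3 ?step) s1 s2"
      have eq: "vars s2 2 = i" "arrs s2 0 = matrix" using frame_vars[OF fr] frame_arrs[OF fr] s1 by simp_all
      have suc: "card (nbhd G i \<inter> {..<Suc j}) = card (nbhd G i \<inter> {..<j}) + (if (i, j) \<in> parcs G then 1 else 0)"
        by (simp add: lessThan_Suc nbhd_def)
      have le: "card (nbhd G i \<inter> {..<j}) \<le> n"
        using card_mono[of "{..<j}" "nbhd G i \<inter> {..<j}"] j by simp
      have "fits W ?step s2"
        using i j s2 eq le by (simp add: entry_def word_simps)
      then have "run W 20 ?step s2 (result ?step s2)" by (rule run_loop_freeI) (simp_all add: entry_def)
      moreover have "arrs (result ?step s2) 2 = ?row i (Suc j)"
        using i j s2 eq by (auto simp: entry_def word_simps suc fun_eq_iff)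
      ultimately show "\<exists>s3. run W 20 ?step s2 s3 \<and>
          arrs (s3\<lparr>vars := (vars s3)(3 := Suc j)\<rparr>) 2 = ?row i (Suc j)"
        by (intro exI[of _ "result ?step s2"]) simp
    qed (use i s1 W n_pos in \<open>auto simp: entry_def\<close>)
    moreover have "?row i n = ?row (Suc i) 0" using full by (auto simp: fun_eq_iff less_Suc_eq)
    ultimately show ?thesis by auto
  qed
  have "\<exists>s'. run W (6 + n * ((6 + n * (20 + 8)) + 8)) deg_prog s s' \<and> arrs s' 2 = ?row n 0 \<and> frame deg_prog s s'"
    unfolding deg_prog_def
  proof (rule run_For[where P="\<lambda>i s. arrs s 2 = ?row i 0"])
    fix i s1
    assume "i < n" "arrs s1 2 = ?row i 0" "vars s1 2 = i" "vars s1 0 = n" and fr: "frame (For 2 (For 3 ?step)) s s1"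
    moreover have "arrs s1 0 = matrix" using frame_arrs[OF fr] assms by simp
    ultimately obtain s2 where "run W (6 + n * (20 + 8)) (For 3 ?step) s1 s2" "arrs s2 2 = ?row (Suc i) 0"
      using inner by blast
    then show "\<exists>s2. run W (6 + n * (20 + 8)) (For 3 ?step) s1 s2 \<and>
        arrs (s2\<lparr>vars := (vars s2)(2 := Suc i)\<rparr>) 2 = ?row (Suc i) 0" by (intro exI[of _ s2]) simp
  qed (use assms W n_pos in \<open>auto\<close>)
  then obtain s' where s': "run W (6 + n * ((6 + n * (20 + 8)) + 8)) deg_prog s s'" "arrs s' 2 = ?row n 0" by blast
  have "run W (50 * (n + 1) * (n + 1)) deg_prog s s'" using s'(1) by (rule run_mono) (simp add: algebra_simps)
  moreover have "?row n 0 = degrees" by (auto simp: degrees_def fun_eq_iff)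
  ultimately show ?thesis using s'(2) by (intro exI[of _ s']) simp
qed

lemma run_core_prog:
  assumes "vars s 0 = n" "arrs s 0 = matrix" "arrs s 2 = degrees" "arrs s 3 = (\<lambda>_. 0)"
  shows "\<exists>s'. run W (100 * (n + 1) * (n + 1) * (n + 1)) core_prog s s' \<and>
    arrs s' 3 = (\<lambda>v. if v \<in> core G then 1 else 0)"
proof -
  let ?H = "hub G"
  \<comment> \<open>Array 3 after all triples lexicographically before \<open>(i, j, k)\<close> have
    been tested. The end of an inner loop and the next start of the surrounding one give the same
    function.\<close>
  let ?c = "\<lambda>i j k v. if v < i \<and> (\<exists>x<n. \<exists>y<n. ?H v x y) \<or> v = i \<and> ((\<exists>x<j. \<exists>y<n. ?H v x y) \<or> (\<exists>y<k. ?H v j y))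
    then 1 else 0 :: nat"
  let ?step = "Cond hub_test (Store 3 (Var 2) (Const 1)) Skip"
  let ?T = "60"
  have inner: "\<exists>s2. run W (6 + n * (?T + 8)) (For 4 ?step) s1 s2 \<and> arrs s2 3 = ?c i (Suc j) 0"
    if ij: "i < n" "j < n" and s1: "arrs s1 3 = ?c i j 0" "vars s1 2 = i" "vars s1 3 = j" "vars s1 0 = n"
      "arrs s1 0 = matrix" "arrs s1 2 = degrees" for i j s1
  proof -
    have "\<exists>s2. run W (6 + n * (?T + 8)) (For 4 ?step) s1 s2 \<and> arrs s2 3 = ?c i j n \<and> frame (For 4 ?step) s1 s2"
    proof (rule run_For[where P="\<lambda>k s. arrs s 3 = ?c i j k"])
      fix k s2
      assume k: "k < n" and s2: "arrs s2 3 = ?c i j k" "vars s2 4 = k" "vars s2 0 = n"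
        and fr: "frame (For 4 ?step) s1 s2"
      have eq: "vars s2 2 = i" "vars s2 3 = j" "arrs s2 0 = matrix" "arrs s2 2 = degrees"
        using frame_vars[OF fr] frame_arrs[OF fr] s1 by simp_all
      have "bfits W hub_test s2"
        using ij k s2 eq by (simp add: hub_test_def entry_def word_simps degrees_W)
      then have "fits W ?step s2" using ij eq by (simp add: bound_W)
      then have "run W ?T ?step s2 (result ?step s2)"
        by (rule run_loop_freeI) (simp_all add: entry_def hub_test_def)
      moreover have "bval hub_test s2 \<longleftrightarrow> ?H i j k"
        using ij k s2 eq by (simp add: hub_test_def entry_def word_simps hub_def degrees_def)
      then have "arrs (result ?step s2) 3 = ?c i j (Suc k)"
        using s2 eq by (auto simp: fun_eq_iff less_Suc_eq)
      ultimately show "\<exists>s3. run W ?T ?step s2 s3 \<and>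
          arrs (s3\<lparr>vars := (vars s3)(4 := Suc k)\<rparr>) 3 = ?c i j (Suc k)"
        by (intro exI[of _ "result ?step s2"]) simp
    qed (use s1 W n_pos in \<open>auto\<close>)
    moreover have "?c i j n = ?c i (Suc j) 0" by (auto simp: fun_eq_iff less_Suc_eq)
    ultimately show ?thesis by auto
  qed
  let ?T2 = "6 + n * (?T + 8)"
  have middle: "\<exists>s2. run W (6 + n * (?T2 + 8)) (For 3 (For 4 ?step)) s1 s2 \<and> arrs s2 3 = ?c (Suc i) 0 0"
    if i: "i < n" and s1: "arrs s1 3 = ?c i 0 0" "vars s1 2 = i" "vars s1 0 = n"
      "arrs s1 0 = matrix" "arrs s1 2 = degrees" for i s1
  proof -
    have "\<exists>s2. run W (6 + n * (?T2 + 8)) (For 3 (For 4 ?step)) s1 s2 \<and> arrs s2 3 = ?c i n 0 \<and>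
      frame (For 3 (For 4 ?step)) s1 s2"
    proof (rule run_For[where P="\<lambda>j s. arrs s 3 = ?c i j 0"])
      fix j s2
      assume j: "j < n" and s2: "arrs s2 3 = ?c i j 0" "vars s2 3 = j" "vars s2 0 = n"
        and fr: "frame (For 3 (For 4 ?step)) s1 s2"
      have eq: "vars s2 2 = i" "arrs s2 0 = matrix" "arrs s2 2 = degrees"
        using frame_vars[OF fr] frame_arrs[OF fr] s1 by simp_all
      from inner[OF i j s2(1) eq(1) s2(2,3) eq(2,3)] obtain s3
        where "run W ?T2 (For 4 ?step) s2 s3" "arrs s3 3 = ?c i (Suc j) 0" by blast
      then show "\<exists>s3. run W ?T2 (For 4 ?step) s2 s3 \<and>
          arrs (s3\<lparr>vars := (vars s3)(3 := Suc j)\<rparr>) 3 = ?c i (Suc j) 0"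
        by (intro exI[of _ s3]) simp
    qed (use s1 W n_pos in \<open>auto\<close>)
    moreover have "?c i n 0 = ?c (Suc i) 0 0" by (auto simp: fun_eq_iff less_Suc_eq)
    ultimately show ?thesis by auto
  qed
  let ?T3 = "6 + n * (?T2 + 8)"
  have "\<exists>s'. run W (6 + n * (?T3 + 8)) core_prog s s' \<and> arrs s' 3 = ?c n 0 0 \<and> frame core_prog s s'"
    unfolding core_prog_def
  proof (rule run_For[where P="\<lambda>i s. arrs s 3 = ?c i 0 0"])
    fix i s1
    assume i: "i < n" and s1: "arrs s1 3 = ?c i 0 0" "vars s1 2 = i" "vars s1 0 = n"
      and fr: "frame (For 2 (For 3 (For 4 ?step))) s s1"
    have eq: "arrs s1 0 = matrix" "arrs s1 2 = degrees"
      using frame_arrs[OF fr] assms by simp_all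
    from middle[OF i s1 eq] obtain s2 where "run W ?T3 (For 3 (For 4 ?step)) s1 s2" "arrs s2 3 = ?c (Suc i) 0 0"
      by blast
    then show "\<exists>s2. run W ?T3 (For 3 (For 4 ?step)) s1 s2 \<and>
        arrs (s2\<lparr>vars := (vars s2)(2 := Suc i)\<rparr>) 3 = ?c (Suc i) 0 0"
      by (intro exI[of _ s2]) simp
  qed (use assms W n_pos in \<open>auto\<close>)
  then obtain s' where s': "run W (6 + n * (?T3 + 8)) core_prog s s'" "arrs s' 3 = ?c n 0 0" by blast
  have "run W (100 * (n + 1) * (n + 1) * (n + 1)) core_prog s s'"
    using s'(1) by (rule run_mono) (simp add: algebra_simps)
  moreover have "?c n 0 0 = (\<lambda>v. if v \<in> core G then 1 else 0)"
    unfolding core_def verts atLeast0LessThan by (auto simp: fun_eq_iff Bex_def)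
  ultimately show ?thesis using s'(2) by (intro exI[of _ s']) simp
qed

lemma run_init_prog:
  assumes "vars s 0 = n" "arrs s 4 = (\<lambda>_. 0)"
  shows "\<exists>s'. run W (50 * (n + 1)) init_prog s s' \<and> vars s' 5 = 1 \<and> arrs s' 4 = (\<lambda>v. if v < n then 1 else 0)"
proof -
  let ?step = "Store 4 (Var 2) (Const 1)"
  have "\<exists>s1. run W (6 + n * (3 + 8)) (For 2 ?step) s s1 \<and> arrs s1 4 = (\<lambda>v. if v < n then 1 else 0) \<and>
    frame (For 2 ?step) s s1"
  proof (rule run_For[where P="\<lambda>i s. arrs s 4 = (\<lambda>v. if v < i then 1 else 0)"])
    fix i and s1 :: state
    assume i: "i < n" and s1: "arrs (s1 :: state) 4 = (\<lambda>v. if v < i then 1 else 0)" "vars s1 2 = i" "vars s1 0 = n"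
    have "run W (cost ?step) ?step s1 (result ?step s1)" using i s1 W by (intro run_loop_free) simp_all
    moreover have "arrs (result ?step s1) 4 = (\<lambda>v. if v < Suc i then 1 else 0)"
      using s1 by (auto simp: fun_eq_iff)
    ultimately show "\<exists>s2. run W 3 ?step s1 s2 \<and>
        arrs (s2\<lparr>vars := (vars s2)(2 := Suc i)\<rparr>) 4 = (\<lambda>v. if v < Suc i then 1 else 0)"
      by (intro exI[of _ "result ?step s1"]) (simp add: eval_nat_numeral)
  qed (use assms W n_pos in \<open>auto\<close>)
  then obtain s1 where s1: "run W (6 + n * (3 + 8)) (For 2 ?step) s s1" "arrs s1 4 = (\<lambda>v. if v < n then 1 else 0)"
    by blast
  let ?c = "Assign 5 (Const 1)"
  have "run W (cost ?c) ?c s1 (result ?c s1)" using W by (intro run_loop_free) simp_all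
  from run_Seq[OF s1(1) this] have "run W (50 * (n + 1)) init_prog s (result ?c s1)"
    unfolding init_prog_def by (rule run_mono) simp
  then show ?thesis using s1(2) by (intro exI[of _ "result ?c s1"]) simp
qed

end

section \<open>Splitting a subproblem\<close>

definition at_level :: "nat \<Rightarrow> bexp" where
  "at_level x = Eq (Arr 4 (Var x)) (Var 5)"

text \<open>The first minimum and the last maximum are kept, so the two vertices differ as soon as
  the level has two clique vertices, even if their degrees are equal.\<close>

definition extremes_prog :: com where
  "extremes_prog = Seq (Assign 6 (Var 0)) (Seq (Assign 7 (Var 0)) (For 2
     (Cond (And (at_level 2) (Eq (Arr 3 (Var 2)) (Const 1)))
       (Seq (Cond (Or (Eq (Var 6) (Var 0)) (Less (Arr 2 (Var 2)) (Arr 2 (Var 6)))) (Assign 6 (Var 2)) Skip)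
         (Cond (Or (Eq (Var 7) (Var 0)) (Not (Less (Arr 2 (Var 2)) (Arr 2 (Var 7))))) (Assign 7 (Var 2)) Skip))
       Skip)))"

text \<open>The first independent vertex of the level is a fallback; only a private neighbour of
  variable 6 against variable 7 can replace it.\<close>

definition select_prog :: com where
  "select_prog = Seq (Assign 8 (Var 0)) (For 2
     (Cond (And (And (at_level 2) (Eq (Arr 3 (Var 2)) (Const 0)))
         (Or (Eq (Var 8) (Var 0)) (And (Eq (entry (Var 6) (Var 2)) (Const 1)) (Eq (entry (Var 7) (Var 2)) (Const 0)))))
       (Assign 8 (Var 2)) Skip))"

definition lower_test :: bexp where
  "lower_test = And (And (at_level 3) (Eq (Arr 3 (Var 3)) (Const 1)))
     (And (Eq (entry (Var 3) (Var 8)) (Const 1))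
       (Or (Eq (Var 2) (Var 3)) (And (Eq (entry (Var 3) (Var 2)) (Const 1)) (Eq (Arr 3 (Var 2)) (Const 0)))))"

text \<open>\<open>z\<close> leaves its level before the loop, so it is neither marked nor counted
  when the parts are tested for emptiness.\<close>

definition mark_prog :: com where
  "mark_prog = Seq (Store 4 (Var 8) (Const 0)) (Seq (Assign 9 (Const 0)) (Seq (Assign 10 (Const 0)) (For 2
     (Cond (at_level 2)
       (Seq (Store 5 (Var 2) (Const 0))
         (Seq (For 3 (Cond lower_test (Store 5 (Var 2) (Const 1)) Skip))
           (Cond (Eq (Arr 5 (Var 2)) (Const 1)) (Assign 9 (Const 1)) (Assign 10 (Const 1)))))
       Skip))))"

text \<open>The lower part goes on top of the stack because it is the first operand of the union and
  its code must come first; the upper part keeps its level.\<close>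

definition push_prog :: com where
  "push_prog = Seq (For 2
       (Cond (at_level 2) (Cond (Eq (Arr 5 (Var 2)) (Const 1)) (Store 4 (Var 2) (Add (Var 5) (Const 1))) Skip) Skip))
     (Assign 5 (Add (Var 5) (Const 1)))"

locale input_split = input_graph G n W + one_Sperner_split G K I
  for G :: "nat pair_pre_digraph" and n W :: nat and K I :: "nat set"
begin

definition config :: "(nat \<Rightarrow> nat) \<Rightarrow> nat \<Rightarrow> state \<Rightarrow> bool" where
  "config lv L s \<longleftrightarrow> vars s 0 = n \<and> arrs s 0 = matrix \<and> arrs s 2 = degrees \<and>
     arrs s 3 = (\<lambda>v. if v \<in> K then 1 else 0) \<and> arrs s 4 = lv \<and> vars s 5 = L"

definition level :: "(nat \<Rightarrow> nat) \<Rightarrow> nat \<Rightarrow> nat set" where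
  "level lv i = {v. v < n \<and> lv v = i}"

lemma degrees_deg: "v < n \<Longrightarrow> degrees v = deg v"
  by (simp add: degrees_def deg_def)

lemma I_iff: "v < n \<Longrightarrow> v \<in> I \<longleftrightarrow> v \<notin> K"
  using K_Un_I K_Int_I verts by auto

lemma K_less: "v \<in> K \<Longrightarrow> v < n"
  using K_Un_I verts by auto

definition extremes :: "nat set \<Rightarrow> nat \<Rightarrow> nat \<Rightarrow> bool" where
  "extremes T u w \<longleftrightarrow> T = {} \<and> u = n \<and> w = n \<or>
     u \<in> T \<and> w \<in> T \<and> (\<forall>e \<in> T. deg u \<le> deg e \<and> deg e \<le> deg w) \<and> (u = w \<longrightarrow> T \<subseteq> {u})"

text \<open>On a tie the new vertex replaces \<open>w\<close> but not \<open>u\<close>; this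
  preserves the last clause of \<open>extremes\<close>.\<close>

lemma extremes_insert:
  assumes "extremes T u w" "T \<subseteq> {..<n}" "v < n" "v \<notin> T"
  shows "extremes (insert v T) (if u = n \<or> deg v < deg u then v else u) (if w = n \<or> \<not> deg v < deg w then v else w)"
proof (cases "T = {}")
  case True
  then show ?thesis using assms(1) by (simp add: extremes_def)
next
  case False
  then have T: "u \<in> T" "w \<in> T" "\<And>e. e \<in> T \<Longrightarrow> deg u \<le> deg e" "\<And>e. e \<in> T \<Longrightarrow> deg e \<le> deg w" "u = w \<Longrightarrow> T \<subseteq> {u}"
    using assms(1) by (auto simp: extremes_def)
  have "u < n" "w < n" "deg u \<le> deg w" "v \<noteq> u" "v \<noteq> w" using T(1-3) assms(2,4) by auto
  have e: "deg u \<le> deg e" "deg e \<le> deg w" if "e \<in> T" for e using T that by auto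
  show ?thesis
    using e \<open>u < n\<close> \<open>w < n\<close> \<open>deg u \<le> deg w\<close> T(1,2) \<open>v \<noteq> u\<close> \<open>v \<noteq> w\<close>
    unfolding extremes_def by (auto intro: le_trans dest: e)
qed

lemma run_extremes_prog:
  assumes c: "config lv L s" and le: "\<And>v. v < n \<Longrightarrow> lv v \<le> L" "L \<le> n"
  shows "\<exists>s'. run W (100 * (n + 1)) extremes_prog s s' \<and> extremes (K \<inter> level lv L) (vars s' 6) (vars s' 7)"
proof -
  let ?T = "\<lambda>i. K \<inter> level lv L \<inter> {..<i}"
  let ?step = "Cond (And (at_level 2) (Eq (Arr 3 (Var 2)) (Const 1)))
       (Seq (Cond (Or (Eq (Var 6) (Var 0)) (Less (Arr 2 (Var 2)) (Arr 2 (Var 6)))) (Assign 6 (Var 2)) Skip)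
         (Cond (Or (Eq (Var 7) (Var 0)) (Not (Less (Arr 2 (Var 2)) (Arr 2 (Var 7))))) (Assign 7 (Var 2)) Skip))
       Skip"
  define s1 where "s1 = s\<lparr>vars := (vars s)(6 := n, 7 := n)\<rparr>"
  have s1: "run W 2 (Assign 6 (Var 0)) s (s\<lparr>vars := (vars s)(6 := n)\<rparr>)"
    "run W 2 (Assign 7 (Var 0)) (s\<lparr>vars := (vars s)(6 := n)\<rparr>) s1"
    using run_loop_free[of "Assign 6 (Var 0)" W s] run_loop_free[of "Assign 7 (Var 0)" W "s\<lparr>vars := (vars s)(6 := n)\<rparr>"] c W
    by (simp_all add: s1_def config_def bound_W eval_nat_numeral)
  have c1: "config lv L s1" using c by (simp add: config_def s1_def)
  have "\<exists>s'. run W (6 + n * (50 + 8)) (For 2 ?step) s1 s' \<and> extremes (?T n) (vars s' 6) (vars s' 7) \<and> frame (For 2 ?step) s1 s'"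
  proof (rule run_For[where P="\<lambda>i s. extremes (?T i) (vars s 6) (vars s 7)"])
    fix i s2
    assume i: "i < n" and s2: "extremes (?T i) (vars s2 6) (vars s2 7)" "vars s2 2 = i" "vars s2 0 = n"
      and fr: "frame (For 2 ?step) s1 s2"
    have c2: "arrs s2 0 = matrix" "arrs s2 2 = degrees" "arrs s2 3 = (\<lambda>v. if v \<in> K then 1 else 0)"
      "arrs s2 4 = lv" "vars s2 5 = L"
      using frame_vars[OF fr] frame_arrs[OF fr] c1 by (simp_all add: config_def at_level_def)
    let ?u = "vars s2 6" and ?w = "vars s2 7"
    have uw: "?u \<le> n" "?w \<le> n" using s2(1) K_less by (auto simp: extremes_def intro: less_imp_le)
    have "fits W ?step s2"
      using i s2(2,3) c2 uw le(1)[OF i] le(2) by (simp add: bound_W at_level_def degrees_W)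
    then have r: "run W 50 ?step s2 (result ?step s2)" by (rule run_loop_freeI) (simp_all add: at_level_def)
    have "extremes (?T (Suc i)) (vars (result ?step s2) 6) (vars (result ?step s2) 7)"
    proof (cases "i \<in> K \<and> lv i = L")
      case True
      then have T: "?T (Suc i) = insert i (?T i)" using i by (auto simp: level_def less_Suc_eq)
      have du: "?u \<noteq> n \<Longrightarrow> degrees ?u = deg ?u" "?w \<noteq> n \<Longrightarrow> degrees ?w = deg ?w"
        using degrees_deg uw by simp_all
      have "vars (result ?step s2) 6 = (if ?u = n \<or> deg i < deg ?u then i else ?u)"
        "vars (result ?step s2) 7 = (if ?w = n \<or> \<not> deg i < deg ?w then i else ?w)"
        using True i s2(2,3) c2 du by (cases "?u = n"; cases "?w = n"; simp add: at_level_def degrees_deg)+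
      then show ?thesis unfolding T using extremes_insert[OF s2(1) _ i] i by (simp add: subset_iff)
    next
      case False
      then have T: "?T (Suc i) = ?T i" using i by (auto simp: level_def less_Suc_eq)
      have "vars (result ?step s2) 6 = ?u" "vars (result ?step s2) 7 = ?w"
        using False i s2(2,3) c2 by (auto simp: at_level_def)
      then show ?thesis unfolding T using s2(1) by simp
    qed
    then show "\<exists>s3. run W 50 ?step s2 s3 \<and> extremes (?T (Suc i))
        (vars (s3\<lparr>vars := (vars s3)(2 := Suc i)\<rparr>) 6) (vars (s3\<lparr>vars := (vars s3)(2 := Suc i)\<rparr>) 7)"
      using r by (intro exI[of _ "result ?step s2"]) simp
  qed (use c1 W n_pos in \<open>auto simp: config_def s1_def extremes_def\<close>)
  then obtain s' where s': "run W (6 + n * (50 + 8)) (For 2 ?step) s1 s'" "extremes (?T n) (vars s' 6) (vars s' 7)" by blast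
  have "run W (100 * (n + 1)) extremes_prog s s'"
    using run_Seq[OF s1(1) run_Seq[OF s1(2) s'(1)]] unfolding extremes_prog_def by (rule run_mono) simp
  moreover have "?T n = K \<inter> level lv L" by (auto simp: level_def)
  ultimately show ?thesis using s'(2) by auto
qed

definition selected :: "nat set \<Rightarrow> nat \<Rightarrow> nat \<Rightarrow> nat \<Rightarrow> bool" where
  "selected J u w z \<longleftrightarrow> J = {} \<and> z = n \<or>
     z \<in> J \<and> ((\<exists>x \<in> J. adj u x \<and> \<not> adj w x) \<longrightarrow> adj u z \<and> \<not> adj w z)"

lemma run_select_prog:
  assumes c: "config lv L s" and le: "\<And>v. v < n \<Longrightarrow> lv v \<le> L" "L \<le> n"
    and uw: "vars s 6 = u" "vars s 7 = w" "u \<le> n" "w \<le> n"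
  shows "\<exists>s'. run W (100 * (n + 1)) select_prog s s' \<and> selected (I \<inter> level lv L) u w (vars s' 8)"
proof -
  let ?J = "\<lambda>i. I \<inter> level lv L \<inter> {..<i}"
  let ?step = "Cond (And (And (at_level 2) (Eq (Arr 3 (Var 2)) (Const 0)))
         (Or (Eq (Var 8) (Var 0)) (And (Eq (entry (Var 6) (Var 2)) (Const 1)) (Eq (entry (Var 7) (Var 2)) (Const 0)))))
       (Assign 8 (Var 2)) Skip"
  define s1 where "s1 = s\<lparr>vars := (vars s)(8 := n)\<rparr>"
  have s1: "run W 2 (Assign 8 (Var 0)) s s1"
    using run_loop_free[of "Assign 8 (Var 0)" W s] c W
    by (simp add: s1_def config_def bound_W eval_nat_numeral)
  have c1: "config lv L s1" using c by (simp add: config_def s1_def)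
  have "\<exists>s'. run W (6 + n * (50 + 8)) (For 2 ?step) s1 s' \<and> selected (?J n) u w (vars s' 8) \<and> frame (For 2 ?step) s1 s'"
  proof (rule run_For[where P="\<lambda>i s. selected (?J i) u w (vars s 8)"])
    fix i s2
    assume i: "i < n" and s2: "selected (?J i) u w (vars s2 8)" "vars s2 2 = i" "vars s2 0 = n"
      and fr: "frame (For 2 ?step) s1 s2"
    have c2: "arrs s2 0 = matrix" "arrs s2 2 = degrees" "arrs s2 3 = (\<lambda>v. if v \<in> K then 1 else 0)"
      "arrs s2 4 = lv" "vars s2 5 = L" "vars s2 6 = u" "vars s2 7 = w"
      using frame_vars[OF fr] frame_arrs[OF fr] c1 uw by (simp_all add: config_def at_level_def s1_def)
    let ?z = "vars s2 8"
    have z: "?z \<le> n" using s2(1) by (auto simp: selected_def level_def)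
    have "fits W ?step s2"
      using i s2(2,3) c2 uw(3,4) z le(1)[OF i] le(2) by (simp add: word_simps at_level_def degrees_W entry_def)
    then have r: "run W 50 ?step s2 (result ?step s2)"
      by (rule run_loop_freeI) (simp_all add: at_level_def entry_def)
    have "selected (?J (Suc i)) u w (vars (result ?step s2) 8)"
    proof (cases "i \<in> I \<and> lv i = L")
      case True
      then have J: "?J (Suc i) = insert i (?J i)" using i by (auto simp: level_def less_Suc_eq)
      have "vars (result ?step s2) 8 = (if ?z = n \<or> adj u i \<and> \<not> adj w i then i else ?z)"
        using True i s2(2,3) c2 by (auto simp: at_level_def entry_def I_iff matrix_entry)
      moreover have "?z = n \<longleftrightarrow> ?J i = {}" using s2(1) by (auto simp: selected_def level_def)
      ultimately show ?thesis using s2(1) unfolding J selected_def by (auto split: if_splits)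
    next
      case False
      then have J: "?J (Suc i) = ?J i" using i by (auto simp: level_def less_Suc_eq)
      have "vars (result ?step s2) 8 = ?z"
        using False i s2(2,3) c2 by (auto simp: at_level_def I_iff)
      then show ?thesis unfolding J using s2(1) by simp
    qed
    then show "\<exists>s3. run W 50 ?step s2 s3 \<and> selected (?J (Suc i)) u w (vars (s3\<lparr>vars := (vars s3)(2 := Suc i)\<rparr>) 8)"
      using r by (intro exI[of _ "result ?step s2"]) simp
  qed (use c1 W n_pos in \<open>auto simp: config_def s1_def selected_def\<close>)
  then obtain s' where s': "run W (6 + n * (50 + 8)) (For 2 ?step) s1 s'" "selected (?J n) u w (vars s' 8)" by blast
  have "run W (100 * (n + 1)) select_prog s s'"
    using run_Seq[OF s1(1) s'(1)] unfolding select_prog_def by (rule run_mono) simp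
  moreover have "?J n = I \<inter> level lv L" by (auto simp: level_def)
  ultimately show ?thesis using s'(2) by auto
qed

lemma run_mark_prog:
  assumes c: "config lv L s" and le: "\<And>v. v < n \<Longrightarrow> lv v \<le> L" "L \<le> n" "0 < L"
    and z: "vars s 8 = z" "z \<in> I \<inter> level lv L"
  shows "\<exists>s'. run W (100 * (n + 1) * (n + 1)) mark_prog s s' \<and> config (lv(z := 0)) L s' \<and>
    (\<forall>x \<in> level lv L - {z}. arrs s' 5 x = (if x \<in> lower (level lv L) z then 1 else 0)) \<and>
    (vars s' 9 = (if lower (level lv L) z = {} then 0 else 1)) \<and>
    (vars s' 10 = (if upper (level lv L) z = {} then 0 else 1))"
proof -
  let ?S = "level lv L" and ?lv = "lv(z := 0)"
  let ?lo = "lower ?S z"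
  let ?inner = "Cond lower_test (Store 5 (Var 2) (Const 1)) Skip"
  let ?end = "Cond (Eq (Arr 5 (Var 2)) (Const 1)) (Assign 9 (Const 1)) (Assign 10 (Const 1))"
  let ?step = "Cond (at_level 2) (Seq (Store 5 (Var 2) (Const 0)) (Seq (For 3 ?inner) ?end)) Skip"
  have zS: "z \<in> I" "z < n" "lv z = L" "z \<in> ?S" using z(2) by (auto simp: level_def)
  have lo: "?lo \<subseteq> ?S - {z}" using lower_subset[OF zS(1)] .
  \<comment> \<open>The meaning of \<open>lower_test\<close> after \<open>z\<close> has left the
    level: \<open>u\<close> witnesses that \<open>x\<close> belongs to the lower part.\<close>
  define \<phi> where "\<phi> x u \<longleftrightarrow> u < n \<and> ?lv u = L \<and> u \<in> K \<and> adj u z \<and> (x = u \<or> adj u x \<and> x \<notin> K)" for x u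
  have phi: "x \<in> ?lo \<longleftrightarrow> (\<exists>u < n. \<phi> x u)" if "x \<in> ?S - {z}" for x
    using that zS K_Int_I I_iff[of x] \<open>0 < L\<close> unfolding lower_def \<phi>_def level_def by auto
  define s1 where "s1 = s\<lparr>arrs := (arrs s)(4 := ?lv), vars := (vars s)(9 := 0, 10 := 0)\<rparr>"
  have s1: "run W 3 (Store 4 (Var 8) (Const 0)) s (s\<lparr>arrs := (arrs s)(4 := ?lv)\<rparr>)"
    "run W 2 (Assign 9 (Const 0)) (s\<lparr>arrs := (arrs s)(4 := ?lv)\<rparr>) (s\<lparr>arrs := (arrs s)(4 := ?lv), vars := (vars s)(9 := 0)\<rparr>)"
    "run W 2 (Assign 10 (Const 0)) (s\<lparr>arrs := (arrs s)(4 := ?lv), vars := (vars s)(9 := 0)\<rparr>) s1"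
    using run_loop_free[of "Store 4 (Var 8) (Const 0)" W s]
      run_loop_free[of "Assign 9 (Const 0)" W "s\<lparr>arrs := (arrs s)(4 := ?lv)\<rparr>"]
      run_loop_free[of "Assign 10 (Const 0)" W "s\<lparr>arrs := (arrs s)(4 := ?lv), vars := (vars s)(9 := 0)\<rparr>"] c W z zS
    by (simp_all add: s1_def config_def bound_W eval_nat_numeral)
  have c1: "config ?lv L s1" "vars s1 8 = z" "vars s1 9 = 0" "vars s1 10 = 0"
    using c z by (simp_all add: config_def s1_def)
  let ?P = "\<lambda>i s. (\<forall>x \<in> ?S - {z}. x < i \<longrightarrow> arrs s 5 x = (if x \<in> ?lo then 1 else 0)) \<and>
    (vars s 9 = (if ?lo \<inter> {..<i} = {} then 0 else 1)) \<and> (vars s 10 = (if upper ?S z \<inter> {..<i} = {} then 0 else 1))"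
  let ?T1 = "6 + n * (50 + 8)"
  let ?T = "?T1 + 20"
  have "\<exists>s'. run W (6 + n * (?T + 8)) (For 2 ?step) s1 s' \<and> ?P n s' \<and> frame (For 2 ?step) s1 s'"
  proof (rule run_For[where P="?P"])
    fix i s2
    assume i: "i < n" and P: "?P i s2" and s2: "vars s2 2 = i" "vars s2 0 = n"
      and fr: "frame (For 2 ?step) s1 s2"
    have c2: "arrs s2 0 = matrix" "arrs s2 2 = degrees" "arrs s2 3 = (\<lambda>v. if v \<in> K then 1 else 0)"
      "arrs s2 4 = ?lv" "vars s2 5 = L" "vars s2 8 = z"
      using frame_vars[OF fr] frame_arrs[OF fr] c1 by (simp_all add: config_def)
    have lvW: "?lv x < W" "?lv x \<le> n" if "x < n" for x
      using le(1)[OF that] le(2) W by auto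
    have fb: "bfits W (at_level 2) s2" using c2 s2 i lvW le(2) by (simp add: at_level_def bound_W)
    show "\<exists>s3. run W ?T ?step s2 s3 \<and> ?P (Suc i) (s3\<lparr>vars := (vars s3)(2 := Suc i)\<rparr>)"
    proof (cases "?lv i = L")
      case False
      then have b: "\<not> bval (at_level 2) s2" using c2 s2 by (simp add: at_level_def)
      have "run W 1 Skip s2 s2" using run_loop_free[of Skip W s2] by simp
      then have "run W (1 + bcost (at_level 2) + 1) ?step s2 s2" using fb b by (intro run_Cond) simp_all
      then have r: "run W ?T ?step s2 s2" by (rule run_mono) (simp add: at_level_def)
      \<comment> \<open>\<open>i = z\<close> is included here, since \<open>z\<close> now has level
        0 and \<open>L\<close> is positive.\<close>
      have "i \<notin> ?S - {z}" using False by (cases "i = z") (simp_all add: level_def)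
      then have "?P (Suc i) s2" using P lo by (auto simp: less_Suc_eq lessThan_Suc)
      then show ?thesis using r by (intro exI[of _ s2]) simp
    next
      case True
      then have b: "bval (at_level 2) s2" using c2 s2 by (simp add: at_level_def)
      have iS: "i \<in> ?S - {z}" using True i \<open>0 < L\<close> by (auto simp: level_def split: if_splits)
      define s3 where "s3 = result (Store 5 (Var 2) (Const 0)) s2"
      have r3: "run W 3 (Store 5 (Var 2) (Const 0)) s2 s3"
        unfolding s3_def by (rule run_loop_freeI) (use s2 i in \<open>simp_all add: bound_W\<close>)
      have s3: "vars s3 = vars s2" "arrs s3 = (arrs s2)(5 := (arrs s2 5)(i := 0))"
        using s2 by (simp_all add: s3_def)
      have "\<exists>s4. run W ?T1 (For 3 ?inner) s3 s4 \<and>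
        arrs s4 5 = (arrs s2 5)(i := if \<exists>u<n. \<phi> i u then 1 else 0) \<and> frame (For 3 ?inner) s3 s4"
      proof (rule run_For[where P="\<lambda>j s. arrs s 5 = (arrs s2 5)(i := if \<exists>u<j. \<phi> i u then 1 else 0)"])
        fix j s4
        assume j: "j < n" and s4: "arrs s4 5 = (arrs s2 5)(i := if \<exists>u<j. \<phi> i u then 1 else 0)" "vars s4 3 = j" "vars s4 0 = n"
          and fr: "frame (For 3 ?inner) s3 s4"
        have c4: "arrs s4 0 = matrix" "arrs s4 2 = degrees" "arrs s4 3 = (\<lambda>v. if v \<in> K then 1 else 0)"
          "arrs s4 4 = ?lv" "vars s4 5 = L" "vars s4 8 = z" "vars s4 2 = i"
          using frame_vars[OF fr] frame_arrs[OF fr] c2 s2 by (simp_all add: s3)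
        have "bfits W lower_test s4"
          using i j s4(2,3) c4 zS(2) lvW[OF j] le(2)
          by (simp add: lower_test_def at_level_def entry_def word_simps del: fun_upd_apply)
        then have "fits W ?inner s4" using i c4 by (simp add: bound_W)
        then have "run W 50 ?inner s4 (result ?inner s4)"
          by (rule run_loop_freeI) (simp_all add: lower_test_def at_level_def entry_def)
        moreover have "bval lower_test s4 \<longleftrightarrow> \<phi> i j"
          using i j s4(2,3) c4 zS(2)
          by (simp add: lower_test_def at_level_def entry_def \<phi>_def matrix_entry del: fun_upd_apply)
        then have "arrs (result ?inner s4) 5 = (arrs s2 5)(i := if \<exists>u<Suc j. \<phi> i u then 1 else 0)"
          using s4 c4 by (auto simp: less_Suc_eq)
        ultimately show "\<exists>s5. run W 50 ?inner s4 s5 \<and>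
          arrs (s5\<lparr>vars := (vars s5)(3 := Suc j)\<rparr>) 5 = (arrs s2 5)(i := if \<exists>u<Suc j. \<phi> i u then 1 else 0)"
          by (intro exI[of _ "result ?inner s4"]) simp
      qed (use s2 s3 W n_pos in \<open>auto simp: lower_test_def\<close>)
      then obtain s4 where r4: "run W ?T1 (For 3 ?inner) s3 s4"
        and s4: "arrs s4 5 = (arrs s2 5)(i := if \<exists>u<n. \<phi> i u then 1 else 0)" and fr4: "frame (For 3 ?inner) s3 s4" by blast
      have v4: "vars s4 2 = i" "vars s4 9 = vars s2 9" "vars s4 10 = vars s2 10"
        using frame_vars[OF fr4] s2 by (simp_all add: s3)
      define s5 where "s5 = result ?end s4"
      have "fits W ?end s4" using v4 s4 i by (simp add: bound_W)
      then have r5: "run W 10 ?end s4 s5" unfolding s5_def by (rule run_loop_freeI) simp_all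
      have s5: "arrs s5 5 = (arrs s2 5)(i := if i \<in> ?lo then 1 else 0)"
        "vars s5 9 = (if i \<in> ?lo then 1 else vars s2 9)" "vars s5 10 = (if i \<in> ?lo then vars s2 10 else 1)"
        using v4 s4[folded phi[OF iS]] by (cases "i \<in> ?lo"; simp add: s5_def)+
      have "run W (?T1 + 13) (Seq (Store 5 (Var 2) (Const 0)) (Seq (For 3 ?inner) ?end)) s2 s5"
        using run_Seq[OF r3 run_Seq[OF r4 r5]] by (rule run_mono) simp
      then have "run W (1 + bcost (at_level 2) + (?T1 + 13)) ?step s2 s5" using fb b by (intro run_Cond) simp_all
      then have "run W ?T ?step s2 s5" by (rule run_mono) (simp add: at_level_def)
      moreover have "?P (Suc i) s5"
      proof (cases "i \<in> ?lo")
        case True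
        then have "?lo \<inter> {..<Suc i} \<noteq> {}" "upper ?S z \<inter> {..<Suc i} = upper ?S z \<inter> {..<i}"
          by (auto simp: less_Suc_eq)
        then show ?thesis using True P s5 by (auto simp: less_Suc_eq)
      next
        case False
        then have "upper ?S z \<inter> {..<Suc i} \<noteq> {}" "?lo \<inter> {..<Suc i} = ?lo \<inter> {..<i}"
          using iS by (auto simp: less_Suc_eq)
        then show ?thesis using False P s5 by (auto simp: less_Suc_eq)
      qed
      ultimately show ?thesis by (intro exI[of _ s5]) simp
    qed
  qed (use c1 W n_pos in \<open>auto simp: config_def lower_test_def at_level_def\<close>)
  then obtain s' where s': "run W (6 + n * (?T + 8)) (For 2 ?step) s1 s'" "?P n s'" "frame (For 2 ?step) s1 s'" by blast
  have "run W (100 * (n + 1) * (n + 1)) mark_prog s s'"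
    using run_Seq[OF s1(1) run_Seq[OF s1(2) run_Seq[OF s1(3) s'(1)]]] unfolding mark_prog_def
    by (rule run_mono) (simp add: algebra_simps)
  moreover have "config ?lv L s'"
    using frame_vars[OF s'(3)] frame_arrs[OF s'(3)] c1 by (simp add: config_def)
  moreover have "?lo \<inter> {..<n} = ?lo" "upper ?S z \<inter> {..<n} = upper ?S z" using lo by (auto simp: level_def)
  ultimately show ?thesis using s'(2) by (intro exI[of _ s']) (auto simp: level_def)
qed

lemma run_push_prog:
  assumes c: "config lv L s" and le: "\<And>v. v < n \<Longrightarrow> lv v \<le> L" "L \<le> n"
    and mark: "\<And>x. x \<in> level lv L \<Longrightarrow> arrs s 5 x = (if x \<in> M then 1 else 0)" and M: "M \<subseteq> level lv L"
  shows "\<exists>s'. run W (100 * (n + 1)) push_prog s s' \<and> config (\<lambda>v. if v \<in> M then Suc L else lv v) (Suc L) s'"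
proof -
  let ?step = "Cond (at_level 2) (Cond (Eq (Arr 5 (Var 2)) (Const 1)) (Store 4 (Var 2) (Add (Var 5) (Const 1))) Skip) Skip"
  let ?lv = "\<lambda>i v. if v \<in> M \<and> v < i then Suc L else lv v"
  have "\<exists>s1. run W (6 + n * (50 + 8)) (For 2 ?step) s s1 \<and> arrs s1 4 = ?lv n \<and> frame (For 2 ?step) s s1"
  proof (rule run_For[where P="\<lambda>i s. arrs s 4 = ?lv i"])
    fix i s2
    assume i: "i < n" and s2: "arrs s2 4 = ?lv i" "vars s2 2 = i" "vars s2 0 = n"
      and fr: "frame (For 2 ?step) s s2"
    have c2: "vars s2 5 = L" "arrs s2 5 = arrs s 5"
      using frame_vars[OF fr] frame_arrs[OF fr] c by (simp_all add: config_def at_level_def)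
    have lvW: "lv i < W" using le(1)[OF i] le(2) W by simp
    have b: "bval (at_level 2) s2 \<longleftrightarrow> i \<in> level lv L"
      using s2 c2 i by (simp add: at_level_def level_def)
    have fb: "bfits W (at_level 2) s2"
      using s2 c2 i le(2) lvW by (simp add: at_level_def bound_W)
    have a5: "arrs s2 5 i = (if i \<in> M then 1 else 0)" if "i \<in> level lv L" using mark[OF that] c2 by simp
    have "fits W ?step s2" using i s2 c2 le(2) fb b a5 by (auto simp: bound_W)
    then have r: "run W 50 ?step s2 (result ?step s2)" by (rule run_loop_freeI) (simp_all add: at_level_def)
    have "arrs (result ?step s2) 4 = ?lv (Suc i)"
      using s2 c2 b a5 M by (cases "i \<in> level lv L") (auto simp: less_Suc_eq fun_eq_iff)
    then show "\<exists>s3. run W 50 ?step s2 s3 \<and> arrs (s3\<lparr>vars := (vars s3)(2 := Suc i)\<rparr>) 4 = ?lv (Suc i)"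
      using r by (intro exI[of _ "result ?step s2"]) simp
  qed (use c W n_pos in \<open>auto simp: config_def at_level_def\<close>)
  then obtain s1 where s1: "run W (6 + n * (50 + 8)) (For 2 ?step) s s1" "arrs s1 4 = ?lv n" "frame (For 2 ?step) s s1" by blast
  let ?c = "Assign 5 (Add (Var 5) (Const 1))"
  have L: "vars s1 5 = L" using frame_vars[OF s1(3)] c by (simp add: config_def at_level_def)
  have "run W 4 ?c s1 (result ?c s1)" by (rule run_loop_freeI) (use L le(2) in \<open>simp_all add: bound_W\<close>)
  with s1(1) have "run W (6 + n * (50 + 8) + 4) push_prog s (result ?c s1)"
    unfolding push_prog_def by (rule run_Seq)
  then have "run W (100 * (n + 1)) push_prog s (result ?c s1)" by (rule run_mono) simp
  moreover have "?lv n = (\<lambda>v. if v \<in> M then Suc L else lv v)" using M by (auto simp: level_def fun_eq_iff)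
  then have "config (\<lambda>v. if v \<in> M then Suc L else lv v) (Suc L) (result ?c s1)"
    using s1(2) frame_vars[OF s1(3)] frame_arrs[OF s1(3)] c L by (simp add: config_def at_level_def)
  ultimately show ?thesis by blast
qed

end

section \<open>The main loop\<close>

text \<open>A unary operation contributes a fixed prefix to the code, so it can be emitted before
  its operand has been worked out.\<close>

definition shift_code :: "nat list" where
  "shift_code = [2, 1, 3, 2, 2, 4]"

lemma code_shift: "code (shift e) = shift_code @ code e"
  by (simp add: shift_def shift_code_def)

lemma code_attach: "code (attach z e) = [2, 5, 2, 2, 4, 2, 2, 3, 1, 3, 1, 5, 1, 0, 5, z] @ code e"
  by (simp add: attach_def)

lemma code_glue: "code (glue e f) = [3, 1, 3, 3, 2, 3, 1] @ code e @ shift_code @ code f"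
  by (simp add: glue_def code_shift)

text \<open>After a finished part, the next pending one is the upper operand of some
  \<open>glue\<close>, and there the operand is preceded by its shift.\<close>

definition pop_prog :: com where
  "pop_prog = Seq (Assign 5 (Sub (Var 5) (Const 1)))
     (Cond (Less (Const 0) (Var 5)) (emits (map Const shift_code)) Skip)"

definition branch_prog :: com where
  "branch_prog = Cond (Eq (Var 10) (Const 0)) Skip
     (Cond (Eq (Var 9) (Const 0)) (emits (map Const shift_code))
       (Seq (emits (map Const [3, 1, 3, 3, 2, 3, 1])) push_prog))"

definition split_prog :: com where
  "split_prog = Seq mark_prog (Cond (And (Eq (Var 9) (Const 0)) (Eq (Var 10) (Const 0)))
     (Seq (emits [Const 0, Const 2, Var 8]) pop_prog)
     (Seq (emits (map Const [2, 5, 2, 2, 4, 2, 2, 3, 1, 3, 1, 5, 1, 0, 5] @ [Var 8])) branch_prog))"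

text \<open>If no independent vertex is found, the level consists of a single clique vertex, which
  variable 6 then holds.\<close>

definition step_prog :: com where
  "step_prog = Seq extremes_prog (Seq select_prog (Cond (Eq (Var 8) (Var 0))
     (Seq (emits [Const 0, Const 1, Var 6]) (Seq (Store 4 (Var 6) (Const 0)) pop_prog))
     split_prog))"

definition main_prog :: com where
  "main_prog = Seq deg_prog (Seq core_prog (Seq init_prog (While (Less (Const 0) (Var 5)) step_prog)))"

lemma atom_simps [simp]: "atom W (Const c) s \<longleftrightarrow> c < W" "atom W (Var x) s \<longleftrightarrow> x \<noteq> 1 \<and> vars s x < W"
  by (auto simp: atom_def)

lemma outputs_frame:
  "outputs s xs \<Longrightarrow> frame c s s' \<Longrightarrow> \<not> writes_var c 1 \<Longrightarrow> \<not> writes_arr c 1 \<Longrightarrow> outputs s' xs"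
  by (simp add: outputs_def frame_def)

text \<open>Levels under the top of the stack are upper parts whose shift has not been emitted
  yet.\<close>

primrec below :: "(nat \<Rightarrow> nat cw_expr) \<Rightarrow> nat \<Rightarrow> nat list" where
  "below es 0 = []"
| "below es (Suc k) = shift_code @ code (es (Suc k)) @ below es k"

text \<open>Everything that precedes the top part in the code is already in the output, including
  its shift if it has one; hence no \<open>shift_code\<close> before \<open>es L\<close>.\<close>

definition pending :: "(nat \<Rightarrow> nat cw_expr) \<Rightarrow> nat \<Rightarrow> nat list" where
  "pending es L = (if L = 0 then [] else code (es L) @ below es (L - 1))"

lemma below_cong: "(\<And>i. i \<le> k \<Longrightarrow> es i = fs i) \<Longrightarrow> below es k = below fs k"
  by (induction k) auto

lemma below_pending: "below es k = (if k = 0 then [] else shift_code @ pending es k)"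
  by (cases k) (auto simp: pending_def)

section \<open>The loop invariant and its preservation\<close>

context input_split
begin

definition active :: "(nat \<Rightarrow> nat) \<Rightarrow> nat set" where
  "active lv = {v. v < n \<and> 0 < lv v}"

text \<open>The third line is a potential argument: a retired vertex pays for 30 symbols and for the
  growth of the stack by at most one. The quantification over all \<open>es\<close> expresses that
  the expressions of the pending parts are still open.\<close>

definition invar :: "(nat \<Rightarrow> nat) \<Rightarrow> nat \<Rightarrow> nat list \<Rightarrow> bool" where
  "invar lv L out \<longleftrightarrow> (\<forall>v < n. lv v \<le> L) \<and>
     (\<forall>i \<in> {1..L}. level lv i \<noteq> {} \<and> module (level lv i)) \<and>
     length out + 30 * card (active lv) \<le> 30 * n \<and> L + card (active lv) \<le> n + 1 \<and>
     (\<forall>es. (\<forall>i \<in> {1..L}. realizes (level lv i) (es i)) \<longrightarrow>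
       (\<exists>\<tau>. realizes (pverts G) \<tau> \<and> code \<tau> = out @ pending es L))"

lemma finite_active: "finite (active lv)"
  unfolding active_def by auto

lemma level_subset: "level lv i \<subseteq> pverts G"
  unfolding level_def verts by auto

lemma invarD:
  assumes "invar lv L out" "0 < L"
  shows "\<And>v. v < n \<Longrightarrow> lv v \<le> L" "level lv L \<noteq> {}" "module (level lv L)" "L \<le> n" "length out \<le> 30 * n"
proof -
  show "\<And>v. v < n \<Longrightarrow> lv v \<le> L" "level lv L \<noteq> {}" "module (level lv L)" "length out \<le> 30 * n"
    using assms unfolding invar_def by auto
  then obtain v where "v \<in> active lv" using \<open>0 < L\<close> unfolding level_def active_def by auto
  then have "0 < card (active lv)" using finite_active by (auto simp: card_gt_0_iff)
  then show "L \<le> n" using assms unfolding invar_def by linarith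
qed

lemma invar_init: "invar (\<lambda>v. if v < n then 1 else 0) 1 []"
proof -
  have "level (\<lambda>v. if v < n then 1 else 0) 1 = pverts G" unfolding level_def verts by auto
  moreover have "active (\<lambda>v. if v < n then 1 else 0) = {..<n}" unfolding active_def by auto
  moreover have "pverts G \<noteq> {}" using verts n_pos by auto
  ultimately show ?thesis
    unfolding invar_def using module_pverts by (auto simp: pending_def)
qed

text \<open>One round replaces the set of level \<open>L\<close> by the sets of the levels \<open>L\<close> to \<open>L'\<close>, whose
  expressions continue the emitted word \<open>new\<close> to an expression for the former.\<close>

lemma invar_step:
  assumes inv: "invar lv L out" and L: "0 < L" "L \<le> Suc L'" "L' \<le> Suc L"
    and same: "\<And>v. v < n \<Longrightarrow> lv v < L \<Longrightarrow> lv' v = lv v"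
    and moved: "\<And>v. v < n \<Longrightarrow> lv v = L \<Longrightarrow> lv' v = 0 \<or> L \<le> lv' v \<and> lv' v \<le> L'"
    and z: "z \<in> level lv L" "lv' z = 0"
    and new: "\<And>i. L \<le> i \<Longrightarrow> i \<le> L' \<Longrightarrow> level lv' i \<noteq> {} \<and> module (level lv' i)"
    and len: "length new \<le> 30"
    and real: "\<And>es. (\<And>i. L \<le> i \<Longrightarrow> i \<le> L' \<Longrightarrow> realizes (level lv' i) (es i)) \<Longrightarrow>
      \<exists>e. realizes (level lv L) e \<and> code e @ below es (L - 1) = new @ pending es L'"
  shows "invar lv' L' (out @ new)" and "card (active lv') < card (active lv)"
proof -
  have le: "lv v \<le> L" if "v < n" for v using invarD(1)[OF inv L(1) that] .
  have keep: "level lv' i = level lv i" if "1 \<le> i" "i < L" for i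
  proof -
    have "lv' v = i \<longleftrightarrow> lv v = i" if "v < n" for v
      using same[OF that] moved[OF that] le[OF that] \<open>1 \<le> i\<close> \<open>i < L\<close> by (cases "lv v = L") auto
    then show ?thesis unfolding level_def by auto
  qed
  have zn: "z < n" "lv z = L" using z unfolding level_def by auto
  have "active lv' \<subseteq> active lv - {z}"
  proof
    fix v assume "v \<in> active lv'"
    then have "v < n" "0 < lv' v" unfolding active_def by auto
    then show "v \<in> active lv - {z}"
      using same[of v] le[of v] L(1) z(2) unfolding active_def by (cases "lv v < L") auto
  qed
  moreover have "z \<in> active lv" using zn L(1) unfolding active_def by auto
  ultimately have "active lv' \<subset> active lv" by blast
  then show card: "card (active lv') < card (active lv)"
    using finite_active by (rule psubset_card_mono[rotated])
  have "\<exists>\<tau>. realizes (pverts G) \<tau> \<and> code \<tau> = (out @ new) @ pending es L'"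
    if es: "\<And>i. 1 \<le> i \<Longrightarrow> i \<le> L' \<Longrightarrow> realizes (level lv' i) (es i)" for es
  proof -
    obtain e where e: "realizes (level lv L) e" "code e @ below es (L - 1) = new @ pending es L'"
      using real[of es] es L(1) by auto
    \<comment> \<open>The old invariant is applied with the newly composed \<open>e\<close> in place
      of the old top entry; the lower entries are unaffected.\<close>
    have "\<forall>i \<in> {1..L}. realizes (level lv i) ((es(L := e)) i)"
    proof
      fix i assume i: "i \<in> {1..L}"
      show "realizes (level lv i) ((es(L := e)) i)"
      proof (cases "i = L")
        case True then show ?thesis using e by simp
      next
        case False
        then have "1 \<le> i" "i < L" using i by auto
        then show ?thesis using es[of i] keep[of i] L(2) by simp
      qed
    qed
    then obtain \<tau> where "realizes (pverts G) \<tau>" "code \<tau> = out @ pending (es(L := e)) L"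
      using inv unfolding invar_def by blast
    moreover have "below (es(L := e)) (L - 1) = below es (L - 1)" using L(1) by (intro below_cong) auto
    then have "pending (es(L := e)) L = code e @ below es (L - 1)" using L(1) by (simp add: pending_def)
    ultimately show ?thesis using e(2) by auto
  qed
  moreover have "lv' v \<le> L'" if "v < n" for v
    using same[OF that] moved[OF that] le[OF that] L by (cases "lv v < L") auto
  moreover have "level lv' i \<noteq> {} \<and> module (level lv' i)" if "i \<in> {1..L'}" for i
  proof (cases "i < L")
    case True then show ?thesis using keep[of i] that inv unfolding invar_def by auto
  next
    case False then show ?thesis using new[of i] that by auto
  qed
  moreover have "length (out @ new) + 30 * card (active lv') \<le> 30 * n" "L' + card (active lv') \<le> n + 1"
    using card inv len L unfolding invar_def by auto
  ultimately show "invar lv' L' (out @ new)" unfolding invar_def by auto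
qed

text \<open>Here \<open>L'\<close> is \<open>L - 1\<close>, so there are no new levels to check. The
  shift of the next part passes from \<open>below\<close> to the output.\<close>

lemma invar_leaf:
  assumes inv: "invar lv L out" "0 < L" and v: "level lv L = {v}"
  shows "invar (lv(v := 0)) (L - 1)
      (out @ code (Create (if v \<in> K then 1 else 2) v) @ (if L - 1 = 0 then [] else shift_code))"
    and "card (active (lv(v := 0))) < card (active lv)"
proof -
  have vn: "v < n" "lv v = L" using v unfolding level_def by auto
  have u: "u = v" if "u < n" "lv u = L" for u using v that unfolding level_def by auto
  have r: "realizes (level lv L) (Create (if v \<in> K then 1 else 2) v)"
    unfolding v by (rule realizes_Create) (use vn verts in auto)
  let ?new = "code (Create (if v \<in> K then 1 else 2) v) @ (if L - 1 = 0 then [] else shift_code)"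
  note st = invar_step[OF inv, of "L - 1" "lv(v := 0)" v ?new]
  have LL: "L \<le> Suc (L - 1)" "L - 1 \<le> Suc L" by simp_all
  have 1: "(lv(v := 0)) x = lv x" if "x < n" "lv x < L" for x using that vn by auto
  have 2: "(lv(v := 0)) x = 0 \<or> L \<le> (lv(v := 0)) x \<and> (lv(v := 0)) x \<le> L - 1"
    if "x < n" "lv x = L" for x using u[OF that] by simp
  have 3: "v \<in> level lv L" "(lv(v := 0)) v = 0" using v by simp_all
  have prem: "level (lv(v := 0)) i \<noteq> {} \<and> module (level (lv(v := 0)) i)" if "L \<le> i" "i \<le> L - 1" for i
    using that inv(2) by linarith
  have len: "length ?new \<le> 30" by (simp add: shift_code_def)
  have r': "\<exists>f. realizes (level lv L) f \<and> code f @ below es (L - 1) = ?new @ pending es (L - 1)" for es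
    using r by (intro exI[of _ "Create (if v \<in> K then 1 else 2) v"]) (simp add: below_pending pending_def)
  show "invar (lv(v := 0)) (L - 1) (out @ ?new)" and "card (active (lv(v := 0))) < card (active lv)"
    using st[OF LL 1 2 3 prem len r'] by blast+
qed

lemma invar_attach:
  assumes inv: "invar lv L out" "0 < L" and z: "separates (level lv L) z"
    and U: "upper (level lv L) z = {}" "lower (level lv L) z \<noteq> {}"
  shows "invar (lv(z := 0)) L (out @ [2, 5, 2, 2, 4, 2, 2, 3, 1, 3, 1, 5, 1, 0, 5, z])"
    and "card (active (lv(z := 0))) < card (active lv)"
proof -
  let ?S = "level lv L"
  note zS = separates_mem[OF z] lower_subset[OF separates_mem(1)[OF z], of ?S]
  have z': "z < n" "lv z = L" using zS(2) unfolding level_def by auto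
  have lev: "level (lv(z := 0)) L = lower ?S z"
  proof -
    have "level (lv(z := 0)) L = ?S - {z}" using inv(2) unfolding level_def by auto
    then show ?thesis using U zS(4) by auto
  qed
  have r: "\<exists>f. realizes ?S f \<and> code f @ below es (L - 1) =
      [2, 5, 2, 2, 4, 2, 2, 3, 1, 3, 1, 5, 1, 0, 5, z] @ pending es L"
    if "realizes (lower ?S z) (es L)" for es
    using realizes_attach[OF level_subset z U(1) that] inv(2)
    by (intro exI[of _ "attach z (es L)"]) (simp add: code_attach pending_def)
  let ?new = "[2, 5, 2, 2, 4, 2, 2, 3, 1, 3, 1, 5, 1, 0, 5, z]"
  note st = invar_step[OF inv, of L "lv(z := 0)" z ?new]
  have prem: "level (lv(z := 0)) i \<noteq> {} \<and> module (level (lv(z := 0)) i)" if "L \<le> i" "i \<le> L" for i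
    using that U(2) module_lower[OF invarD(3)[OF inv] z] lev by auto
  have LL: "L \<le> Suc L" "L \<le> Suc L" by simp_all
  have 1: "(lv(z := 0)) x = lv x" if "x < n" "lv x < L" for x using that z' by auto
  have 2: "(lv(z := 0)) x = 0 \<or> L \<le> (lv(z := 0)) x \<and> (lv(z := 0)) x \<le> L"
    if "x < n" "lv x = L" for x using that by simp
  have 3: "z \<in> ?S" "(lv(z := 0)) z = 0" using zS by simp_all
  have r': "\<exists>f. realizes ?S f \<and> code f @ below es (L - 1) = ?new @ pending es L"
    if "\<And>i. L \<le> i \<Longrightarrow> i \<le> L \<Longrightarrow> realizes (level (lv(z := 0)) i) (es i)" for es
    using r[of es] that[of L] lev by simp
  have len: "length ?new \<le> 30" by (simp add: shift_code_def)
  show "invar (lv(z := 0)) L (out @ ?new)" and "card (active (lv(z := 0))) < card (active lv)"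
    using st[OF LL 1 2 3 prem len r'] by blast+
qed

lemma invar_attach_shift:
  assumes inv: "invar lv L out" "0 < L" and z: "separates (level lv L) z"
    and U: "upper (level lv L) z \<noteq> {}" "lower (level lv L) z = {}"
  shows "invar (lv(z := 0)) L (out @ [2, 5, 2, 2, 4, 2, 2, 3, 1, 3, 1, 5, 1, 0, 5, z] @ shift_code)"
    and "card (active (lv(z := 0))) < card (active lv)"
proof -
  let ?S = "level lv L"
  note zS = separates_mem[OF z] lower_subset[OF separates_mem(1)[OF z], of ?S]
  have z': "z < n" "lv z = L" using zS(2) unfolding level_def by auto
  have lev: "level (lv(z := 0)) L = upper ?S z"
    using inv(2) U unfolding level_def by auto
  have r: "\<exists>f. realizes ?S f \<and> code f @ below es (L - 1) =
      ([2, 5, 2, 2, 4, 2, 2, 3, 1, 3, 1, 5, 1, 0, 5, z] @ shift_code) @ pending es L"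
    if "realizes (upper ?S z) (es L)" for es
    using realizes_attach_shift[OF level_subset z U(2) that] inv(2)
    by (intro exI[of _ "attach z (shift (es L))"]) (simp add: code_attach code_shift pending_def)
  let ?new = "[2, 5, 2, 2, 4, 2, 2, 3, 1, 3, 1, 5, 1, 0, 5, z] @ shift_code"
  note st = invar_step[OF inv, of L "lv(z := 0)" z ?new]
  have prem: "level (lv(z := 0)) i \<noteq> {} \<and> module (level (lv(z := 0)) i)" if "L \<le> i" "i \<le> L" for i
    using that U(1) module_upper[OF invarD(3)[OF inv] z] lev by auto
  have LL: "L \<le> Suc L" "L \<le> Suc L" by simp_all
  have 1: "(lv(z := 0)) x = lv x" if "x < n" "lv x < L" for x using that z' by auto
  have 2: "(lv(z := 0)) x = 0 \<or> L \<le> (lv(z := 0)) x \<and> (lv(z := 0)) x \<le> L"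
    if "x < n" "lv x = L" for x using that by simp
  have 3: "z \<in> ?S" "(lv(z := 0)) z = 0" using zS by simp_all
  have r': "\<exists>f. realizes ?S f \<and> code f @ below es (L - 1) = ?new @ pending es L"
    if "\<And>i. L \<le> i \<Longrightarrow> i \<le> L \<Longrightarrow> realizes (level (lv(z := 0)) i) (es i)" for es
    using r[of es] that[of L] lev by simp
  have len: "length ?new \<le> 30" by (simp add: shift_code_def)
  show "invar (lv(z := 0)) L (out @ ?new)" and "card (active (lv(z := 0))) < card (active lv)"
    using st[OF LL 1 2 3 prem len r'] by blast+
qed

lemma invar_attach_glue:
  assumes inv: "invar lv L out" "0 < L" and z: "separates (level lv L) z"
    and U: "upper (level lv L) z \<noteq> {}" "lower (level lv L) z \<noteq> {}"
  defines "lv' \<equiv> \<lambda>v. if v \<in> lower (level lv L) z then Suc L else (lv(z := 0)) v"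
  shows "invar lv' (Suc L) (out @ [2, 5, 2, 2, 4, 2, 2, 3, 1, 3, 1, 5, 1, 0, 5, z] @ [3, 1, 3, 3, 2, 3, 1])"
    and "card (active lv') < card (active lv)"
proof -
  let ?S = "level lv L"
  note zS = separates_mem[OF z] lower_subset[OF separates_mem(1)[OF z], of ?S]
  have z': "z < n" "lv z = L" "z \<notin> lower ?S z" using zS unfolding level_def by auto
  have lo: "v < n \<and> lv v = L" if "v \<in> lower ?S z" for v using that zS(4) unfolding level_def by auto
  have le: "lv v \<le> L" if "v < n" for v using invarD(1)[OF inv that] .
  have lev: "level lv' L = upper ?S z"
    using inv(2) unfolding level_def lv'_def by auto
  have "v \<in> level lv' (Suc L) \<longleftrightarrow> v \<in> lower ?S z" for v
  proof -
    have "v \<in> level lv' (Suc L) \<longleftrightarrow> v < n \<and> lv' v = Suc L" by (simp add: level_def)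
    moreover have "lv' v \<noteq> Suc L" if "v < n" "v \<notin> lower ?S z" using that le[of v] by (simp add: lv'_def)
    moreover have "lv' v = Suc L" if "v \<in> lower ?S z" using that by (simp add: lv'_def)
    ultimately show ?thesis using lo by blast
  qed
  then have lev2: "level lv' (Suc L) = lower ?S z" by blast
  let ?new = "[2, 5, 2, 2, 4, 2, 2, 3, 1, 3, 1, 5, 1, 0, 5, z] @ [3, 1, 3, 3, 2, 3, 1]"
  have r: "\<exists>f. realizes ?S f \<and> code f @ below es (L - 1) = ?new @ pending es (Suc L)"
    if "realizes (level lv' L) (es L)" "realizes (level lv' (Suc L)) (es (Suc L))" for es
  proof -
    \<comment> \<open>\<open>below es L\<close> then unfolds once and supplies the
      \<open>shift_code\<close> in front of the upper operand of \<open>glue\<close>.\<close>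
    obtain k where k: "L = Suc k" using inv(2) by (cases L) auto
    show ?thesis
      using realizes_attach_glue[OF level_subset z that(2)[unfolded lev2] that(1)[unfolded lev]]
      by (intro exI[of _ "attach z (glue (es (Suc L)) (es L))"]) (simp add: code_attach code_glue pending_def k)
  qed
  have prem: "level lv' i \<noteq> {} \<and> module (level lv' i)" if "L \<le> i" "i \<le> Suc L" for i
  proof -
    consider "i = L" | "i = Suc L" using \<open>L \<le> i\<close> \<open>i \<le> Suc L\<close> by linarith
    then show ?thesis
    proof cases
      case 1
      show ?thesis unfolding 1 lev using U(1) module_upper[OF invarD(3)[OF inv] z] by (rule conjI)
    next
      case 2
      show ?thesis unfolding 2 lev2 using U(2) module_lower[OF invarD(3)[OF inv] z] by (rule conjI)
    qed
  qed
  note st = invar_step[OF inv, of "Suc L" lv' z ?new]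
  have 1: "lv' v = lv v" if "v < n" "lv v < L" for v using that lo[of v] z' unfolding lv'_def by auto
  have 2: "lv' v = 0 \<or> L \<le> lv' v \<and> lv' v \<le> Suc L" if "v < n" "lv v = L" for v using that unfolding lv'_def by auto
  have 3: "lv' z = 0" using z' unfolding lv'_def by auto
  have len: "length ?new \<le> 30" by simp
  have LL: "L \<le> Suc (Suc L)" "Suc L \<le> Suc L" by simp_all
  have r': "\<exists>f. realizes ?S f \<and> code f @ below es (L - 1) = ?new @ pending es (Suc L)"
    if "\<And>i. L \<le> i \<Longrightarrow> i \<le> Suc L \<Longrightarrow> realizes (level lv' i) (es i)" for es
    by (rule r; rule that; simp)
  show "invar lv' (Suc L) (out @ ?new)" and "card (active lv') < card (active lv)"
    using st[OF LL 1 2 zS(2) 3 prem len r'] by blast+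
qed

section \<open>Execution of one round\<close>

lemma config_frame:
  assumes "config lv L s" "frame c s s'"
    "\<not> writes_var c 0" "\<not> writes_arr c 0" "\<not> writes_arr c 2" "\<not> writes_arr c 3" "\<not> writes_arr c 4" "\<not> writes_var c 5"
  shows "config lv L s'"
  using assms unfolding config_def by (simp add: frame_vars[OF assms(2)] frame_arrs[OF assms(2)])

lemma run_emits_config:
  assumes c: "config lv L s" and out: "outputs s out" "length out + length es \<le> 40 * n + 90"
    and es: "\<And>e. e \<in> set es \<Longrightarrow> atom W e s"
  shows "\<exists>s'. run W (1 + 7 * length es) (emits es) s s' \<and> config lv L s' \<and>
    outputs s' (out @ map (\<lambda>e. aval e s) es) \<and> frame (emits es) s s'"
proof -
  have "length out + length es < W" "1 < W" using out(2) W by simp_all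
  from run_emits[OF out(1) this es] obtain s' where s': "run W (1 + 7 * length es) (emits es) s s'"
    "outputs s' (out @ map (\<lambda>e. aval e s) es)" by blast
  have fr: "frame (emits es) s s'" using run_frame[OF s'(1)] .
  have "config lv L s'" by (rule config_frame[OF c fr]) simp_all
  then show ?thesis using s' fr by blast
qed

lemma run_pop_prog:
  assumes c: "config lv L s" and L: "0 < L" "L \<le> n" and out: "outputs s out" "length out \<le> 40 * n"
  shows "\<exists>s'. run W 60 pop_prog s s' \<and> config lv (L - 1) s' \<and>
    outputs s' (out @ (if L - 1 = 0 then [] else shift_code))"
proof -
  define s1 where "s1 = s\<lparr>vars := (vars s)(5 := L - 1)\<rparr>"
  let ?c = "Assign 5 (Sub (Var 5) (Const 1))"
  have r1: "run W 4 ?c s s1"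
    using run_loop_freeI[of W ?c s 4] c L by (simp add: s1_def config_def bound_W)
  have c1: "config lv (L - 1) s1" using c by (simp add: s1_def config_def)
  have o1: "outputs s1 out" using out(1) by (simp add: s1_def outputs_def)
  let ?t = "map Const shift_code"
  have es: "atom W e s1" if "e \<in> set ?t" for e using that W by (auto simp: shift_code_def)
  have av: "map (\<lambda>e. aval e s1) ?t = shift_code" by (simp add: shift_code_def)
  have "length out + length ?t \<le> 40 * n + 90" using out(2) by (simp add: shift_code_def)
  from run_emits_config[OF c1 o1 this es] obtain s2 where s2: "run W 43 (emits ?t) s1 s2"
    "config lv (L - 1) s2" "outputs s2 (out @ shift_code)"
    unfolding av by (auto simp: shift_code_def eval_nat_numeral)
  have b: "bfits W (Less (Const 0) (Var 5)) s1" using c1 L by (simp add: config_def bound_W)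
  show ?thesis
  proof (cases "L - 1 = 0")
    case True
    have "run W 1 Skip s1 s1" using run_loop_freeI[of W Skip s1 1] by simp
    then have "run W (1 + bcost (Less (Const 0) (Var 5)) + 1) (Cond (Less (Const 0) (Var 5)) (emits ?t) Skip) s1 s1"
      by (rule run_Cond_False) (use b c1 True in \<open>simp_all add: config_def\<close>)
    from run_Seq[OF r1 this] have "run W 60 pop_prog s s1" unfolding pop_prog_def by (rule run_mono) simp
    then show ?thesis using c1 o1 True by (intro exI[of _ s1]) simp
  next
    case False
    have "run W (1 + bcost (Less (Const 0) (Var 5)) + 43) (Cond (Less (Const 0) (Var 5)) (emits ?t) Skip) s1 s2"
      using s2(1) by (rule run_Cond_True) (use b c1 False in \<open>simp_all add: config_def\<close>)
    from run_Seq[OF r1 this] have "run W 60 pop_prog s s2" unfolding pop_prog_def by (rule run_mono) simp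
    then show ?thesis using s2 False by (intro exI[of _ s2]) simp
  qed
qed

definition next_config :: "(nat \<Rightarrow> nat) \<Rightarrow> state \<Rightarrow> bool" where
  "next_config lv s' \<longleftrightarrow> (\<exists>lv' L' out'. config lv' L' s' \<and> outputs s' out' \<and> invar lv' L' out' \<and>
     card (active lv') < card (active lv))"

lemma run_branch_prog:
  assumes c: "config (lv(z := 0)) L s" and out: "outputs s (out @ [2, 5, 2, 2, 4, 2, 2, 3, 1, 3, 1, 5, 1, 0, 5, z])"
    and inv: "invar lv L out" "0 < L" and z: "separates (level lv L) z"
    and mark: "\<And>x. x \<in> level lv L - {z} \<Longrightarrow> arrs s 5 x = (if x \<in> lower (level lv L) z then 1 else 0)"
    and flags: "vars s 9 = (if lower (level lv L) z = {} then 0 else 1)"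
      "vars s 10 = (if upper (level lv L) z = {} then 0 else 1)" "\<not> (vars s 9 = 0 \<and> vars s 10 = 0)"
  shows "\<exists>s'. run W (200 * (n + 1)) branch_prog s s' \<and> next_config lv s'"
proof -
  let ?S = "level lv L"
  note D = invarD[OF inv]
  have Lz: "z \<in> ?S" using separates_mem[OF z] by simp
  have b1: "bfits W (Eq (Var 10) (Const 0)) s" using flags W by simp
  have b2: "bfits W (Eq (Var 9) (Const 0)) s" using flags W by simp
  have len: "length (out @ [2, 5, 2, 2, 4, 2, 2, 3, 1, 3, 1, 5, 1, 0, 5, z]) \<le> 30 * n + 16" using D(5) by simp
  show ?thesis
  proof (cases "upper ?S z = {}")
    case True
    then have lo: "lower ?S z \<noteq> {}" using flags by auto
    have "run W 1 Skip s s" using run_loop_freeI[of W Skip s 1] by simp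
    then have "run W (1 + bcost (Eq (Var 10) (Const 0)) + 1) branch_prog s s"
      unfolding branch_prog_def by (rule run_Cond_True) (use b1 flags True in simp_all)
    then have "run W (200 * (n + 1)) branch_prog s s" by (rule run_mono) simp
    then show ?thesis using c out invar_attach[OF inv z True lo] unfolding next_config_def by blast
  next
    case up: False
    show ?thesis
    proof (cases "lower ?S z = {}")
      case True
      let ?t = "map Const shift_code"
      have es: "atom W e s" if "e \<in> set ?t" for e using that W by (auto simp: shift_code_def)
      have av: "map (\<lambda>e. aval e s) ?t = shift_code" by (simp add: shift_code_def)
      have "length (out @ [2, 5, 2, 2, 4, 2, 2, 3, 1, 3, 1, 5, 1, 0, 5, z]) + length ?t \<le> 40 * n + 90"
        using len by (simp add: shift_code_def)
      from run_emits_config[OF c out this es] obtain s2 where s2: "run W 43 (emits ?t) s s2"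
        "config (lv(z := 0)) L s2" "outputs s2 (out @ [2, 5, 2, 2, 4, 2, 2, 3, 1, 3, 1, 5, 1, 0, 5, z] @ shift_code)"
        unfolding av by (auto simp: shift_code_def eval_nat_numeral)
      have "run W (1 + bcost (Eq (Var 9) (Const 0)) + 43) (Cond (Eq (Var 9) (Const 0)) (emits ?t)
          (Seq (emits (map Const [3, 1, 3, 3, 2, 3, 1])) push_prog)) s s2"
        using s2(1) by (rule run_Cond_True) (use b2 flags True in simp_all)
      then have "run W (1 + bcost (Eq (Var 10) (Const 0)) + (1 + bcost (Eq (Var 9) (Const 0)) + 43)) branch_prog s s2"
        unfolding branch_prog_def by (rule run_Cond_False) (use b1 flags up in simp_all)
      then have "run W (200 * (n + 1)) branch_prog s s2" by (rule run_mono) simp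
      then show ?thesis using s2 invar_attach_shift[OF inv z up True] unfolding next_config_def by blast
    next
      case lo: False
      let ?t = "map Const [3, 1, 3, 3, 2, 3, 1]"
      have es: "atom W e s" if "e \<in> set ?t" for e using that W by auto
      have av: "map (\<lambda>e. aval e s) ?t = [3, 1, 3, 3, 2, 3, 1]" by simp
      have lt: "length ?t = 7" by simp
      have "length (out @ [2, 5, 2, 2, 4, 2, 2, 3, 1, 3, 1, 5, 1, 0, 5, z]) + length ?t \<le> 40 * n + 90"
        using len by simp
      from run_emits_config[OF c out this es] obtain s2 where s2: "run W (1 + 7 * 7) (emits ?t) s s2"
        "config (lv(z := 0)) L s2"
        "outputs s2 ((out @ [2, 5, 2, 2, 4, 2, 2, 3, 1, 3, 1, 5, 1, 0, 5, z]) @ [3, 1, 3, 3, 2, 3, 1])"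
        "frame (emits ?t) s s2"
        unfolding av lt by blast
      have lev: "level (lv(z := 0)) L = ?S - {z}" using inv(2) unfolding level_def by auto
      have "arrs s2 5 = arrs s 5" using frame_arrs[OF s2(4), of 5] by simp
      then have mark2: "arrs s2 5 x = (if x \<in> lower ?S z then 1 else 0)" if "x \<in> level (lv(z := 0)) L" for x
        using mark that unfolding lev by simp
      have le2: "(lv(z := 0)) v \<le> L" if "v < n" for v using D(1)[OF that] by simp
      have sub: "lower ?S z \<subseteq> level (lv(z := 0)) L"
        unfolding lev using lower_subset[OF separates_mem(1)[OF z]] .
      from run_push_prog[OF s2(2) le2 D(4) mark2 sub] obtain s3 where s3: "run W (100 * (n + 1)) push_prog s2 s3"
        "config (\<lambda>v. if v \<in> lower ?S z then Suc L else (lv(z := 0)) v) (Suc L) s3" by blast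
      have o3: "outputs s3 (out @ [2, 5, 2, 2, 4, 2, 2, 3, 1, 3, 1, 5, 1, 0, 5, z] @ [3, 1, 3, 3, 2, 3, 1])"
        using outputs_frame[OF s2(3) run_frame[OF s3(1)]] by (simp add: push_prog_def)
      have "run W (1 + bcost (Eq (Var 9) (Const 0)) + (1 + 7 * 7 + 100 * (n + 1))) (Cond (Eq (Var 9) (Const 0))
          (emits (map Const shift_code)) (Seq (emits ?t) push_prog)) s s3"
        using run_Seq[OF s2(1) s3(1)] by (rule run_Cond_False) (use b2 flags lo in simp_all)
      then have "run W (1 + bcost (Eq (Var 10) (Const 0)) + (1 + bcost (Eq (Var 9) (Const 0)) + (1 + 7 * 7 + 100 * (n + 1)))) branch_prog s s3"
        unfolding branch_prog_def by (rule run_Cond_False) (use b1 flags up in simp_all)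
      then have "run W (200 * (n + 1)) branch_prog s s3" by (rule run_mono) simp
      then show ?thesis using s3 o3 invar_attach_glue[OF inv z up lo] unfolding next_config_def by blast
    qed
  qed
qed

lemma run_leaf:
  assumes c: "config lv L s" and out: "outputs s out" and inv: "invar lv L out" "0 < L" and v: "level lv L = {v}"
    and x: "x \<noteq> 1" "vars s x = v"
  shows "\<exists>s'. run W 30 (emits [Const 0, Const (if v \<in> K then 1 else 2), Var x]) s s' \<and> config lv L s' \<and>
    outputs s' (out @ code (Create (if v \<in> K then 1 else 2) v)) \<and> frame (emits [Const 0, Const (if v \<in> K then 1 else 2), Var x]) s s'"
proof -
  let ?t = "[Const 0, Const (if v \<in> K then 1 else 2), Var x]"
  have "v < n" using v unfolding level_def by auto
  then have es: "atom W e s" if "e \<in> set ?t" for e using that x W by (auto simp: bound_W)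
  have "length out + length ?t \<le> 40 * n + 90" using invarD(5)[OF inv] by simp
  from run_emits_config[OF c out this es] obtain s' where s': "run W (1 + 7 * length ?t) (emits ?t) s s'"
    "config lv L s'" "outputs s' (out @ map (\<lambda>e. aval e s) ?t)" "frame (emits ?t) s s'" by blast
  have "run W 30 (emits ?t) s s'" using s'(1) by (rule run_mono) simp
  moreover have "map (\<lambda>e. aval e s) ?t = code (Create (if v \<in> K then 1 else 2) v)" using x by simp
  ultimately show ?thesis using s' by metis
qed

lemma run_split_prog:
  assumes c: "config lv L s" and out: "outputs s out" and inv: "invar lv L out" "0 < L"
    and z: "separates (level lv L) z" "vars s 8 = z"
  shows "\<exists>s'. run W (600 * (n + 1) * (n + 1)) split_prog s s' \<and> next_config lv s'"
proof -
  let ?S = "level lv L"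
  note D = invarD[OF inv]
  note zS = separates_mem[OF z(1)] lower_subset[OF separates_mem(1)[OF z(1)], of ?S]
  have zn: "z < n" using zS unfolding level_def by auto
  have zI: "z \<in> I \<inter> ?S" using zS by simp
  from run_mark_prog[OF c D(1,4) inv(2) z(2) zI] obtain s1 where s1: "run W (100 * (n + 1) * (n + 1)) mark_prog s s1"
    "config (lv(z := 0)) L s1" "\<And>x. x \<in> ?S - {z} \<Longrightarrow> arrs s1 5 x = (if x \<in> lower ?S z then 1 else 0)"
    "vars s1 9 = (if lower ?S z = {} then 0 else 1)" "vars s1 10 = (if upper ?S z = {} then 0 else 1)" by blast
  have fr: "frame mark_prog s s1" using run_frame[OF s1(1)] .
  have o1: "outputs s1 out" by (rule outputs_frame[OF out fr]) (simp_all add: mark_prog_def)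
  have z1: "vars s1 8 = z" using frame_vars[OF fr, of 8] z(2) by (simp add: mark_prog_def)
  let ?b = "And (Eq (Var 9) (Const 0)) (Eq (Var 10) (Const 0))"
  have b: "bfits W ?b s1" using s1(4,5) W by simp
  have "\<exists>s'. run W (1 + bcost ?b + 400 * (n + 1)) (Cond ?b (Seq (emits [Const 0, Const 2, Var 8]) pop_prog)
     (Seq (emits (map Const [2, 5, 2, 2, 4, 2, 2, 3, 1, 3, 1, 5, 1, 0, 5] @ [Var 8])) branch_prog)) s1 s' \<and> next_config lv s'"
  proof (cases "bval ?b s1")
    case True
    then have "lower ?S z = {}" "upper ?S z = {}" using s1(4,5) by (auto split: if_splits)
    then have S: "?S = {z}" using zS by blast
    let ?t = "[Const 0, Const 2, Var 8]"
    have es: "atom W e s1" if "e \<in> set ?t" for e using that z1 zn W by (auto simp: bound_W)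
    have "length out + length ?t \<le> 40 * n + 90" using D(5) by simp
    from run_emits_config[OF s1(2) o1 this es] obtain s2 where s2: "run W (1 + 7 * length ?t) (emits ?t) s1 s2"
      "config (lv(z := 0)) L s2" "outputs s2 (out @ map (\<lambda>e. aval e s1) ?t)" by blast
    have t: "map (\<lambda>e. aval e s1) ?t = code (Create (if z \<in> K then 1 else 2) z)" using z1 zS by simp
    have "length (out @ code (Create (if z \<in> K then 1 else 2) z)) \<le> 40 * n" using D(5) n_pos by simp
    from run_pop_prog[OF s2(2) inv(2) D(4) s2(3)[unfolded t] this] obtain s3 where s3: "run W 60 pop_prog s2 s3"
      "config (lv(z := 0)) (L - 1) s3"
      "outputs s3 ((out @ code (Create (if z \<in> K then 1 else 2) z)) @ (if L - 1 = 0 then [] else shift_code))" by blast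
    have "run W (400 * (n + 1)) (Seq (emits ?t) pop_prog) s1 s3"
      using run_Seq[OF s2(1) s3(1)] by (rule run_mono) simp
    then have "run W (1 + bcost ?b + 400 * (n + 1)) (Cond ?b (Seq (emits ?t) pop_prog)
       (Seq (emits (map Const [2, 5, 2, 2, 4, 2, 2, 3, 1, 3, 1, 5, 1, 0, 5] @ [Var 8])) branch_prog)) s1 s3"
      by (rule run_Cond_True) (use b True in simp_all)
    moreover have "next_config lv s3"
      unfolding next_config_def using s3(2) s3(3)[unfolded append_assoc] invar_leaf[OF inv S] by blast
    ultimately show ?thesis by blast
  next
    case False
    let ?t = "map Const [2, 5, 2, 2, 4, 2, 2, 3, 1, 3, 1, 5, 1, 0, 5] @ [Var 8]"
    have es: "atom W e s1" if "e \<in> set ?t" for e using that z1 zn W by (auto simp: bound_W)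
    have "length out + length ?t \<le> 40 * n + 90" using D(5) by simp
    from run_emits_config[OF s1(2) o1 this es] obtain s2 where s2: "run W (1 + 7 * length ?t) (emits ?t) s1 s2"
      "config (lv(z := 0)) L s2" "outputs s2 (out @ map (\<lambda>e. aval e s1) ?t)" "frame (emits ?t) s1 s2" by blast
    have t: "map (\<lambda>e. aval e s1) ?t = [2, 5, 2, 2, 4, 2, 2, 3, 1, 3, 1, 5, 1, 0, 5, z]" using z1 by simp
    have same: "arrs s2 5 = arrs s1 5" "vars s2 9 = vars s1 9" "vars s2 10 = vars s1 10"
      using frame_arrs[OF s2(4), of 5] frame_vars[OF s2(4), of 9] frame_vars[OF s2(4), of 10] by simp_all
    have "\<exists>s'. run W (200 * (n + 1)) branch_prog s2 s' \<and> next_config lv s'"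
      by (rule run_branch_prog[OF s2(2) s2(3)[unfolded t] inv z(1)]) (use s1 same False in auto)
    then obtain s3 where s3: "run W (200 * (n + 1)) branch_prog s2 s3" "next_config lv s3" by blast
    have "run W (400 * (n + 1)) (Seq (emits ?t) branch_prog) s1 s3"
      using run_Seq[OF s2(1) s3(1)] by (rule run_mono) simp
    then have "run W (1 + bcost ?b + 400 * (n + 1)) (Cond ?b (Seq (emits [Const 0, Const 2, Var 8]) pop_prog)
       (Seq (emits ?t) branch_prog)) s1 s3"
      by (rule run_Cond_False) (use b False in simp_all)
    then show ?thesis using s3(2) by blast
  qed
  then obtain s' where s': "run W (1 + bcost ?b + 400 * (n + 1)) (Cond ?b (Seq (emits [Const 0, Const 2, Var 8]) pop_prog)
     (Seq (emits (map Const [2, 5, 2, 2, 4, 2, 2, 3, 1, 3, 1, 5, 1, 0, 5] @ [Var 8])) branch_prog)) s1 s'" "next_config lv s'" by blast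
  have "run W (600 * (n + 1) * (n + 1)) split_prog s s'"
    using run_Seq[OF s1(1) s'(1)] unfolding split_prog_def by (rule run_mono) (simp add: algebra_simps)
  then show ?thesis using s'(2) by blast
qed

lemma run_step_prog:
  assumes c: "config lv L s" and out: "outputs s out" and inv: "invar lv L out" "0 < L"
  shows "\<exists>s'. run W (1000 * (n + 1) * (n + 1)) step_prog s s' \<and> next_config lv s'"
proof -
  let ?S = "level lv L"
  note D = invarD[OF inv]
  from run_extremes_prog[OF c D(1,4)] obtain s1 where s1: "run W (100 * (n + 1)) extremes_prog s s1"
    "extremes (K \<inter> ?S) (vars s1 6) (vars s1 7)" by blast
  define u w where "u = vars s1 6" and "w = vars s1 7"
  have uw: "u \<le> n" "w \<le> n" using s1(2) K_less by (auto simp: extremes_def u_def w_def intro: less_imp_le)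
  have fr1: "frame extremes_prog s s1" using run_frame[OF s1(1)] .
  have c1: "config lv L s1" by (rule config_frame[OF c fr1]) (simp_all add: extremes_prog_def)
  have o1: "outputs s1 out" by (rule outputs_frame[OF out fr1]) (simp_all add: extremes_prog_def)
  from run_select_prog[OF c1 D(1,4) u_def[symmetric] w_def[symmetric] uw] obtain s2
    where s2: "run W (100 * (n + 1)) select_prog s1 s2" "selected (I \<inter> ?S) u w (vars s2 8)" by blast
  have fr2: "frame select_prog s1 s2" using run_frame[OF s2(1)] .
  have c2: "config lv L s2" by (rule config_frame[OF c1 fr2]) (simp_all add: select_prog_def)
  have o2: "outputs s2 out" by (rule outputs_frame[OF o1 fr2]) (simp_all add: select_prog_def)
  have u2: "vars s2 6 = u" using frame_vars[OF fr2, of 6] by (simp add: u_def select_prog_def)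
  define z where "z = vars s2 8"
  have n2: "vars s2 0 = n" using c2 by (simp add: config_def)
  have zn: "z \<le> n" using s2(2) by (auto simp: selected_def level_def z_def)
  let ?b = "Eq (Var 8) (Var 0)"
  let ?leaf = "Seq (emits [Const 0, Const 1, Var 6]) (Seq (Store 4 (Var 6) (Const 0)) pop_prog)"
  have b: "bfits W ?b s2" using n2 zn by (simp add: z_def[symmetric] bound_W)
  have "\<exists>s'. run W (1 + bcost ?b + 700 * (n + 1) * (n + 1)) (Cond ?b ?leaf split_prog) s2 s' \<and> next_config lv s'"
  proof (cases "z = n")
    case True
    then have "I \<inter> ?S = {}" using s2(2) by (auto simp: selected_def level_def z_def)
    from singleton_or_I_nonempty[OF D(3,2) this] obtain v where v: "v \<in> K" "?S = {v}" by (elim bexE)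
    \<comment> \<open>The extremes of a one-element set are its element, so variable 6 holds the
      vertex to be created.\<close>
    have KS: "K \<inter> ?S = {v}" unfolding v(2) using v(1) by blast
    have "extremes {v} u w" using s1(2) unfolding KS u_def w_def .
    then have "u = v" unfolding extremes_def by blast
    have x: "(6::nat) \<noteq> 1" "vars s2 6 = v" using u2 \<open>u = v\<close> by simp_all
    have vn: "v < n" "lv v = L" using v unfolding level_def by auto
    have vK: "(if v \<in> K then 1 else 2) = (1 :: nat)" using v(1) by simp
    from run_leaf[OF c2 o2 inv v(2) x] obtain s3 where s3: "run W 30 (emits [Const 0, Const 1, Var 6]) s2 s3"
      "config lv L s3" "outputs s3 (out @ code (Create (if v \<in> K then 1 else 2) v))" "frame (emits [Const 0, Const 1, Var 6]) s2 s3"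
      unfolding vK by (elim exE conjE)
    have u3: "vars s3 6 = v" using frame_vars[OF s3(4), of 6] x by simp
    define s4 where "s4 = s3\<lparr>arrs := (arrs s3)(4 := lv(v := 0))\<rparr>"
    have r4: "run W 3 (Store 4 (Var 6) (Const 0)) s3 s4"
      using run_loop_freeI[of W "Store 4 (Var 6) (Const 0)" s3 3] u3 vn s3(2)
      by (simp add: s4_def config_def bound_W)
    have c4: "config (lv(v := 0)) L s4" using s3(2) by (simp add: s4_def config_def)
    have o4: "outputs s4 (out @ code (Create (if v \<in> K then 1 else 2) v))"
      using s3(3) by (simp add: s4_def outputs_def)
    have "length (out @ code (Create (if v \<in> K then 1 else 2) v)) \<le> 40 * n" using D(5) n_pos by simp
    from run_pop_prog[OF c4 inv(2) D(4) o4 this] obtain s5 where s5: "run W 60 pop_prog s4 s5"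
      "config (lv(v := 0)) (L - 1) s5"
      "outputs s5 ((out @ code (Create (if v \<in> K then 1 else 2) v)) @ (if L - 1 = 0 then [] else shift_code))" by blast
    have "run W (700 * (n + 1) * (n + 1)) ?leaf s2 s5"
      using run_Seq[OF s3(1) run_Seq[OF r4 s5(1)]] by (rule run_mono) (simp add: algebra_simps)
    then have "run W (1 + bcost ?b + 700 * (n + 1) * (n + 1)) (Cond ?b ?leaf split_prog) s2 s5"
      by (rule run_Cond_True) (use b True n2 in \<open>simp_all add: z_def\<close>)
    moreover have "next_config lv s5"
      unfolding next_config_def using s5(2) s5(3)[unfolded append_assoc] invar_leaf[OF inv v(2)] by blast
    ultimately show ?thesis by blast
  next
    case False
    then have z: "z \<in> I \<inter> ?S" "(\<exists>x \<in> I \<inter> ?S. adj u x \<and> \<not> adj w x) \<Longrightarrow> adj u z \<and> \<not> adj w z"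
      using s2(2) by (auto simp: selected_def z_def)
    have ext: "u \<in> K \<inter> ?S \<and> w \<in> K \<inter> ?S \<and> deg u \<le> deg e \<and> deg e \<le> deg w" if "e \<in> K \<inter> ?S" for e
      using s1(2) that unfolding extremes_def u_def w_def by blast
    have single: "u = w \<Longrightarrow> K \<inter> ?S \<subseteq> {u}"
      using s1(2) unfolding extremes_def u_def w_def by blast
    have "separates ?S z" using separatesI[OF D(3) z(1) ext single z(2)] .
    from run_split_prog[OF c2 o2 inv this z_def[symmetric]] obtain s3
      where s3: "run W (600 * (n + 1) * (n + 1)) split_prog s2 s3" "next_config lv s3" by blast
    have "run W (700 * (n + 1) * (n + 1)) split_prog s2 s3"
      using s3(1) by (rule run_mono) (simp add: algebra_simps)
    then have "run W (1 + bcost ?b + 700 * (n + 1) * (n + 1)) (Cond ?b ?leaf split_prog) s2 s3"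
      by (rule run_Cond_False) (use b False n2 in \<open>simp_all add: z_def\<close>)
    then show ?thesis using s3(2) by blast
  qed
  then obtain s' where s': "run W (1 + bcost ?b + 700 * (n + 1) * (n + 1)) (Cond ?b ?leaf split_prog) s2 s'"
    "next_config lv s'" by blast
  have "run W (1000 * (n + 1) * (n + 1)) step_prog s s'"
    using run_Seq[OF s1(1) run_Seq[OF s2(1) s'(1)]] unfolding step_prog_def
    by (rule run_mono) (simp add: algebra_simps)
  then show ?thesis using s'(2) by blast
qed

text \<open>Every round retires an active vertex, so there are at most \<open>n\<close> rounds of
  quadratic cost.\<close>

lemma run_main_loop:
  assumes c: "config lv L s" and out: "outputs s out" and inv: "invar lv L out"
  shows "\<exists>s' \<tau>. run W (4 + n * (4 + 1000 * (n + 1) * (n + 1))) (While (Less (Const 0) (Var 5)) step_prog) s s' \<and>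
    outputs s' (code \<tau>) \<and> realizes (pverts G) \<tau> \<and> expr_size \<tau> \<le> 30 * n"
proof -
  let ?b = "Less (Const 0) (Var 5)"
  let ?P = "\<lambda>s. \<exists>lv L out. config lv L s \<and> outputs s out \<and> invar lv L out"
  let ?m = "\<lambda>s. card (active (arrs s 4))"
  have "\<exists>s'. run W (1 + bcost ?b + ?m s * (1 + bcost ?b + 1000 * (n + 1) * (n + 1))) (While ?b step_prog) s s' \<and>
    ?P s' \<and> \<not> bval ?b s'"
  proof (rule run_While)
    show "?P s" using assms by blast
    show "bfits W ?b s" if "?P s" for s
    proof -
      from that obtain lv L out where "config lv L s" "invar lv L out" by blast
      then have "vars s 5 \<le> n + 1" unfolding config_def invar_def by simp
      then show ?thesis by (simp add: bound_W)
    qed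
    show "\<exists>s'. run W (1000 * (n + 1) * (n + 1)) step_prog s s' \<and> ?P s' \<and> ?m s' < ?m s" if "?P s" "bval ?b s" for s
    proof -
      from that obtain lv L out where c: "config lv L s" "outputs s out" "invar lv L out" "0 < L"
        by (auto simp: config_def)
      from run_step_prog[OF c] obtain s' lv' L' out' where s': "run W (1000 * (n + 1) * (n + 1)) step_prog s s'"
        "config lv' L' s'" "outputs s' out'" "invar lv' L' out'" "card (active lv') < card (active lv)"
        unfolding next_config_def by blast
      moreover have "arrs s 4 = lv" "arrs s' 4 = lv'" using c(1) s'(2) by (simp_all add: config_def)
      ultimately show ?thesis by auto
    qed
  qed
  then obtain s' lv' L' out' where s': "run W (1 + bcost ?b + ?m s * (1 + bcost ?b + 1000 * (n + 1) * (n + 1))) (While ?b step_prog) s s'"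
    "config lv' L' s'" "outputs s' out'" "invar lv' L' out'" "\<not> bval ?b s'" by blast
  then have "L' = 0" by (simp add: config_def)
  \<comment> \<open>With an empty stack the condition on \<open>es\<close> is vacuous and
    \<open>pending es 0\<close> is empty, so the output itself is the code.\<close>
  then obtain \<tau> where \<tau>: "realizes (pverts G) \<tau>" "code \<tau> = out'" "length out' \<le> 30 * n"
    using s'(4) unfolding invar_def by (auto simp: pending_def)
  have "?m s \<le> n"
    using card_mono[of "{..<n}" "active (arrs s 4)"] by (auto simp: active_def)
  then have le: "4 + ?m s * (4 + 1000 * (n + 1) * (n + 1)) \<le> 4 + n * (4 + 1000 * (n + 1) * (n + 1))"
    by (rule add_left_mono[OF mult_le_mono1])
  have bc: "1 + bcost ?b = 4" by simp
  have "run W (4 + n * (4 + 1000 * (n + 1) * (n + 1))) (While ?b step_prog) s s'"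
    using s'(1) unfolding bc by (rule run_mono[OF _ le])
  moreover have "expr_size \<tau> = length (code \<tau>)" by (simp add: length_code)
  ultimately show ?thesis using s'(3) \<tau> by (intro exI[of _ s'] exI[of _ \<tau>]) simp
qed

end

text \<open>The clique of the locale is \<open>core G\<close> because that is the set which
  \<open>core_prog\<close> writes to array 3.\<close>

lemma run_main_prog:
  assumes "input_split G n W (core G) I"
  shows "\<exists>s' \<tau>. run W (50 * (n + 1) * (n + 1) + (100 * (n + 1) * (n + 1) * (n + 1) +
      (50 * (n + 1) + (4 + n * (4 + 1000 * (n + 1) * (n + 1)))))) main_prog (input_state n G) s' \<and>
    outputs s' (code \<tau>) \<and> k_expression 5 \<tau> \<and> graph_of \<tau> = G \<and> expr_size \<tau> \<le> 30 * n"
proof -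
  interpret input_split G n W "core G" I by fact
  let ?s = "input_state n G"
  have s: "vars ?s 0 = n" "arrs ?s 0 = matrix" "arrs ?s 2 = (\<lambda>_. 0)" "arrs ?s 3 = (\<lambda>_. 0)" "arrs ?s 4 = (\<lambda>_. 0)"
    "outputs ?s []"
    by (auto simp: input_state_def matrix_def outputs_def fun_eq_iff)
  from run_deg_prog[OF s(1-3)] obtain s1 where s1: "run W (50 * (n + 1) * (n + 1)) deg_prog ?s s1" "arrs s1 2 = degrees"
    by blast
  note fr1 = run_frame[OF s1(1)]
  have p1: "vars s1 0 = n" "arrs s1 0 = matrix" "arrs s1 3 = (\<lambda>_. 0)" "arrs s1 4 = (\<lambda>_. 0)"
    using frame_vars[OF fr1, of 0] frame_arrs[OF fr1, of 0] frame_arrs[OF fr1, of 3] frame_arrs[OF fr1, of 4] s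
    by (simp_all add: deg_prog_def)
  have o1: "outputs s1 []" by (rule outputs_frame[OF s(6) fr1]) (simp_all add: deg_prog_def)
  from run_core_prog[OF p1(1,2) s1(2) p1(3)] obtain s2 where s2: "run W (100 * (n + 1) * (n + 1) * (n + 1)) core_prog s1 s2"
    "arrs s2 3 = (\<lambda>v. if v \<in> core G then 1 else 0)" by blast
  note fr2 = run_frame[OF s2(1)]
  have p2: "vars s2 0 = n" "arrs s2 0 = matrix" "arrs s2 2 = degrees" "arrs s2 4 = (\<lambda>_. 0)"
    using frame_vars[OF fr2, of 0] frame_arrs[OF fr2, of 0] frame_arrs[OF fr2, of 2] frame_arrs[OF fr2, of 4] p1 s1(2)
    by (simp_all add: core_prog_def)
  have o2: "outputs s2 []" by (rule outputs_frame[OF o1 fr2]) (simp_all add: core_prog_def)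
  from run_init_prog[OF p2(1,4)] obtain s3 where s3: "run W (50 * (n + 1)) init_prog s2 s3" "vars s3 5 = 1"
    "arrs s3 4 = (\<lambda>v. if v < n then 1 else 0)" by blast
  note fr3 = run_frame[OF s3(1)]
  have p3: "config (\<lambda>v. if v < n then 1 else 0) 1 s3"
    using frame_vars[OF fr3, of 0] frame_arrs[OF fr3, of 0] frame_arrs[OF fr3, of 2] frame_arrs[OF fr3, of 3] p2 s2(2) s3
    unfolding config_def by (simp add: init_prog_def)
  have o3: "outputs s3 []" by (rule outputs_frame[OF o2 fr3]) (simp_all add: init_prog_def)
  from run_main_loop[OF p3 o3 invar_init] obtain s4 \<tau>
    where s4: "run W (4 + n * (4 + 1000 * (n + 1) * (n + 1))) (While (Less (Const 0) (Var 5)) step_prog) s3 s4"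
      "outputs s4 (code \<tau>)" "realizes (pverts G) \<tau>" "expr_size \<tau> \<le> 30 * n" by blast
  have "parcs G \<inter> pverts G \<times> pverts G = parcs G" using in_arcsD1 in_arcsD2 by auto
  then have "k_expression 5 \<tau>" "graph_of \<tau> = G" using s4(3) unfolding realizes_def by simp_all
  moreover note run_Seq[OF s1(1) run_Seq[OF s2(1) run_Seq[OF s3(1) s4(1)]], folded main_prog_def]
  ultimately show ?thesis using s4(2,4) by blast
qed

text \<open>The polynomial is cubic with coefficients summing to 5108, and for positive
  \<open>n\<close> each power is at most \<open>n ^ 4\<close>; 6000 is a round bound.\<close>

lemma time_bound:
  fixes n :: nat
  assumes "1 \<le> n"
  shows "50 * (n + 1) * (n + 1) + (100 * (n + 1) * (n + 1) * (n + 1) +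
      (50 * (n + 1) + (4 + n * (4 + 1000 * (n + 1) * (n + 1))))) \<le> 6000 * n ^ 4"
proof -
  have "50 * (n + 1) * (n + 1) + (100 * (n + 1) * (n + 1) * (n + 1) +
      (50 * (n + 1) + (4 + n * (4 + 1000 * (n + 1) * (n + 1))))) = 1100 * n ^ 3 + 2350 * n ^ 2 + 1454 * n + 204"
    by (simp add: power2_eq_square power3_eq_cube algebra_simps)
  moreover have "n ^ 3 \<le> n ^ 4" "n ^ 2 \<le> n ^ 4" "n ^ 1 \<le> n ^ 4" "n ^ 0 \<le> n ^ 4"
    by (rule power_increasing; use assms in simp)+
  ultimately show ?thesis unfolding power_0 power_one_right by linarith
qed

text \<open>As \<open>n + 1\<close> is at least 2, six factors contribute 64 and the remaining
  square dominates. At \<open>n = 1\<close> the value to exceed is 141, so 8 is the least exponent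
  that works.\<close>

lemma word_bound:
  fixes n :: nat
  assumes n: "1 \<le> n"
  shows "n * n + 40 * n + 100 < (n + 1) ^ 8"
proof -
  have "64 * (n + 1) ^ 2 = 2 ^ 6 * (n + 1) ^ 2" by simp
  also have "\<dots> \<le> (n + 1) ^ 6 * (n + 1) ^ 2" using n by (intro mult_le_mono1 power_mono) auto
  also have "\<dots> = (n + 1) ^ 8" by (simp flip: power_add)
  finally have "64 * (n + 1) ^ 2 \<le> (n + 1) ^ 8" .
  moreover have "n * n + 40 * n + 100 < 64 * (n + 1) ^ 2" using n by (simp add: power2_eq_square algebra_simps)
  ultimately show ?thesis by linarith
qed

lemma clique_Sperner_clique_width:
  assumes "pair_graph G" "pverts G \<noteq> {}" "\<not> has_induced G H_graph" "clique_Sperner G"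
  shows "clique_width G \<le> 5"
proof -
  obtain K I where KI: "split_partition G K I"
    "\<And>u v. u \<in> K \<Longrightarrow> v \<in> K \<Longrightarrow> nbhd G u \<inter> I \<subseteq> nbhd G v \<inter> I \<Longrightarrow> u = v"
    using assms(4) unfolding clique_Sperner_def by blast
  then interpret one_Sperner_split G K I
    using assms by (intro one_Sperner_splitI)
  show ?thesis using clique_width_le_5 assms(2) .
qed

lemma exec_main_prog:
  assumes G: "pair_graph G" "pverts G = {0..<n}" "1 \<le> n" "\<not> has_induced G H_graph" "clique_Sperner G"
  shows "\<exists>t s \<tau>. exec ((n + 1) ^ 8) main_prog (input_state n G) t s \<and> t \<le> 6000 * n ^ 4 \<and>
    outputs s (code \<tau>) \<and> k_expression 5 \<tau> \<and> graph_of \<tau> = G \<and> expr_size \<tau> \<le> 6000 * n"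
proof -
  obtain K I where KI: "split_partition G K I"
    "\<And>u v. u \<in> K \<Longrightarrow> v \<in> K \<Longrightarrow> nbhd G u \<inter> I \<subseteq> nbhd G v \<inter> I \<Longrightarrow> u = v"
    using G(5) unfolding clique_Sperner_def by blast
  have ex: "\<exists>I'. split_partition G (core G) I' \<and>
      (\<forall>u \<in> core G. \<forall>v \<in> core G. nbhd G u \<inter> I' \<subseteq> nbhd G v \<inter> I' \<longrightarrow> u = v)"
    by (rule split_partition_core[OF G(1) KI(1)]) (rule KI(2))
  obtain I' where I': "split_partition G (core G) I'"
    "\<And>u v. u \<in> core G \<Longrightarrow> v \<in> core G \<Longrightarrow> nbhd G u \<inter> I' \<subseteq> nbhd G v \<inter> I' \<Longrightarrow> u = v"
    using ex by (elim exE conjE) blast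
  have "one_Sperner_split G (core G) I'"
    by (rule one_Sperner_splitI[OF G(1) I'(1) G(4) I'(2)])
  moreover have "input_graph G n ((n + 1) ^ 8)"
    using G word_bound[OF G(3)] unfolding input_graph_def input_graph_axioms_def by simp
  ultimately have "input_split G n ((n + 1) ^ 8) (core G) I'"
    unfolding input_split_def by blast
  from run_main_prog[OF this] obtain s \<tau> where s: "run ((n + 1) ^ 8) (50 * (n + 1) * (n + 1) + (100 * (n + 1) * (n + 1) * (n + 1) +
      (50 * (n + 1) + (4 + n * (4 + 1000 * (n + 1) * (n + 1)))))) main_prog (input_state n G) s"
    "outputs s (code \<tau>)" "k_expression 5 \<tau>" "graph_of \<tau> = G" "expr_size \<tau> \<le> 30 * n" by blast
  from s(1) obtain t where "exec ((n + 1) ^ 8) main_prog (input_state n G) t s" "t \<le> 6000 * n ^ 4"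
    using time_bound[OF G(3)] unfolding run_def by (meson le_trans)
  \<comment> \<open>One constant has to serve for both time and size, so the bound
    \<open>30 * n\<close> is weakened.\<close>
  moreover have "expr_size \<tau> \<le> 6000 * n" using s(5) by simp
  ultimately show ?thesis using s(2-4) by blast
qed

theorem theorem6p2:
  shows "(\<forall>G :: 'a pair_pre_digraph.
            pair_graph G \<and> pverts G \<noteq> {} \<and>
            split_graph G \<and> \<not> has_induced G H_graph \<and> clique_Sperner G
            \<longrightarrow> clique_width G \<le> 5) \<and>
         (\<exists>(prog :: com) (C :: nat) (d :: nat).
            \<forall>(n :: nat) (G :: nat pair_pre_digraph).
              pair_graph G \<and> pverts G = {0..<n} \<and> n \<ge> 1 \<and>
              split_graph G \<and> \<not> has_induced G H_graph \<and> clique_Sperner G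
              \<longrightarrow> (\<exists>(t :: nat) (s :: state) (\<tau> :: nat cw_expr).
                     exec ((n + 1) ^ d) prog (input_state n G) t s \<and>
                     t \<le> C * n ^ 4 \<and>
                     outputs s (code \<tau>) \<and>
                     k_expression 5 \<tau> \<and> graph_of \<tau> = G \<and>
                     expr_size \<tau> \<le> C * n))"
proof (rule conjI)
  show "\<forall>G :: 'a pair_pre_digraph. pair_graph G \<and> pverts G \<noteq> {} \<and>
      split_graph G \<and> \<not> has_induced G H_graph \<and> clique_Sperner G \<longrightarrow> clique_width G \<le> 5"
    using clique_Sperner_clique_width by blast
  show "\<exists>(prog :: com) (C :: nat) (d :: nat). \<forall>(n :: nat) (G :: nat pair_pre_digraph).
      pair_graph G \<and> pverts G = {0..<n} \<and> n \<ge> 1 \<and>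
      split_graph G \<and> \<not> has_induced G H_graph \<and> clique_Sperner G
      \<longrightarrow> (\<exists>(t :: nat) (s :: state) (\<tau> :: nat cw_expr).
        exec ((n + 1) ^ d) prog (input_state n G) t s \<and> t \<le> C * n ^ 4 \<and> outputs s (code \<tau>) \<and>
        k_expression 5 \<tau> \<and> graph_of \<tau> = G \<and> expr_size \<tau> \<le> C * n)"
    by (intro exI[of _ main_prog] exI[of _ "6000 :: nat"] exI[of _ "8 :: nat"] allI impI exec_main_prog) blast+
qed

end
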